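(* Let $n\ge2$. On the set $\bigsqcup_{\lambda,\rho\in\mathbb S}\mathrm{SST}(\lambda/\rho,n)^2$, the families of Kashiwara operators $\{E^{(1)}_i,F^{(1)}_i:0\le i\le n-1\}$ and $\{E^{(2)}_i,F^{(2)}_i:0\le i\le n-1\}$ commute with each other, i.e. $G^{(1)}\circ G^{(2)}=G^{(2)}\circ G^{(1)}$ for every $G^{(1)}$ in the first family and $G^{(2)}$ in the second (with the convention $G(\mathbf 0)=\mathbf 0$). That is, they equip $\bigsqcup_{\lambda,\rho}\mathrm{SST}(\lambda/\rho,n)^2$ with an $(\widehat{\mathfrak{sl}}_n\oplus\widehat{\mathfrak{sl}}_n)$-crystal structure.
   Context: A signature of length $\ell\ge0$ is a sequence of integers $\lambda=(\lambda_1\ge\dots\ge\lambda_\ell)$; $\mathbb S_\ell$ is the set of these, $\mathbb S=\bigsqcup_{\ell\ge0}\mathbb S_\ell$. Conjugate: $\lambda'_x=\#\{j:\lambda_j\ge x\}$, $x\in\mathbb Z$. $\kappa\preceq\mu$ (same length) means $\mu_1\ge\kappa_1\ge\mu_2\ge\kappa_2\ge\cdots$, equivalently $\mu'_x-\kappa'_x\in\{0,1\}$ for all $x$. For $\kappa\preceq\mu$, $\kappa\preceq\lambda$ in $\mathbb S_\ell$ put $a_x=\mu'_x-\kappa'_x$, $b_x=\lambda'_x-\kappa'_x$, $c_x=\max\{0,a_x+b_x+c_{x-1}-1\}$ with $c_x=0$ for $x\ll0$; $\overline{\mathsf F}(\kappa,\mu,\lambda)=\nu\in\mathbb S_\ell$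 is given by $\nu'_x=\mu'_x+\lambda'_x-\kappa'_x+c_{x-1}-c_x$. $\mathscr C_n=\mathbb Z^2/\sim$, $(x,y)\sim(x+kn,y-kn)$, $k\in\mathbb Z$. A Fomin field is a map $\boldsymbol\lambda:\mathscr C_n\to\mathbb S_\ell$ with $\boldsymbol\lambda(p)\preceq\boldsymbol\lambda(p+\mathbf e_i)$ ($i=1,2$) and $\boldsymbol\lambda(p+\mathbf e_1+\mathbf e_2)=\overline{\mathsf F}(\boldsymbol\lambda(p),\boldsymbol\lambda(p+\mathbf e_1),\boldsymbol\lambda(p+\mathbf e_2))$. For $\rho,\lambda$ of the same length, $P\in\mathrm{SST}(\lambda/\rho,n)$ is a chain $\rho=\lambda^{(0)}\preceq\dots\preceq\lambda^{(n)}=\lambda$; equivalently a filling where cells $(j,k)$ (row $j$, column $k$) with $\lambda^{(i-1)}_j<k\le\lambda^{(i)}_j$ have label $i$. For $P=(\lambda^{(i)})_i$, $Q=(\mu^{(i)})_i$ in $\mathrm{SST}(\lambda/\rho,n)$, $\boldsymbol\lambda[P,Q]$ is the unique Fomin field on $\mathscr C_n$ with $\boldsymbol\lambda(i,0)=\lambda^{(i)}$, $\boldsymbol\lambda(0,i)=\mu^{(i)}$, $0\le i\le n$. With $\boldsymbol\lambda=\boldsymbol\lambda[P,Q]$, $\iota_1(P,Q)=\big((\boldsymbol\lambda(1+i,0))_{i=0}^n,(\boldsymbol\lambda(1,i))_{i=0}^n\big)$ and $\iota_2(P,Q)=\big((\boldsymbol\lambda(i,1))_{i=0}^n,(\boldsymbol\lambda(0,1+i))_{i=0}^n\big)$;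 both are invertible. Kashiwara operators. For $1\le i\le n-1$ and a tableau $P$, take its row reading word (rows concatenated from bottom to top), replace each $i$ by ")" and each $i+1$ by "(", ignore other letters, delete successively adjacent pairs "(" ")" until the remaining string is $)\cdots)(\cdots($. $e_i(P)$ changes the $i+1$ of the leftmost remaining "(" into $i$ ($\mathbf 0$ if none); $f_i(P)$ changes the $i$ of the rightmost remaining ")" into $i+1$ ($\mathbf 0$ if none). On pairs, for $1\le i\le n-1$: $E^{(1)}_i=e_i\times\mathbf 1$, $F^{(1)}_i=f_i\times\mathbf 1$, $E^{(2)}_i=\mathbf 1\times e_i$, $F^{(2)}_i=\mathbf 1\times f_i$; and $E^{(k)}_0=\iota_k\circ E^{(k)}_1\circ\iota_k^{-1}$, $F^{(k)}_0=\iota_k\circ F^{(k)}_1\circ\iota_k^{-1}$ for $k=1,2$. Crystal structure means: for each $k$, with weight $\mathrm{wt}^{(k)}\in\mathbb Z^n$ counting the labels $1,\dots,n$ in the $k$-th tableau, $F_i^{(k)}(b)=b'$ iff $E_i^{(k)}(b')=b$; then $\mathrm{wt}^{(k)}(b')=\mathrm{wt}^{(k)}(b)-\epsilon_i+\epsilon_{i+1}$ (standard basis, $\epsilon_0=\epsilon_n$); and $\varphi_i-\varepsilon_i=\langle\epsilon_i-\epsilon_{i+1},\mathrm{wt}^{(k)}\rangle$ where $\varepsilon_i(b)=\max\{m:(E_i^{(k)})^mb\ne\mathbf 0\}$, $\varphi_i(b)=\max\{m:(F_i^{(k)})^mb\neq\mathbf 0\}$; the two structures commute. *)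

theory Defs
  imports Main
begin

section \<open>Signatures and the local rule\<close>

text \<open>Signatures are weakly decreasing integer lists; list positions count from 0, so
  the part \<open>\<lambda>\<^sub>j\<close> is \<open>lam ! (j - 1)\<close>.\<close>

definition signatures_of_length :: "nat \<Rightarrow> int list set" where
  "signatures_of_length l = {lam. length lam = l \<and> sorted_wrt (\<ge>) lam}"

definition signatures :: "int list set" where
  "signatures = (\<Union>l. signatures_of_length l)"

definition sig_conj :: "int list \<Rightarrow> int \<Rightarrow> int" where
  "sig_conj lam x = int (card {j. j < length lam \<and> lam ! j \<ge> x})"

definition interlaces :: "int list \<Rightarrow> int list \<Rightarrow> bool"  (infix "\<preceq>" 50) where
  "kap \<preceq> mu \<longleftrightarrow> kap \<in> signatures \<and> mu \<in> signatures \<and> length kap = length mu \<and>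
     (\<forall>j<length kap. kap ! j \<le> mu ! j) \<and>
     (\<forall>j. Suc j < length kap \<longrightarrow> mu ! Suc j \<le> kap ! j)"

text \<open>The sequence \<open>c\<close>; the recursion runs over all of \<open>\<int>\<close> and is pinned down by vanishing
  near \<open>-\<infinity>\<close>.\<close>

definition carry :: "int list \<Rightarrow> int list \<Rightarrow> int list \<Rightarrow> int \<Rightarrow> int" where
  "carry kap mu lam = (THE c. (\<exists>N. \<forall>x\<le>N. c x = 0) \<and>
     (\<forall>x. c x = max 0 ((sig_conj mu x - sig_conj kap x) + (sig_conj lam x - sig_conj kap x)
                        + c (x - 1) - 1)))"

definition fomin_rule :: "int list \<Rightarrow> int list \<Rightarrow> int list \<Rightarrow> int list" where
  "fomin_rule kap mu lam = (THE nu. nu \<in> signatures_of_length (length kap) \<and>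
     (\<forall>x. sig_conj nu x = sig_conj mu x + sig_conj lam x - sig_conj kap x
                          + carry kap mu lam (x - 1) - carry kap mu lam x))"

section \<open>Fomin fields on the cylinder\<close>

definition cylinder_rel :: "nat \<Rightarrow> ((int \<times> int) \<times> (int \<times> int)) set" where
  "cylinder_rel n = {((x, y), (x', y')). \<exists>k. x' = x + k * int n \<and> y' = y - k * int n}"

text \<open>A map on the cylinder is given as a map on \<open>\<int>\<^sup>2\<close> respecting \<^term>\<open>cylinder_rel n\<close>.\<close>

definition fomin_field :: "nat \<Rightarrow> (int \<times> int \<Rightarrow> int list) \<Rightarrow> bool" where
  "fomin_field n L \<longleftrightarrow>
     L respects cylinder_rel n \<and>
     (\<exists>l. \<forall>p. L p \<in> signatures_of_length l) \<and>
     (\<forall>x y. L (x, y) \<preceq> L (x + 1, y) \<and> L (x, y) \<preceq> L (x, y + 1) \<and>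
        L (x + 1, y + 1) = fomin_rule (L (x, y)) (L (x + 1, y)) (L (x, y + 1)))"

section \<open>Tableaux\<close>

text \<open>A tableau in \<open>SST(lam/rho, n)\<close> is the list of the \<open>n + 1\<close> signatures of its chain.\<close>

definition SST :: "int list \<Rightarrow> int list \<Rightarrow> nat \<Rightarrow> int list list set" where
  "SST lam rho n = {P. length P = Suc n \<and> P ! 0 = rho \<and> P ! n = lam \<and>
                       (\<forall>i<n. P ! i \<preceq> P ! Suc i)}"

text \<open>A tableau determines \<open>lam\<close> and \<open>rho\<close>, so this union is disjoint.\<close>

definition tableau_pairs :: "nat \<Rightarrow> (int list list \<times> int list list) set" where
  "tableau_pairs n = (\<Union>lam\<in>signatures. \<Union>rho\<in>signatures. SST lam rho n \<times> SST lam rho n)"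

definition field_of_pair ::
    "nat \<Rightarrow> int list list \<times> int list list \<Rightarrow> int \<times> int \<Rightarrow> int list" where
  "field_of_pair n b = (THE L. fomin_field n L \<and>
     (\<forall>i\<le>n. L (int i, 0) = fst b ! i \<and> L (0, int i) = snd b ! i))"

definition iota1 ::
    "nat \<Rightarrow> int list list \<times> int list list \<Rightarrow> int list list \<times> int list list" where
  "iota1 n b = (map (\<lambda>i. field_of_pair n b (1 + int i, 0)) [0..<Suc n],
                map (\<lambda>i. field_of_pair n b (1, int i)) [0..<Suc n])"

definition iota2 ::
    "nat \<Rightarrow> int list list \<times> int list list \<Rightarrow> int list list \<times> int list list" where
  "iota2 n b = (map (\<lambda>i. field_of_pair n b (int i, 1)) [0..<Suc n],
                map (\<lambda>i. field_of_pair n b (0, 1 + int i)) [0..<Suc n])"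

text \<open>The cells \<open>(row, column)\<close> of a tableau in reading order: bottom row (largest row index)
  first, each row from left to right.  Rows are numbered from 0, columns are arbitrary
  integers.\<close>

definition reading_cells :: "int list list \<Rightarrow> (nat \<times> int) list" where
  "reading_cells P =
     concat (map (\<lambda>j. map (Pair j) [hd P ! j + 1 .. last P ! j]) (rev [0..<length (hd P)]))"

definition cell_label :: "int list list \<Rightarrow> nat \<times> int \<Rightarrow> nat" where
  "cell_label P c = (THE i. 1 \<le> i \<and> i < length P \<and>
     P ! (i - 1) ! fst c < snd c \<and> snd c \<le> P ! i ! fst c)"

text \<open>Inverse passage, from a filling \<open>T\<close> of the shape of \<open>P\<close> to a chain: the \<open>i\<close>-th signature
  consists of the inner shape and the cells with label at most \<open>i\<close>.\<close>

definition refill :: "int list list \<Rightarrow> (nat \<times> int \<Rightarrow> nat) \<Rightarrow> int list list" where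
  "refill P T = map (\<lambda>i. map (\<lambda>j. hd P ! j +
       int (card {k. hd P ! j < k \<and> k \<le> last P ! j \<and> T (j, k) \<le> i})) [0..<length (hd P)])
     [0..<length P]"

definition label_count :: "int list list \<Rightarrow> nat \<Rightarrow> int" where
  "label_count P i = int (card {c \<in> set (reading_cells P). cell_label P c = i})"

section \<open>Kashiwara operators\<close>

text \<open>The value \<^const>\<open>None\<close> plays the role of the zero symbol.  The bracket word is kept as a list
  of cells: a cell with label \<open>i + 1\<close> is an opening bracket, one with label \<open>i\<close> a closing
  bracket.  One step deletes the first adjacent matching pair, if there is any.\<close>

fun delete_pair :: "(nat \<times> int \<Rightarrow> nat) \<Rightarrow> nat \<Rightarrow> (nat \<times> int) list \<Rightarrow> (nat \<times> int) list" where
  "delete_pair T i (c # d # w) =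
     (if T c = Suc i \<and> T d = i then w else c # delete_pair T i (d # w))"
| "delete_pair T i w = w"

text \<open>As many steps as the word has letters exhaust all deletions.\<close>

definition remaining_cells :: "nat \<Rightarrow> int list list \<Rightarrow> (nat \<times> int) list" where
  "remaining_cells i P =
     (let w = filter (\<lambda>c. cell_label P c \<in> {i, Suc i}) (reading_cells P)
      in (delete_pair (cell_label P) i ^^ length w) w)"

definition kashiwara_e :: "nat \<Rightarrow> int list list \<Rightarrow> int list list option" where
  "kashiwara_e i P =
     (let w = filter (\<lambda>c. cell_label P c = Suc i) (remaining_cells i P)
      in if w = [] then None else Some (refill P ((cell_label P)(hd w := i))))"

definition kashiwara_f :: "nat \<Rightarrow> int list list \<Rightarrow> int list list option" where
  "kashiwara_f i P =
     (let w = filter (\<lambda>c. cell_label P c = i) (remaining_cells i P)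
      in if w = [] then None else Some (refill P ((cell_label P)(last w := Suc i))))"

definition on_first :: "('a \<Rightarrow> 'a option) \<Rightarrow> 'a \<times> 'a \<Rightarrow> ('a \<times> 'a) option" where
  "on_first g b = map_option (\<lambda>P. (P, snd b)) (g (fst b))"

definition on_second :: "('a \<Rightarrow> 'a option) \<Rightarrow> 'a \<times> 'a \<Rightarrow> ('a \<times> 'a) option" where
  "on_second g b = map_option (\<lambda>Q. (fst b, Q)) (g (snd b))"

definition conjugate_by :: "'b set \<Rightarrow> ('b \<Rightarrow> 'b) \<Rightarrow> ('b \<Rightarrow> 'b option) \<Rightarrow> 'b \<Rightarrow> 'b option" where
  "conjugate_by X h G b = map_option h (G (inv_into X h b))"

definition E1 ::
    "nat \<Rightarrow> nat \<Rightarrow> int list list \<times> int list list \<Rightarrow> (int list list \<times> int list list) option" where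
  "E1 n i = (if i = 0 then conjugate_by (tableau_pairs n) (iota1 n) (on_first (kashiwara_e 1))
             else on_first (kashiwara_e i))"

definition F1 ::
    "nat \<Rightarrow> nat \<Rightarrow> int list list \<times> int list list \<Rightarrow> (int list list \<times> int list list) option" where
  "F1 n i = (if i = 0 then conjugate_by (tableau_pairs n) (iota1 n) (on_first (kashiwara_f 1))
             else on_first (kashiwara_f i))"

definition E2 ::
    "nat \<Rightarrow> nat \<Rightarrow> int list list \<times> int list list \<Rightarrow> (int list list \<times> int list list) option" where
  "E2 n i = (if i = 0 then conjugate_by (tableau_pairs n) (iota2 n) (on_second (kashiwara_e 1))
             else on_second (kashiwara_e i))"

definition F2 ::
    "nat \<Rightarrow> nat \<Rightarrow> int list list \<times> int list list \<Rightarrow> (int list list \<times> int list list) option" where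
  "F2 n i = (if i = 0 then conjugate_by (tableau_pairs n) (iota2 n) (on_second (kashiwara_f 1))
             else on_second (kashiwara_f i))"

definition wt1 :: "int list list \<times> int list list \<Rightarrow> nat \<Rightarrow> int" where
  "wt1 b = label_count (fst b)"

definition wt2 :: "int list list \<times> int list list \<Rightarrow> nat \<Rightarrow> int" where
  "wt2 b = label_count (snd b)"

section \<open>Crystals\<close>

text \<open>Vectors of \<open>\<int>\<^sup>n\<close> are functions read on the indices \<open>1, \<dots>, n\<close>; \<open>eps n i\<close> is the standard
  basis vector, with \<open>eps n 0 = eps n n\<close>.\<close>

definition eps :: "nat \<Rightarrow> nat \<Rightarrow> nat \<Rightarrow> int" where
  "eps n i j = (if j = (if i = 0 then n else i) then 1 else 0)"

text \<open>The exponents \<open>m\<close> with \<open>G\<^sup>m b\<close> nonzero; zero is sent to zero.\<close>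

definition string_exponents :: "('b \<Rightarrow> 'b option) \<Rightarrow> 'b \<Rightarrow> nat set" where
  "string_exponents G b = {m. ((\<lambda>x. Option.bind x G) ^^ m) (Some b) \<noteq> None}"

text \<open>Finiteness of the exponent sets says that the maxima defining \<open>\<epsilon>\<^sub>i\<close> and \<open>\<phi>\<^sub>i\<close>
  exist.\<close>

definition affine_crystal ::
    "nat \<Rightarrow> 'b set \<Rightarrow> (nat \<Rightarrow> 'b \<Rightarrow> 'b option) \<Rightarrow> (nat \<Rightarrow> 'b \<Rightarrow> 'b option) \<Rightarrow>
     ('b \<Rightarrow> nat \<Rightarrow> int) \<Rightarrow> bool" where
  "affine_crystal n X E F wt \<longleftrightarrow> (\<forall>i<n.
     (\<forall>b\<in>X. \<forall>b'. E i b = Some b' \<or> F i b = Some b' \<longrightarrow> b' \<in> X) \<and>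
     (\<forall>b\<in>X. \<forall>b'\<in>X. F i b = Some b' \<longleftrightarrow> E i b' = Some b) \<and>
     (\<forall>b\<in>X. \<forall>b'\<in>X. F i b = Some b' \<longrightarrow>
        (\<forall>j\<in>{1..n}. wt b' j = wt b j - eps n i j + eps n (Suc i) j)) \<and>
     (\<forall>b\<in>X. finite (string_exponents (E i) b) \<and> finite (string_exponents (F i) b) \<and>
        int (Max (string_exponents (F i) b)) - int (Max (string_exponents (E i) b))
          = (\<Sum>j=1..n. (eps n i j - eps n (Suc i) j) * wt b j)))"

definition commute_on ::
    "'b set \<Rightarrow> ('b \<Rightarrow> 'b option) \<Rightarrow> ('b \<Rightarrow> 'b option) \<Rightarrow> bool" where
  "commute_on X G H \<longleftrightarrow> (\<forall>b\<in>X. Option.bind (H b) G = Option.bind (G b) H)"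

definition operator_family :: 
    "nat \<Rightarrow> (nat \<Rightarrow> 'b \<Rightarrow> 'b option) \<Rightarrow> (nat \<Rightarrow> 'b \<Rightarrow> 'b option) \<Rightarrow> ('b \<Rightarrow> 'b option) set" where
  "operator_family n E F = E ` {0..<n} \<union> F ` {0..<n}"

end

(* Signatures are handled through the columns x of their conjugates.  A horizontal strip is a 0/1
   sequence on the columns, the local rule passes one strip through another by means of a queue
   (the carry c), and the inverse rule has the same queue read from right to left.  Hence a Fomin
   field exists for every pair (P, Q) and is determined by it, and iota_k shifts the field.

   The operator f_i lowers the middle signature of kap, mu, nu in the column where the height
   2 mu - kap - nu, summed from the left, first attains its maximum.  The two adjacent squares
   above kap, mu, nu have two carries.  Lowering mu in column x0 moves one unit from the first
   carry to the second, until some column xh where it leaves the carries and lowers the signature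
   opposite to mu; xh is the corresponding column of the upper row.  So f_i commutes with iota_2
   and, by transposition, its companion on the second factor commutes with iota_1.  Since iota_1
   and iota_2 commute, conjugation extends this to the operators with index 0. *)

theory Submission
  imports Defs
begin

section \<open>Conjugates, queues and the local rule\<close>

text \<open>A change of one cell in \<open>mu\<close> alters both carries over a stretch of columns
  of unbounded length, so the effect of lowering cannot be checked column by column. What controls
  it is a conserved quantity. The pending brackets \<open>p\<close> of the lower row and
  \<open>ph\<close> of the upper row obey the recursion of a carry themselves: \<open>p\<close> is
  the carry of the bits \<open>d\<close> against the complement of the bits \<open>a\<close>. The
  four queues satisfy \<open>p = e + max 0 (ph - c)\<close>, and \<open>max 0 (c - ph)\<close>
  stores the units that are unmatched below and not yet unmatched above. The height is the bracket
  rule in column form. The reading word goes through rows from bottom to top, the height through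
  columns from left to right; both single out the same cell because the relevant maxima lie at ends
  of rows, where the height counts closing minus opening brackets read so far. Only \<open>f\<close>
  is followed through the squares. The operator \<open>e\<close> is its partial inverse, and the
  crystal axioms at index 0 are those at index 1 moved along a shift, which permutes the weight
  coordinates cyclically.\<close>

abbreviation sig :: "nat \<Rightarrow> int list set" where "sig \<equiv> signatures_of_length"
abbreviation cj :: "int list \<Rightarrow> int \<Rightarrow> int" where "cj \<equiv> sig_conj"

section \<open>Signatures as decreasing step functions on the columns\<close>

lemma sig_iff: "lam \<in> sig l \<longleftrightarrow> length lam = l \<and> (\<forall>i j. i \<le> j \<longrightarrow> j < l \<longrightarrow> lam ! j \<le> lam ! i)"
  unfolding signatures_of_length_def sorted_wrt_iff_nth_less
  by (auto simp: le_less)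

lemma sig_nth_antimono: "lam \<in> sig l \<Longrightarrow> i \<le> j \<Longrightarrow> j < l \<Longrightarrow> lam ! j \<le> lam ! i"
  by (simp add: sig_iff)

lemma sig_length: "lam \<in> sig l \<Longrightarrow> length lam = l"
  by (simp add: sig_iff)

lemma signatures_iff: "lam \<in> signatures \<longleftrightarrow> lam \<in> sig (length lam)"
  by (auto simp: signatures_def sig_iff)

lemma downclosed_eq_lessThan:
  fixes A :: "nat set"
  assumes "finite A" "\<And>i j. j \<in> A \<Longrightarrow> i \<le> j \<Longrightarrow> i \<in> A"
  shows "A = {..<card A}"
proof (cases "A = {}")
  case False
  have "A = {..Max A}"
    using assms False by (auto intro: Max_ge Max_in)
  then have "card A = Suc (Max A)"
    by (metis card_atMost)
  with \<open>A = {..Max A}\<close> show ?thesis by (simp add: lessThan_Suc_atMost)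
qed simp

text \<open>The rows reaching column \<open>x\<close> are closed under going up, so they are
  precisely the first \<open>cj lam x\<close> rows. This equivalence translates every statement
  about parts into one about columns and back.\<close>

lemma sig_conj_gt_iff:
  assumes "lam \<in> sig l" "j < l"
  shows "int j < cj lam x \<longleftrightarrow> x \<le> lam ! j"
proof -
  let ?A = "{j. j < length lam \<and> lam ! j \<ge> x}"
  have "?A = {..<card ?A}"
  proof (rule downclosed_eq_lessThan)
    fix i j assume "j \<in> ?A" "i \<le> j"
    then show "i \<in> ?A"
      using sig_nth_antimono[OF assms(1), of i j] sig_length[OF assms(1)] by auto
  qed simp
  then have "j \<in> ?A \<longleftrightarrow> j < card ?A" by blast
  then show ?thesis
    using assms by (auto simp: sig_conj_def sig_iff)
qed

lemma sig_conj_nonneg: "0 \<le> cj lam x"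
  by (simp add: sig_conj_def)

lemma sig_conj_le: "lam \<in> sig l \<Longrightarrow> cj lam x \<le> int l"
proof -
  assume "lam \<in> sig l"
  then have "{j. j < length lam \<and> lam ! j \<ge> x} \<subseteq> {..<l}" by (auto simp: sig_iff)
  from card_mono[OF _ this] show ?thesis by (simp add: sig_conj_def)
qed

lemma sig_conj_antimono: "x \<le> y \<Longrightarrow> cj lam y \<le> cj lam x"
  unfolding sig_conj_def by (auto intro!: card_mono)

lemma sig_conj_left:
  assumes "lam \<in> sig l"
  obtains N where "\<And>x. x \<le> N \<Longrightarrow> cj lam x = int l"
proof (cases l)
  case 0
  with assms show ?thesis by (intro that[of 0]) (simp add: sig_conj_def sig_iff)
next
  case (Suc k)
  show ?thesis
  proof (rule that[of "lam ! k"])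
    fix x assume "x \<le> lam ! k"
    then have "int k < cj lam x" using sig_conj_gt_iff[OF assms, of k] Suc by auto
    with sig_conj_le[OF assms, of x] Suc show "cj lam x = int l" by linarith
  qed
qed

lemma sig_conj_right:
  assumes "lam \<in> sig l"
  obtains N where "\<And>x. x \<ge> N \<Longrightarrow> cj lam x = 0"
proof (cases l)
  case 0
  with assms show ?thesis by (intro that[of 0]) (simp add: sig_conj_def sig_iff)
next
  case (Suc k)
  show ?thesis
  proof (rule that[of "lam ! 0 + 1"])
    fix x assume "x \<ge> lam ! 0 + 1"
    then have "\<not> int 0 < cj lam x" using sig_conj_gt_iff[OF assms, of 0] Suc by auto
    with sig_conj_nonneg[of lam x] show "cj lam x = 0" by simp
  qed
qed

lemma sig_conj_bounds:
  assumes "kap \<in> sig l" "mu \<in> sig l" "lam \<in> sig l"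
  obtains N M where
    "\<And>x. x \<le> N \<Longrightarrow> cj kap x = int l \<and> cj mu x = int l \<and> cj lam x = int l"
    "\<And>x. x \<ge> M \<Longrightarrow> cj kap x = 0 \<and> cj mu x = 0 \<and> cj lam x = 0"
proof -
  obtain N1 N2 N3 where "\<And>x. x \<le> N1 \<Longrightarrow> cj kap x = int l" "\<And>x. x \<le> N2 \<Longrightarrow> cj mu x = int l" "\<And>x. x \<le> N3 \<Longrightarrow> cj lam x = int l"
    using sig_conj_left assms by metis
  moreover obtain M1 M2 M3 where "\<And>x. x \<ge> M1 \<Longrightarrow> cj kap x = 0" "\<And>x. x \<ge> M2 \<Longrightarrow> cj mu x = 0" "\<And>x. x \<ge> M3 \<Longrightarrow> cj lam x = 0"
    using sig_conj_right assms by metis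
  ultimately show ?thesis using that[of "min N1 (min N2 N3)" "max M1 (max M2 M3)"] by simp
qed

lemma sig_conj_inject:
  assumes "lam \<in> sig l" "mu \<in> sig l" "\<And>x. cj lam x = cj mu x"
  shows "lam = mu"
proof (rule nth_equalityI)
  show "length lam = length mu" using assms by (simp add: sig_iff)
  fix j assume "j < length lam"
  then have j: "j < l" using assms by (simp add: sig_iff)
  have "x \<le> lam ! j \<longleftrightarrow> x \<le> mu ! j" for x
    using sig_conj_gt_iff[OF assms(1) j, of x] sig_conj_gt_iff[OF assms(2) j, of x] assms(3) by simp
  then show "lam ! j = mu ! j" by (meson order_antisym order_refl)
qed

lemma int_step_antimono:
  fixes g :: "int \<Rightarrow> int"
  assumes "\<And>x. g (x + 1) \<le> g x" "x \<le> y"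
  shows "g y \<le> g x"
  using assms(2) by (induction y rule: int_ge_induct) (use assms(1) order_trans in blast)+

text \<open>Row \<open>j\<close> has to end at the last column where \<open>g\<close> exceeds
  \<open>j\<close>. All later constructions of signatures give the column heights and appeal to this
  lemma.\<close>

lemma sig_conj_surj:
  fixes g :: "int \<Rightarrow> int"
  assumes step: "\<And>x. g (x + 1) \<le> g x" and lo: "\<And>x. x \<le> N \<Longrightarrow> g x = int l"
    and hi: "\<And>x. x \<ge> M \<Longrightarrow> g x = 0"
  obtains lam where "lam \<in> sig l" "\<And>x. cj lam x = g x"
proof -
  note anti = int_step_antimono[of g, OF step]
  \<comment> \<open>Columns are counted from \<open>N\<close>, which keeps the greatest element
    within the natural numbers; it exists because \<open>g N = int l\<close> exceeds every row index
    below \<open>l\<close> and \<open>g\<close> vanishes from \<open>M\<close> on.\<close>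
  define t where "t j = (GREATEST k. g (N + int k) > int j)" for j
  define lam where "lam = map (\<lambda>j. N + int (t j)) [0..<l]"
  have key: "x \<le> N + int (t j) \<longleftrightarrow> int j < g x" if "j < l" for x j
  proof -
    let ?P = "\<lambda>k. g (N + int k) > int j"
    have P0: "?P 0" using lo[of N] that by simp
    have bd: "k \<le> nat (M - N)" if "?P k" for k
    proof (rule ccontr)
      assume "\<not> k \<le> nat (M - N)"
      then have "N + int k \<ge> M" by linarith
      from hi[OF this] that show False by simp
    qed
    have Pt: "?P (t j)" unfolding t_def by (rule GreatestI_nat[of ?P, OF P0]) (use bd in auto)
    have mx: "k \<le> t j" if "?P k" for k unfolding t_def
      by (rule Greatest_le_nat[of ?P, OF that]) (use bd in auto)
    show ?thesis
    proof
      assume "x \<le> N + int (t j)"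
      from anti[OF this] Pt show "int j < g x" by linarith
    next
      assume a: "int j < g x"
      show "x \<le> N + int (t j)"
      proof (cases "x \<le> N")
        case False
        then have "g (N + int (nat (x - N))) > int j" using a by simp
        from mx[OF this] False show ?thesis by linarith
      qed linarith
    qed
  qed
  have nonneg: "0 \<le> g x" for x
    using anti[of x "max x M"] hi[of "max x M"] by simp
  have upper: "g x \<le> int l" for x
    using anti[of "min x N" x] lo[of "min x N"] by simp
  have sig: "lam \<in> sig l"
    unfolding sig_iff
  proof (intro conjI allI impI)
    fix i j assume "i \<le> j" "j < l"
    have "int j < g (N + int (t j))" using key[OF \<open>j < l\<close>, of "N + int (t j)"] by simp
    then have "int i < g (N + int (t j))" using \<open>i \<le> j\<close> by linarith
    then show "lam ! j \<le> lam ! i" using key[of i] \<open>i \<le> j\<close> \<open>j < l\<close> by (simp add: lam_def)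
  qed (simp add: lam_def)
  have "cj lam x = g x" for x
  proof -
    have "{j. j < length lam \<and> lam ! j \<ge> x} = {..<nat (g x)}"
      using key upper[of x] by (auto simp: lam_def)
    then show ?thesis using nonneg[of x] by (simp add: sig_conj_def)
  qed
  with sig show ?thesis using that by blast
qed

text \<open>If the column heights at \<open>x\<close> differ by a wrong amount, the smaller of them,
  taken as a row index, points to parts that violate an interlacing inequality. For the converse the
  columns are chosen as parts of \<open>kap\<close> and \<open>mu\<close>.\<close>

lemma interlaces_iff:
  assumes "kap \<in> sig l" "mu \<in> sig l"
  shows "kap \<preceq> mu \<longleftrightarrow> (\<forall>x. cj mu x - cj kap x \<in> {0, 1})"
proof
  assume a: "kap \<preceq> mu"
  show "\<forall>x. cj mu x - cj kap x \<in> {0, 1}"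
  proof
    fix x
    have 1: "cj kap x \<le> cj mu x"
    proof (rule ccontr)
      assume n: "\<not> ?thesis"
      define j where "j = nat (cj mu x)"
      have j: "int j < cj kap x" "\<not> int j < cj mu x" using n sig_conj_nonneg[of mu x] by (auto simp: j_def)
      with sig_conj_le[OF assms(1), of x] have "j < l" by linarith
      then show False using j sig_conj_gt_iff[OF assms(1)] sig_conj_gt_iff[OF assms(2)] a assms
        by (force simp: interlaces_def sig_iff)
    qed
    have 2: "cj mu x \<le> cj kap x + 1"
    proof (rule ccontr)
      assume n: "\<not> ?thesis"
      define j where "j = nat (cj kap x)"
      have j: "int (Suc j) < cj mu x" "\<not> int j < cj kap x" using n sig_conj_nonneg[of kap x] by (auto simp: j_def)
      with sig_conj_le[OF assms(2), of x] have "Suc j < l" by linarith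
      then have "x \<le> mu ! Suc j" "\<not> x \<le> kap ! j" "mu ! Suc j \<le> kap ! j"
        using j sig_conj_gt_iff[OF assms(1), of j] sig_conj_gt_iff[OF assms(2), of "Suc j"] a assms
        by (auto simp: interlaces_def sig_iff)
      then show False by linarith
    qed
    from 1 2 show "cj mu x - cj kap x \<in> {0, 1}" by auto
  qed
next
  assume a: "\<forall>x. cj mu x - cj kap x \<in> {0, 1}"
  have le: "cj kap x \<le> cj mu x" "cj mu x \<le> cj kap x + 1" for x using a[rule_format, of x] by auto
  have "kap ! j \<le> mu ! j" if "j < l" for j
    using sig_conj_gt_iff[OF assms(1) that, of "kap ! j"] sig_conj_gt_iff[OF assms(2) that, of "kap ! j"]
      le[of "kap ! j"] by linarith
  moreover have "mu ! Suc j \<le> kap ! j" if "Suc j < l" for j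
    using sig_conj_gt_iff[OF assms(1) , of j "mu ! Suc j"] sig_conj_gt_iff[OF assms(2) that, of "mu ! Suc j"]
      le[of "mu ! Suc j"] that by auto
  ultimately show "kap \<preceq> mu" using assms by (auto simp: interlaces_def signatures_iff sig_iff)
qed

lemma interlaces_sig:
  assumes "kap \<preceq> mu"
  shows "kap \<in> sig (length kap)" "mu \<in> sig (length kap)"
  using assms by (auto simp: interlaces_def signatures_iff)

lemma interlaces_bits:
  assumes "kap \<preceq> mu" shows "cj mu x - cj kap x \<in> {0, 1}"
  using interlaces_iff interlaces_sig assms by blast

text \<open>Here \<open>g x\<close> is the net arrival at column \<open>x\<close>. Allowing signed
  arrivals lets one recursion describe the carry of the local rule, its reversal and the pending
  brackets.\<close>

definition queue :: "(int \<Rightarrow> int) \<Rightarrow> (int \<Rightarrow> int) \<Rightarrow> bool" where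
  "queue g c \<longleftrightarrow> (\<exists>N. \<forall>x\<le>N. c x = 0) \<and> (\<forall>x. c x = max 0 (g x + c (x - 1)))"

lemma queue_rec: "queue g c \<Longrightarrow> c x = max 0 (g x + c (x - 1))"
  unfolding queue_def by blast

lemma queue_nonneg: "queue g c \<Longrightarrow> 0 \<le> c x"
  using queue_rec[of g c x] by linarith

lemma queue_leftE:
  assumes "queue g c" obtains N where "\<And>x. x \<le> N \<Longrightarrow> c x = 0"
  using assms unfolding queue_def by blast

lemma left_induct [consumes 1, case_names left step]:
  fixes N :: int
  assumes "\<And>x. x \<le> N \<Longrightarrow> P x" "\<And>x. P (x - 1) \<Longrightarrow> P x"
  shows "P x"
proof (cases "x \<le> N")
  case False
  then have "N \<le> x" by simp
  then show ?thesis
  proof (induction x rule: int_ge_induct)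
    case base show ?case using assms(1) by simp
  next
    case (step i) then show ?case using assms(2)[of "i + 1"] by simp
  qed
qed (use assms in blast)

lemma queue_unique:
  assumes "queue g c" "queue g c'" shows "c = c'"
proof
  fix x
  obtain N where N: "\<And>x. x \<le> N \<Longrightarrow> c x = 0" using queue_leftE[OF assms(1)] by blast
  obtain N' where N': "\<And>x. x \<le> N' \<Longrightarrow> c' x = 0" using queue_leftE[OF assms(2)] by blast
  show "c x = c' x"
  proof (rule left_induct[of "min N N'" "\<lambda>x. c x = c' x"])
    show "c x = c' x" if "x \<le> min N N'" for x using N N' that by simp
    show "c x = c' x" if "c (x - 1) = c' (x - 1)" for x
      using that queue_rec[OF assms(1), of x] queue_rec[OF assms(2), of x] by simp
  qed
qed

lemma queue_exists:
  assumes "\<And>x. x \<le> N \<Longrightarrow> g x \<le> 0"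
  obtains c where "queue g c"
proof -
  define r where "r = rec_nat (0::int) (\<lambda>k v. max 0 (g (N + 1 + int k) + v))"
  define c where "c x = r (nat (x - N))" for x
  have "queue g c"
    unfolding queue_def
  proof (intro conjI exI[of _ N] allI impI)
    show "c x = 0" if "x \<le> N" for x using that by (simp add: c_def r_def)
    show "c x = max 0 (g x + c (x - 1))" for x
    proof (cases "x \<le> N")
      case True then show ?thesis using assms[OF True] by (simp add: c_def r_def)
    next
      case False
      then have "nat (x - N) = Suc (nat (x - 1 - N))" "N + 1 + int (nat (x - 1 - N)) = x" by auto
      then show ?thesis by (simp add: c_def r_def)
    qed
  qed
  then show ?thesis using that by blast
qed

text \<open>Net arrivals of at most -1 drain the queue by one per column, so it is empty
  \<open>c M\<close> columns after \<open>M\<close>.\<close>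

lemma queue_right:
  assumes "queue g c" "\<And>x. x \<ge> M \<Longrightarrow> g x \<le> -1"
  obtains K where "\<And>x. x \<ge> K \<Longrightarrow> c x = 0"
proof -
  have "c x \<le> max 0 (c M - (x - M))" if "x \<ge> M" for x
    using that
  proof (induction x rule: int_ge_induct)
    case (step i)
    then show ?case using queue_rec[OF assms(1), of "i + 1"] assms(2)[of "i + 1"] by auto
  qed simp
  then have "c x = 0" if "x \<ge> M + c M" for x
    using that queue_nonneg[OF assms(1), of x] queue_nonneg[OF assms(1), of M]
    by (smt (verit))
  then show ?thesis using that by blast
qed

text \<open>The carry is an explicit argument instead of being hidden behind the definite
  descriptions in \<open>carry\<close> and \<open>fomin_rule\<close>, because later arguments modify
  the carry itself.\<close>

definition fomin_square ::
    "int list \<Rightarrow> int list \<Rightarrow> int list \<Rightarrow> int list \<Rightarrow> (int \<Rightarrow> int) \<Rightarrow> bool" where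
  "fomin_square kap mu lam nu c \<longleftrightarrow> kap \<preceq> mu \<and> kap \<preceq> lam \<and> nu \<in> sig (length kap) \<and>
     queue (\<lambda>x. cj mu x + cj lam x - 2 * cj kap x - 1) c \<and>
     (\<forall>x. cj nu x = cj mu x + cj lam x - cj kap x + c (x - 1) - c x)"

lemma fomin_square_exists:
  assumes "kap \<preceq> mu" "kap \<preceq> lam"
  obtains nu c where "fomin_square kap mu lam nu c"
proof -
  define l where "l = length kap"
  define g where "g = (\<lambda>x. cj mu x + cj lam x - 2 * cj kap x - 1)"
  have sg: "kap \<in> sig l" "mu \<in> sig l" "lam \<in> sig l"
    using interlaces_sig assms by (auto simp: l_def)
  obtain N M where N: "\<And>x. x \<le> N \<Longrightarrow> cj kap x = int l \<and> cj mu x = int l \<and> cj lam x = int l"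
    and M: "\<And>x. x \<ge> M \<Longrightarrow> cj kap x = 0 \<and> cj mu x = 0 \<and> cj lam x = 0"
    using sig_conj_bounds[OF sg] by blast
  have "g x \<le> 0" if "x \<le> N" for x using that N by (simp add: g_def)
  then obtain c where c: "queue g c" using queue_exists[of _ g] by blast
  have "g x \<le> -1" if "x \<ge> M" for x using that M by (simp add: g_def)
  from queue_right[OF c this] obtain K where K: "\<And>x. x \<ge> K \<Longrightarrow> c x = 0" by blast
  from queue_leftE[OF c] obtain N' where N': "\<And>x. x \<le> N' \<Longrightarrow> c x = 0" by blast
  define f where "f x = cj mu x + cj lam x - cj kap x + c (x - 1) - c x" for x
  have bits: "cj mu x - cj kap x \<in> {0,1}" "cj lam x - cj kap x \<in> {0,1}" for x
    using interlaces_bits assms by blast+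
  \<comment> \<open>Over \<open>kap\<close>, a column gains one cell as soon as a strip or the
    incoming carry offers one; any surplus is carried on.\<close>
  have f_val: "f x = cj kap x + (if cj mu x = cj kap x \<and> cj lam x = cj kap x \<and> c (x - 1) = 0 then 0 else 1)" for x
    using bits[of x] queue_rec[OF c, of x] queue_nonneg[OF c, of "x-1"]
    by (auto simp: f_def g_def)
  \<comment> \<open>If column \<open>x\<close> gains nothing, it carries nothing out either. A cell
    gained at \<open>x + 1\<close> then comes from a strip and is bounded by the height of
    \<open>mu\<close> or \<open>lam\<close> at \<open>x\<close>, which keeps \<open>f\<close>
    decreasing.\<close>
  have f_c: "c x = 0" if "cj mu x = cj kap x" "cj lam x = cj kap x" "c (x - 1) = 0" for x
    using that queue_rec[OF c, of x] by (simp add: g_def)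
  have "f (x + 1) \<le> f x" for x
    using f_val[of x] f_val[of "x + 1"] f_c[of x] bits[of "x + 1"] sig_conj_antimono[of x "x+1" kap]
      sig_conj_antimono[of x "x+1" mu] sig_conj_antimono[of x "x+1" lam]
    by (auto split: if_splits)
  moreover have "f x = int l" if "x \<le> min N N'" for x using that N N' by (simp add: f_def)
  moreover have "f x = 0" if "x \<ge> max M (K + 1)" for x using that M K by (simp add: f_def)
  ultimately obtain nu where "nu \<in> sig l" "\<And>x. cj nu x = f x"
    using sig_conj_surj[of f] by metis
  with c have "fomin_square kap mu lam nu c"
    using assms by (simp add: fomin_square_def f_def g_def l_def)
  then show ?thesis using that by blast
qed

lemma fomin_rule_eq:
  assumes "fomin_square kap mu lam nu c"
  shows "fomin_rule kap mu lam = nu"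
proof -
  have c: "queue (\<lambda>x. cj mu x + cj lam x - 2 * cj kap x - 1) c"
    using assms by (simp add: fomin_square_def)
  have q: "(\<exists>N. \<forall>x\<le>N. c x = 0) \<and>
     (\<forall>x. c x = max 0 ((cj mu x - cj kap x) + (cj lam x - cj kap x) + c (x - 1) - 1)) \<longleftrightarrow>
     queue (\<lambda>x. cj mu x + cj lam x - 2 * cj kap x - 1) c" for c
    unfolding queue_def by (simp add: algebra_simps)
  have "carry kap mu lam = c"
    unfolding carry_def q using c queue_unique by blast
  then show ?thesis
    unfolding fomin_rule_def using assms
    by (intro the_equality) (auto simp: fomin_square_def intro: sig_conj_inject)
qed

lemma fomin_rule_square:
  assumes "kap \<preceq> mu" "kap \<preceq> lam"
  obtains c where "fomin_square kap mu lam (fomin_rule kap mu lam) c"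
  using fomin_square_exists[OF assms] fomin_rule_eq by metis

lemma fomin_square_swap: "fomin_square kap mu lam nu c \<Longrightarrow> fomin_square kap lam mu nu c"
  unfolding fomin_square_def by (simp add: algebra_simps)

lemma fomin_rule_commute:
  assumes "kap \<preceq> mu" "kap \<preceq> lam"
  shows "fomin_rule kap mu lam = fomin_rule kap lam mu"
  using fomin_rule_square[OF assms] fomin_rule_eq fomin_square_swap by metis

lemma fomin_square_interlaces:
  assumes "fomin_square kap mu lam nu c"
  shows "mu \<preceq> nu" "lam \<preceq> nu"
proof -
  have sg: "kap \<in> sig (length kap)" "mu \<in> sig (length kap)" "lam \<in> sig (length kap)" "nu \<in> sig (length kap)"
    using interlaces_sig assms by (auto simp: fomin_square_def)
  have c: "queue (\<lambda>x. cj mu x + cj lam x - 2 * cj kap x - 1) c"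
    using assms by (simp add: fomin_square_def)
  have bits: "cj mu x - cj kap x \<in> {0,1}" "cj lam x - cj kap x \<in> {0,1}" for x
    using interlaces_bits assms by (auto simp: fomin_square_def)
  have nu: "cj nu x = cj mu x + cj lam x - cj kap x + c (x - 1) - c x" for x
    using assms by (simp add: fomin_square_def)
  have "cj nu x - cj mu x \<in> {0,1}" "cj nu x - cj lam x \<in> {0,1}" for x
    using nu[of x] bits[of x] queue_rec[OF c, of x] queue_nonneg[OF c, of "x - 1"] by auto
  then show "mu \<preceq> nu" "lam \<preceq> nu" using interlaces_iff sg by blast+
qed

text \<open>The inverse rule has the same carry, read from right to left.\<close>

lemma fomin_square_backward:
  assumes "fomin_square kap mu lam nu c"
  shows "queue (\<lambda>y. 2 * cj nu (1 - y) - cj mu (1 - y) - cj lam (1 - y) - 1) (\<lambda>y. c (- y))"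
proof -
  have sg: "kap \<in> sig (length kap)" "mu \<in> sig (length kap)" "lam \<in> sig (length kap)"
    using interlaces_sig assms by (auto simp: fomin_square_def)
  have c: "queue (\<lambda>x. cj mu x + cj lam x - 2 * cj kap x - 1) c"
    using assms by (simp add: fomin_square_def)
  obtain M where M: "\<And>x. x \<ge> M \<Longrightarrow> cj kap x = 0 \<and> cj mu x = 0 \<and> cj lam x = 0"
    using sig_conj_bounds[OF sg] by blast
  have "cj mu x + cj lam x - 2 * cj kap x - 1 \<le> -1" if "x \<ge> M" for x using that M by simp
  from queue_right[OF c this] obtain K where K: "\<And>x. x \<ge> K \<Longrightarrow> c x = 0" by blast
  have bits: "cj mu x - cj kap x \<in> {0,1}" "cj lam x - cj kap x \<in> {0,1}" for x
    using interlaces_bits assms by (auto simp: fomin_square_def)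
  have nu: "cj nu x = cj mu x + cj lam x - cj kap x + c (x - 1) - c x" for x
    using assms by (simp add: fomin_square_def)
  \<comment> \<open>In each column the forward step can be solved for the incoming carry once the
    output is known.\<close>
  have "c (x - 1) = max 0 (2 * cj nu x - cj mu x - cj lam x - 1 + c x)" for x
    using nu[of x] bits[of x] queue_rec[OF c, of x] queue_nonneg[OF c, of "x - 1"] by auto
  from this[of "1 - y" for y]
  have "c (- y) = max 0 (2 * cj nu (1 - y) - cj mu (1 - y) - cj lam (1 - y) - 1 + c (- (y - 1)))" for y
    by simp
  moreover have "c (- y) = 0" if "y \<le> - K" for y using K that by simp
  ultimately show ?thesis
    unfolding queue_def by blast
qed

text \<open>The backward queue depends on \<open>mu\<close>, \<open>lam\<close> and
  \<open>nu\<close> only, so the two squares share their carry, and the formula for the conjugate of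
  \<open>nu\<close> can be solved for that of the lower corner.\<close>

lemma fomin_square_cancel:
  assumes "fomin_square kap mu lam nu c" "fomin_square kap' mu lam nu c'"
  shows "kap = kap'"
proof -
  have "(\<lambda>y. c (- y)) = (\<lambda>y. c' (- y))"
    using fomin_square_backward assms queue_unique by blast
  then have "c x = c' x" for x using fun_cong[of _ _ "- x"] by fastforce
  moreover have "kap \<in> sig (length mu)" "kap' \<in> sig (length mu)"
    using interlaces_sig assms by (fastforce simp: fomin_square_def interlaces_def)+
  ultimately show ?thesis
    using assms by (intro sig_conj_inject) (auto simp: fomin_square_def)
qed

text \<open>Mirror image of the forward construction: the carry is built from the right, and
  \<open>kap\<close> loses a cell of \<open>nu\<close> in each column where a strip or the carry
  \<open>c x\<close> demands one.\<close>

lemma fomin_square_exists_backward: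
  assumes "mu \<preceq> nu" "lam \<preceq> nu"
  obtains kap c where "fomin_square kap mu lam nu c"
proof -
  define l where "l = length nu"
  define g where "g y = 2 * cj nu (1 - y) - cj mu (1 - y) - cj lam (1 - y) - 1" for y
  have sg: "nu \<in> sig l" "mu \<in> sig l" "lam \<in> sig l"
    using interlaces_sig assms by (auto simp: l_def interlaces_def)
  obtain N M where N: "\<And>x. x \<le> N \<Longrightarrow> cj nu x = int l \<and> cj mu x = int l \<and> cj lam x = int l"
    and M: "\<And>x. x \<ge> M \<Longrightarrow> cj nu x = 0 \<and> cj mu x = 0 \<and> cj lam x = 0"
    using sig_conj_bounds[OF sg] by blast
  have "g y \<le> 0" if "y \<le> 1 - M" for y using that M by (simp add: g_def)
  then obtain C where C: "queue g C" using queue_exists[of _ g] by blast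
  have "g y \<le> -1" if "y \<ge> 1 - N" for y using that N by (simp add: g_def)
  from queue_right[OF C this] obtain K where K: "\<And>x. x \<ge> K \<Longrightarrow> C x = 0" by blast
  from queue_leftE[OF C] obtain N' where N': "\<And>x. x \<le> N' \<Longrightarrow> C x = 0" by blast
  define c where "c x = C (- x)" for x
  have cnn: "0 \<le> c x" for x using queue_nonneg[OF C] by (simp add: c_def)
  have crec: "c (x - 1) = max 0 (2 * cj nu x - cj mu x - cj lam x - 1 + c x)" for x
    using queue_rec[OF C, of "1 - x"] by (simp add: c_def g_def)
  define f where "f x = cj mu x + cj lam x - cj nu x + c (x - 1) - c x" for x
  have bits: "cj nu x - cj mu x \<in> {0,1}" "cj nu x - cj lam x \<in> {0,1}" for x
    using interlaces_bits assms by blast+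
  have f_val: "f x = cj nu x - (if cj mu x = cj nu x \<and> cj lam x = cj nu x \<and> c x = 0 then 0 else 1)" for x
    using bits[of x] crec[of x] cnn[of x] by (auto simp: f_def)
  have f_c: "c (x - 1) = 0" if "cj mu x = cj nu x" "cj lam x = cj nu x" "c x = 0" for x
    using that crec[of x] by simp
  have "f (x + 1) \<le> f x" for x
    using f_val[of x] f_val[of "x + 1"] f_c[of "x + 1"] bits[of x] sig_conj_antimono[of x "x+1" nu]
      sig_conj_antimono[of x "x+1" mu] sig_conj_antimono[of x "x+1" lam]
    by (auto split: if_splits)
  moreover have "f x = int l" if "x \<le> min N (-K)" for x using that N K by (simp add: f_def c_def)
  moreover have "f x = 0" if "x \<ge> max M (1 - N')" for x using that M N' by (simp add: f_def c_def)
  ultimately obtain kap where kap: "kap \<in> sig l" "\<And>x. cj kap x = f x"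
    using sig_conj_surj[of f] by metis
  have kb: "cj mu x - cj kap x \<in> {0,1}" "cj lam x - cj kap x \<in> {0,1}" for x
    using bits[of x] crec[of x] cnn[of x] kap(2)[of x] by (auto simp: f_def)
  have "queue (\<lambda>x. cj mu x + cj lam x - 2 * cj kap x - 1) c"
    unfolding queue_def
  proof (intro conjI exI[of _ "- K"] allI impI)
    show "c x = 0" if "x \<le> - K" for x using K that by (simp add: c_def)
    show "c x = max 0 (cj mu x + cj lam x - 2 * cj kap x - 1 + c (x - 1))" for x
      using bits[of x] crec[of x] cnn[of x] kap(2)[of x] by (auto simp: f_def)
  qed
  moreover have "kap \<preceq> mu" "kap \<preceq> lam"
    using kb interlaces_iff kap sg by blast+
  ultimately have "fomin_square kap mu lam nu c"
    using kap sg by (auto simp: fomin_square_def f_def sig_length)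
  then show ?thesis using that by blast
qed

section \<open>The local commutation lemma\<close>

text \<open>With 1 in \<open>s\<close> read as a closing and -1 as an opening bracket, the queue of
  \<open>- s\<close> counts the opening brackets still pending, and this value is 1 precisely at the
  closing brackets that find none.\<close>

definition unmatched :: "(int \<Rightarrow> int) \<Rightarrow> (int \<Rightarrow> int) \<Rightarrow> int \<Rightarrow> int" where
  "unmatched s p x = s x + p x - p (x - 1)"

lemma unmatched_range:
  assumes "queue (\<lambda>x. - s x) p" "s x \<in> {-1, 0, 1}"
  shows "unmatched s p x \<in> {0, 1}"
  using queue_rec[OF assms(1), of x] queue_nonneg[OF assms(1), of "x - 1"] assms(2)
  by (auto simp: unmatched_def)

definition top_at :: "(int \<Rightarrow> int) \<Rightarrow> int \<Rightarrow> bool" where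
  "top_at h x \<longleftrightarrow> (\<forall>y<x. h y < h x) \<and> (\<forall>y>x. h y \<le> h x)"

lemma top_at_unique: "top_at h x \<Longrightarrow> top_at h y \<Longrightarrow> x = y"
  unfolding top_at_def by (metis linorder_neqE not_le)

text \<open>\<open>h + p\<close> is the running maximum of \<open>h\<close>: the queue recursion
  reads \<open>h x + p x = max (h x) (h (x - 1) + p (x - 1))\<close>.\<close>

lemma unmatched_height_le:
  assumes q: "queue (\<lambda>x. h (x - 1) - h x) p" and N: "\<And>x. x \<le> N \<Longrightarrow> h x = (0::int)"
    and le: "\<And>y. y \<le> z \<Longrightarrow> h y \<le> t"
  shows "h z + p z \<le> t"
proof -
  obtain N' where N': "\<And>x. x \<le> N' \<Longrightarrow> p x = 0" using queue_leftE[OF q] by blast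
  have t0: "0 \<le> t" using le[of "min z N"] N[of "min z N"] by simp
  have "x \<le> z \<longrightarrow> h x + p x \<le> t" for x
  proof (rule left_induct[of "min N N'" "\<lambda>x. x \<le> z \<longrightarrow> h x + p x \<le> t"])
    show "x \<le> z \<longrightarrow> h x + p x \<le> t" if "x \<le> min N N'" for x using that N N' t0 by simp
    show "x \<le> z \<longrightarrow> h x + p x \<le> t" if "x - 1 \<le> z \<longrightarrow> h (x - 1) + p (x - 1) \<le> t" for x
      using that queue_rec[OF q, of x] le[of x] by auto
  qed
  then show ?thesis by simp
qed

lemma unmatched_mono:
  assumes q: "queue (\<lambda>x. h (x - 1) - h x) p" and "x \<le> y"
  shows "h x + p x \<le> h y + p y"
  using assms(2)
proof (induction y rule: int_ge_induct)
  case (step i)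
  then show ?case using queue_rec[OF q, of "i + 1"] by simp
qed simp

text \<open>Unmatched closing brackets are the columns where the running maximum \<open>m\<close>
  grows by one, so the last of them is the column where \<open>h\<close> first attains its
  maximum.\<close>

lemma top_at_iff_unmatched:
  assumes q: "queue (\<lambda>x. h (x - 1) - h x) p" and N: "\<And>x. x \<le> N \<Longrightarrow> h x = (0::int)"
    and st: "\<And>x. h x - h (x - 1) \<in> {-1, 0, 1}"
  defines "u \<equiv> unmatched (\<lambda>x. h x - h (x - 1)) p"
  shows "top_at h x \<longleftrightarrow> u x = 1 \<and> (\<forall>y>x. u y = 0)"
proof -
  define m where "m x = h x + p x" for x
  have u: "u y = m y - m (y - 1)" for y by (simp add: u_def m_def unmatched_def)
  have q': "queue (\<lambda>x. - (h x - h (x - 1))) p" using q by simp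
  have u01: "u y \<in> {0, 1}" for y
    unfolding u_def by (rule unmatched_range[OF q' st])
  have mh: "h y \<le> m y" for y using queue_nonneg[OF q] by (simp add: m_def)
  have mono: "m y \<le> m z" if "y \<le> z" for y z using unmatched_mono[OF q that] by (simp add: m_def)
  show ?thesis
  proof
    assume t: "top_at h x"
    have le: "h y \<le> h x" for y using t by (cases y x rule: linorder_cases) (auto simp: top_at_def)
    have m1: "m y \<le> h x" for y using unmatched_height_le[OF q, of N y "h x"] N le by (simp add: m_def)
    have "h y \<le> h x - 1" if "y \<le> x - 1" for y
    proof -
      have "y < x" using that by simp
      then show ?thesis using t unfolding top_at_def by fastforce
    qed
    then have "m (x - 1) \<le> h x - 1"
      using unmatched_height_le[OF q, of N "x - 1" "h x - 1"] N by (simp add: m_def)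
    moreover have mx: "m y = h x" if "y \<ge> x" for y using m1[of y] mono[OF that] mh[of x] by simp
    ultimately show "u x = 1 \<and> (\<forall>y>x. u y = 0)"
      using u01[of x] by (auto simp: u)
  next
    assume a: "u x = 1 \<and> (\<forall>y>x. u y = 0)"
    have px: "p x = 0" using a queue_rec[OF q, of x] by (auto simp: u_def unmatched_def)
    have mx: "m y = m x" if "y \<ge> x" for y
      using that by (induction y rule: int_ge_induct) (use a u in force)+
    show "top_at h x" unfolding top_at_def
    proof (intro conjI allI impI)
      fix y assume "y < x"
      then have "m y \<le> m (x - 1)" by (intro mono) simp
      then show "h y < h x" using a u[of x] mh[of y] px by (simp add: m_def)
    next
      fix y assume "x < y"
      then show "h y \<le> h x" using mx[of y] mh[of y] px by (simp add: m_def)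
    qed
  qed
qed

text \<open>A running maximum that never grows keeps its initial value 0.\<close>

lemma unmatched_zero_height:
  assumes q: "queue (\<lambda>x. h (x - 1) - h x) p" and N: "\<And>x. x \<le> N \<Longrightarrow> h x = (0::int)"
  shows "(\<forall>x. unmatched (\<lambda>x. h x - h (x - 1)) p x = 0) \<longleftrightarrow> (\<forall>x. h x \<le> 0)"
proof -
  obtain N' where N': "\<And>x. x \<le> N' \<Longrightarrow> p x = 0" using queue_leftE[OF q] by blast
  show ?thesis
  proof
    assume a: "\<forall>x. unmatched (\<lambda>x. h x - h (x - 1)) p x = 0"
    show "\<forall>x. h x \<le> 0"
    proof
      fix x
      have "h x + p x = 0"
      proof (rule left_induct[of "min N N'" "\<lambda>x. h x + p x = 0"])
        show "h x + p x = 0" if "x \<le> min N N'" for x using that N N' by simp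
        show "h x + p x = 0" if "h (x - 1) + p (x - 1) = 0" for x
          using that a[rule_format, of x] by (simp add: unmatched_def)
      qed
      then show "h x \<le> 0" using queue_nonneg[OF q, of x] by simp
    qed
  next
    assume a: "\<forall>x. h x \<le> 0"
    have le: "h x + p x \<le> 0" for x using unmatched_height_le[OF q, of N x 0] N a by simp
    moreover have "0 \<le> h x + p x" for x
      using unmatched_mono[OF q, of "min x (min N N')" x] N[of "min x (min N N')"] N'[of "min x (min N N')"] by simp
    ultimately have "h x + p x = 0" for x by (simp add: order_antisym)
    then show "\<forall>x. unmatched (\<lambda>x. h x - h (x - 1)) p x = 0"
      unfolding unmatched_def by (metis (no_types, lifting) add.commute add_diff_eq diff_add_eq_diff_diff_swap diff_self diff_zero group_cancel.sub1)
  qed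
qed

lemma queue_step_bits:
  fixes a b c c0 :: int
  assumes "a \<in> {0,1}" "b \<in> {0,1}" "0 \<le> c0" "c = max 0 (a + b - 1 + c0)"
  shows "a + c0 - c \<in> {0, 1}" "b + c0 - c \<in> {0, 1}"
  using assms by auto

text \<open>Induction step of \<open>carrier_unmatched\<close>: once the three bits are fixed, only
  piecewise linear arithmetic in the incoming carries is left.\<close>

lemma carrier_step:
  fixes a b d c e p ph :: int
  assumes "a \<in> {0,1}" "b \<in> {0,1}" "d \<in> {0,1}" "0 \<le> c0" "0 \<le> e0" "0 \<le> ph0"
   "c = max 0 (a + b - 1 + c0)" "e = max 0 (d + (b + c0 - c) - 1 + e0)"
   "p = max 0 (- (a - d) + p0)" "ph = max 0 (- ((a + c0 - c) - (d + e0 - e)) + ph0)"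
   "p0 = e0 + max 0 (ph0 - c0)"
  shows "p = e + max 0 (ph - c)"
proof -
  consider "a = 0" "b = 0" "d = 0" | "a = 0" "b = 0" "d = 1" | "a = 0" "b = 1" "d = 0" | "a = 0" "b = 1" "d = 1" |
    "a = 1" "b = 0" "d = 0" | "a = 1" "b = 0" "d = 1" | "a = 1" "b = 1" "d = 0" | "a = 1" "b = 1" "d = 1"
    using assms(1-3) by blast
  then show ?thesis
    using assms(4-) by cases (simp_all only: max_def, simp_all split: if_splits)
qed

section \<open>Two adjacent carriers and the bracket queues of the lower and upper row\<close>

abbreviation (input) pass :: "(int \<Rightarrow> int) \<Rightarrow> (int \<Rightarrow> int) \<Rightarrow> int \<Rightarrow> int" where
  "pass s q x \<equiv> s x + q (x - 1) - q x"

context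
  fixes a b c d e p ph :: "int \<Rightarrow> int"
  assumes bits: "\<And>x::int. a x \<in> {0, 1::int}" "\<And>x. d x \<in> {0, 1::int}" "\<And>x. b x \<in> {0, 1::int}"
    and c: "queue (\<lambda>x. a x + b x - 1) c"
    and e: "queue (\<lambda>x. d x + pass b c x - 1) e"
    and p: "queue (\<lambda>x. - (a x - d x)) p"
    and ph: "queue (\<lambda>x. - (pass a c x - pass d e x)) ph"
begin

text \<open>Here \<open>a\<close> and \<open>d\<close> are the bits of the two lower strips,
  \<open>b\<close> those of the left edge, \<open>c\<close> and \<open>e\<close> the carries of the
  two squares. The quantity \<open>max 0 (c - ph)\<close> acts as a stock: unmatched units of the
  lower row enter it and unmatched units of the upper row leave it, so the two rows agree up to a
  delay.\<close>

lemma carrier_unmatched: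
  shows "p x = e x + max 0 (ph x - c x)"
    and "unmatched (\<lambda>x. a x - d x) p x =
      unmatched (\<lambda>x. pass a c x - pass d e x) ph x
       + max 0 (c x - ph x) - max 0 (c (x - 1) - ph (x - 1))"
proof -
  obtain N1 where N1: "\<And>x. x \<le> N1 \<Longrightarrow> c x = 0" using queue_leftE[OF c] by blast
  obtain N2 where N2: "\<And>x. x \<le> N2 \<Longrightarrow> e x = 0" using queue_leftE[OF e] by blast
  obtain N3 where N3: "\<And>x. x \<le> N3 \<Longrightarrow> p x = 0" using queue_leftE[OF p] by blast
  obtain N4 where N4: "\<And>x. x \<le> N4 \<Longrightarrow> ph x = 0" using queue_leftE[OF ph] by blast
  note recs = queue_rec[OF c] queue_rec[OF e] queue_rec[OF p] queue_rec[OF ph]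
  note nn = queue_nonneg[OF c] queue_nonneg[OF e] queue_nonneg[OF p] queue_nonneg[OF ph]
  have *: "p x = e x + max 0 (ph x - c x)" for x
  proof (rule left_induct[of "min (min N1 N2) (min N3 N4)" "\<lambda>x. p x = e x + max 0 (ph x - c x)"])
    show "p x = e x + max 0 (ph x - c x)" if "x \<le> min (min N1 N2) (min N3 N4)" for x
      using that N1 N2 N3 N4 by simp
    show "p x = e x + max 0 (ph x - c x)" if ih: "p (x - 1) = e (x - 1) + max 0 (ph (x - 1) - c (x - 1))" for x
      by (rule carrier_step[OF bits(1)[of x] bits(3)[of x] bits(2)[of x] nn(1)[of "x-1"] nn(2)[of "x-1"] nn(4)[of "x-1"]
          recs(1)[of x] recs(2)[of x] recs(3)[of x] recs(4)[of x] ih])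
  qed
  show "p x = e x + max 0 (ph x - c x)" by (rule *)
  show "unmatched (\<lambda>x. a x - d x) p x =
      unmatched (\<lambda>x. pass a c x - pass d e x) ph x
       + max 0 (c x - ph x) - max 0 (c (x - 1) - ph (x - 1))"
    using *[of x] *[of "x - 1"] by (auto simp: unmatched_def max_def)
qed

text \<open>Lowering \<open>a\<close> at the last unmatched position \<open>x0\<close> moves one unit from the carrier \<open>c\<close> to
  the carrier \<open>e\<close> until a position \<open>xh\<close>, where it leaves the carrier and lowers the output.\<close>

lemma carrier_lowering:
  assumes cr: "\<exists>K. \<forall>x\<ge>K. c x = 0"
    and x0: "unmatched (\<lambda>x. a x - d x) p x0 = 1 \<and> (\<forall>y>x0. unmatched (\<lambda>x. a x - d x) p y = 0)"
  defines "uh \<equiv> unmatched (\<lambda>x. pass a c x - pass d e x) ph"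
  defines "a1 \<equiv> \<lambda>x. a x - (if x = x0 then 1 else 0)"
  defines "d1 \<equiv> \<lambda>x. d x + (if x = x0 then 1 else 0)"
  obtains xh c1 e1 where "uh xh = 1 \<and> (\<forall>y>xh. uh y = 0)"
    "
      queue (\<lambda>x. a1 x + b x - 1) c1 \<and>
      queue (\<lambda>x. d1 x + pass b c1 x - 1) e1 \<and>
      (\<forall>x. pass a1 c1 x = pass a c x - (if x = xh then 1 else 0)) \<and>
      (\<forall>x. pass d1 e1 x = pass d e x + (if x = xh then 1 else 0)) \<and>
      (\<forall>x. b x + c1 (x - 1) - c1 x + e1 (x - 1) - e1 x = b x + c (x - 1) - c x + e (x - 1) - e x)"
proof -
  let ?u = "unmatched (\<lambda>x. a x - d x) p"
  have x0: "?u x0 = 1" "\<And>y. y > x0 \<Longrightarrow> ?u y = 0" using assms(2) by blast+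
  define D where "D x = max 0 (c x - ph x)" for x
  note recs = queue_rec[OF c] queue_rec[OF e] queue_rec[OF p] queue_rec[OF ph]
  note nn = queue_nonneg[OF c] queue_nonneg[OF e] queue_nonneg[OF p] queue_nonneg[OF ph]
  have rel: "?u x = uh x + D x - D (x - 1)" for x
    unfolding D_def uh_def by (rule carrier_unmatched(2))
  have pe: "p x = e x + max 0 (ph x - c x)" for x
    by (rule carrier_unmatched(1))
  have step: "pass a c x - pass d e x \<in> {-1,0,1}" for x
    using queue_step_bits(1)[OF bits(1)[of x] bits(3)[of x] nn(1) recs(1)]
      queue_step_bits(1)[OF bits(2)[of x] queue_step_bits(2)[OF bits(1)[of x] bits(3)[of x] nn(1) recs(1)] nn(2) recs(2)[of x]]
    by auto
  have uh01: "uh x \<in> {0, 1}" for x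
    unfolding uh_def by (rule unmatched_range[OF ph step])
  have D0: "0 \<le> D x" for x by (simp add: D_def)
  obtain K where K: "\<And>x. x \<ge> K \<Longrightarrow> c x = 0" using cr by blast
  have "D x = 0" if "x \<ge> K" for x using K[OF that] nn(4)[of x] by (simp add: D_def)
  then have ex: "\<exists>k. D (x0 + int k) = 0" by (intro exI[of _ "nat (K - x0)"]) simp
  \<comment> \<open>No unit enters the stock \<open>D\<close> after \<open>x0\<close>, and
    \<open>D\<close> vanishes with \<open>c\<close> far to the right. Where it first runs empty, the
    last unit has left in the upper row.\<close>
  define k where "k = (LEAST k. D (x0 + int k) = 0)"
  define xh where "xh = x0 + int k"
  have Dxh: "D xh = 0" unfolding xh_def k_def using LeastI_ex[OF ex] .
  have Dlt: "D x > 0" if "x0 \<le> x" "x < xh" for x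
  proof -
    have "nat (x - x0) < k" using that by (simp add: xh_def)
    from not_less_Least[OF this[unfolded k_def]] have "D x \<noteq> 0" using that by simp
    then show ?thesis using D0[of x] by simp
  qed
  have Dge: "D x = 0" if "x \<ge> xh" for x
    using that
  proof (induction x rule: int_ge_induct)
    case (step i)
    then have "?u (i + 1) = 0" using x0(2)[of "i + 1"] by (simp add: xh_def)
    then show ?case using rel[of "i + 1"] step uh01[of "i + 1"] D0[of "i + 1"] by auto
  qed (rule Dxh)
  have 1: "uh xh = 1"
  proof (cases "xh = x0")
    case True
    then show ?thesis using rel[of xh] x0(1) Dxh D0[of "xh - 1"] uh01[of xh] by auto
  next
    case False
    then have "xh > x0" by (simp add: xh_def)
    then show ?thesis using rel[of xh] x0(2)[of xh] Dxh Dlt[of "xh - 1"] uh01[of xh] by auto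
  qed
  have 2: "uh y = 0" if "y > xh" for y
    using rel[of y] x0(2)[of y] Dge[of y] Dge[of "y - 1"] that by (simp add: xh_def)
  have x0v: "a x0 = 1" "d x0 = 0" "p (x0 - 1) = 0"
    using x0(1) recs(3)[of x0] bits(1)[of x0] bits(2)[of x0] nn(3)[of "x0-1"] by (auto simp: unmatched_def)
  have xhv: "ph (xh - 1) = 0" "a xh + c (xh - 1) - c xh = 1 + (d xh + e (xh - 1) - e xh)" "c xh = 0"
  proof -
    show "ph (xh - 1) = 0" "a xh + c (xh - 1) - c xh = 1 + (d xh + e (xh - 1) - e xh)"
      using 1 recs(4)[of xh] step[of xh] nn(4)[of "xh-1"] unfolding uh_def unmatched_def by auto
    then show "c xh = 0"
      using Dxh recs(4)[of xh] nn(1)[of xh] by (auto simp: D_def max_def split: if_splits)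
  qed
  \<comment> \<open>While \<open>D\<close> is positive, \<open>c\<close> exceeds \<open>ph\<close>;
    so \<open>c\<close> has a unit to give away and \<open>p\<close> reduces to
    \<open>e\<close>.\<close>
  have mid: "c x \<ge> 1" "p x = e x" if "x0 \<le> x" "x < xh" for x
    using Dlt[OF that] pe[of x] nn(4)[of x] by (auto simp: D_def max_def split: if_splits)
  have um: "a x - d x + p x - p (x - 1) = 0" if "x > x0" for x
    using x0(2)[OF that] by (simp add: unmatched_def)
  have e0: "e (x0 - 1) = 0" using pe[of "x0 - 1"] x0v nn(2)[of "x0-1"] by auto
  \<comment> \<open>If \<open>xh\<close> lies to the right of \<open>x0\<close>, the carry drops
    there from at least 1 to 0, which forces empty arrivals and exactly one unit left in
    \<open>c\<close>.\<close>
  have cle: "c x = 0 \<and> a x = 0 \<and> b x = 0 \<and> c (x - 1) = 1 \<and> d x + e (x - 1) = e x" if "x = xh" "x > x0" for x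
  proof -
    have c1: "c (x - 1) \<ge> 1" "c x = 0" using mid[of "x - 1"] xhv that by auto
    then have "a x + b x - 1 + c (x - 1) \<le> 0" using recs(1)[of x] by simp
    then have 1: "a x = 0" "b x = 0" "c (x - 1) = 1" using c1 bits(1)[of x] bits(3)[of x] by auto
    then have "e x = max 0 (d x + e (x - 1))" using recs(2)[of x] c1 by simp
    then show ?thesis using 1 c1 bits(2)[of x] nn(2)[of "x - 1"] by auto
  qed
  \<comment> \<open>From \<open>x0\<close> up to, but not including, \<open>xh\<close> one unit sits
    in \<open>e\<close> instead of \<open>c\<close>; \<open>mid\<close> keeps \<open>c1\<close>
    nonnegative.\<close>
  define c1 where "c1 = (\<lambda>x. c x - (if x0 \<le> x \<and> x < xh then 1 else 0))"
  define e1 where "e1 = (\<lambda>x. e x + (if x0 \<le> x \<and> x < xh then 1 else 0))"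
  note c1 = c1_def and e1 = e1_def and a1 = a1_def and d1 = d1_def
  have main: "queue (\<lambda>x. a1 x + b x - 1) c1 \<and>
      queue (\<lambda>x. d1 x + pass b c1 x - 1) e1 \<and>
      (\<forall>x. pass a1 c1 x = pass a c x - (if x = xh then 1 else 0)) \<and>
      (\<forall>x. pass d1 e1 x = pass d e x + (if x = xh then 1 else 0)) \<and>
      (\<forall>x. b x + c1 (x - 1) - c1 x + e1 (x - 1) - e1 x = b x + c (x - 1) - c x + e (x - 1) - e x)"
  proof -
    obtain N1 where N1: "\<And>x. x \<le> N1 \<Longrightarrow> c x = 0" using queue_leftE[OF c] by blast
    obtain N2 where N2: "\<And>x. x \<le> N2 \<Longrightarrow> e x = 0" using queue_leftE[OF e] by blast
    have le: "x0 \<le> xh" by (simp add: xh_def)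
    have all: "c1 x = max 0 (a1 x + b x - 1 + c1 (x - 1)) \<and>
        e1 x = max 0 (d1 x + pass b c1 x - 1 + e1 (x - 1)) \<and>
        pass a1 c1 x = pass a c x - (if x = xh then 1 else 0) \<and>
        pass d1 e1 x = pass d e x + (if x = xh then 1 else 0) \<and>
        b x + c1 (x - 1) - c1 x + e1 (x - 1) - e1 x = b x + c (x - 1) - c x + e (x - 1) - e x" for x
    proof -
      consider "x < x0 \<or> x > xh" | "x = x0" "x0 = xh" | "x = x0" "x0 < xh" | "x0 < x" "x < xh" | "x0 < x" "x = xh"
        using le by linarith
      then show ?thesis
      proof cases
        case 1 
        then show ?thesis using le recs(1)[of x] recs(2)[of x] by (auto simp: c1 e1 a1 d1)
      next
        case 2
        then have "b x + c (x - 1) \<le> 0" using recs(1)[of x] x0v xhv by simp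
        then have "b x = 0" "c (x - 1) = 0" using bits(3)[of x] nn(1)[of "x - 1"] by auto
        moreover from this have "e x = 0" using recs(2)[of x] 2 x0v xhv e0 by simp
        ultimately show ?thesis using 2 x0v xhv e0 by (simp add: c1 e1 a1 d1)
      next
        case 3
        then have cx: "c x = b x + c (x - 1)" using recs(1)[of x] x0v mid(1)[of x] by simp
        then have "e x = 0" using recs(2)[of x] 3 x0v e0 by simp
        then show ?thesis using 3 cx x0v e0 mid(1)[of x] by (simp add: c1 e1 a1 d1)
      next
        case 4
        then have cx: "c x = a x + b x + c (x - 1) - 1" "c x \<ge> 1"
          using recs(1)[of x] mid(1)[of x] by simp_all
        have "e x = d x - a x + e (x - 1)"
          using um[of x] mid(2)[of x] mid(2)[of "x - 1"] 4 by simp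
        then show ?thesis using 4 cx nn(2)[of x] by (simp add: c1 e1 a1 d1)
      next
        case 5
        then show ?thesis using cle[of x] nn(2)[of x] by (simp add: c1 e1 a1 d1)
      qed
    qed
    moreover have "\<exists>N. \<forall>x\<le>N. c1 x = 0" "\<exists>N. \<forall>x\<le>N. e1 x = 0"
      using N1 N2 by (auto simp: c1 e1 intro!: exI[of _ "min (min N1 N2) (x0 - 1)"])
    ultimately show ?thesis unfolding queue_def by blast
  qed
  show ?thesis by (rule that[OF _ main]) (use 1 2 in blast)
qed

text \<open>Nothing enters the stock \<open>D\<close>, which is empty on the far left, so nothing
  can leave it in the upper row.\<close>

lemma carrier_unmatched_zero:
  assumes u0: "\<And>x. unmatched (\<lambda>x. a x - d x) p x = 0"
  shows "unmatched (\<lambda>x. pass a c x - pass d e x) ph x = 0"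
proof -
  let ?uh = "unmatched (\<lambda>x. pass a c x - pass d e x) ph"
  define D where "D x = max 0 (c x - ph x)" for x
  note recs = queue_rec[OF c] queue_rec[OF e]
  note nn = queue_nonneg[OF c] queue_nonneg[OF e] queue_nonneg[OF ph]
  have rel: "0 = ?uh x + D x - D (x - 1)" for x
    unfolding D_def using carrier_unmatched(2)[of x] u0[of x] by simp
  have step: "pass a c x - pass d e x \<in> {-1,0,1}" for x
    using queue_step_bits(1)[OF bits(1)[of x] bits(3)[of x] nn(1) recs(1)]
      queue_step_bits(1)[OF bits(2)[of x] queue_step_bits(2)[OF bits(1)[of x] bits(3)[of x] nn(1) recs(1)] nn(2) recs(2)[of x]]
    by auto
  have uh01: "?uh x \<in> {0, 1}" for x by (rule unmatched_range[OF ph step])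
  obtain N where N: "\<And>x. x \<le> N \<Longrightarrow> c x = 0" using queue_leftE[OF c] by blast
  have D0: "D x = 0" for x
  proof (rule left_induct[of N "\<lambda>x. D x = 0"])
    show "D x = 0" if "x \<le> N" for x using N[OF that] nn(3)[of x] by (simp add: D_def)
    show "D x = 0" if "D (x - 1) = 0" for x
    proof -
      have "0 \<le> D x" by (simp add: D_def)
      then show ?thesis using that rel[of x] uh01[of x] by auto
    qed
  qed
  show ?thesis using rel[of x] D0[of x] D0[of "x - 1"] by simp
qed

end

section \<open>Heights and lowerings of a triple of interlacing signatures\<close>

definition psum :: "int list \<Rightarrow> int \<Rightarrow> int" where
  "psum lam x = (\<Sum>j<length lam. min (lam ! j) x)"

text \<open>\<open>psum\<close> is a discrete antiderivative of the conjugate. Truncating the parts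
  at \<open>x\<close> replaces the sum of column heights from minus infinity, which would
  diverge.\<close>

lemma psum_diff: "psum lam x - psum lam (x - 1) = cj lam x"
proof -
  have "psum lam x - psum lam (x - 1) = (\<Sum>j<length lam. if lam ! j \<ge> x then 1 else 0)"
    unfolding psum_def sum_subtractf[symmetric] by (intro sum.cong) auto
  also have "\<dots> = (\<Sum>j\<in>{..<length lam} \<inter> {j. lam ! j \<ge> x}. 1)"
    by (simp add: sum.If_cases)
  also have "\<dots> = cj lam x"
    by (simp add: sig_conj_def Int_def)
  finally show ?thesis .
qed

lemma psum_left:
  obtains N where "\<And>x. x \<le> N \<Longrightarrow> psum lam x = int (length lam) * x"
proof (rule that[of "Min (insert 0 (set lam))"])
  fix x assume "x \<le> Min (insert 0 (set lam))"
  then have "x \<le> lam ! j" if "j < length lam" for j using that by simp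
  then show "psum lam x = int (length lam) * x" by (simp add: psum_def)
qed

lemma psum_right:
  obtains M where "\<And>x. x \<ge> M \<Longrightarrow> psum lam x = sum_list lam"
proof (rule that[of "Max (insert 0 (set lam))"])
  fix x assume "x \<ge> Max (insert 0 (set lam))"
  then have "lam ! j \<le> x" if "j < length lam" for j using that by simp
  then show "psum lam x = sum_list lam" by (simp add: psum_def sum_list_sum_nth atLeast0LessThan)
qed

definition height :: "int list \<Rightarrow> int list \<Rightarrow> int list \<Rightarrow> int \<Rightarrow> int" where
  "height kap mu nu x = 2 * psum mu x - psum kap x - psum nu x"

lemma height_diff:
  "height kap mu nu x - height kap mu nu (x - 1) = (cj mu x - cj kap x) - (cj nu x - cj mu x)"
  unfolding height_def using psum_diff[of kap x] psum_diff[of mu x] psum_diff[of nu x] by linarith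

lemma height_step:
  assumes "kap \<preceq> mu" "mu \<preceq> nu"
  shows "height kap mu nu x - height kap mu nu (x - 1) \<in> {-1, 0, 1}"
  using interlaces_bits[OF assms(1), of x] interlaces_bits[OF assms(2), of x] height_diff[of kap mu nu x]
  by auto

text \<open>The three signatures have equal length, so with weights 2, -1 and -1 the linear parts of
  the truncated sums cancel.\<close>

lemma height_left:
  assumes "kap \<preceq> mu" "mu \<preceq> nu"
  obtains N where "\<And>x. x \<le> N \<Longrightarrow> height kap mu nu x = 0"
proof -
  obtain N1 N2 N3 where "\<And>x. x \<le> N1 \<Longrightarrow> psum kap x = int (length kap) * x"
    "\<And>x. x \<le> N2 \<Longrightarrow> psum mu x = int (length mu) * x" "\<And>x. x \<le> N3 \<Longrightarrow> psum nu x = int (length nu) * x"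
    using psum_left by metis
  then have "height kap mu nu x = 0" if "x \<le> min N1 (min N2 N3)" for x
    using that assms by (simp add: height_def interlaces_def)
  then show ?thesis using that by blast
qed

lemma height_right:
  obtains M where "\<And>x. x \<ge> M \<Longrightarrow> height kap mu nu x = 2 * sum_list mu - sum_list kap - sum_list nu"
proof -
  obtain N1 N2 N3 where "\<And>x. x \<ge> N1 \<Longrightarrow> psum kap x = sum_list kap"
    "\<And>x. x \<ge> N2 \<Longrightarrow> psum mu x = sum_list mu" "\<And>x. x \<ge> N3 \<Longrightarrow> psum nu x = sum_list nu"
    using psum_right by metis
  then have "height kap mu nu x = 2 * sum_list mu - sum_list kap - sum_list nu" if "x \<ge> max N1 (max N2 N3)" for x
    using that by (simp add: height_def)
  then show ?thesis using that by blast
qed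

text \<open>Column form of the operator \<open>f\<close> acting on the middle one of three
  consecutive signatures; \<open>kashiwara_f_iff\<close> makes the connection.\<close>

definition lowering :: "int list \<Rightarrow> int list \<Rightarrow> int list \<Rightarrow> int list \<Rightarrow> bool" where
  "lowering kap mu nu mu1 \<longleftrightarrow> mu1 \<in> sig (length mu) \<and>
     (\<exists>x. top_at (height kap mu nu) x \<and> (\<forall>y. cj mu1 y = cj mu y - (if y = x then 1 else 0)))"

lemma lowering_unique:
  assumes "lowering kap mu nu mu1" "lowering kap mu nu mu2"
  shows "mu1 = mu2"
proof -
  obtain x where x: "top_at (height kap mu nu) x" "\<And>y. cj mu1 y = cj mu y - (if y = x then 1 else 0)"
    using assms(1) unfolding lowering_def by blast
  obtain x' where x': "top_at (height kap mu nu) x'" "\<And>y. cj mu2 y = cj mu y - (if y = x' then 1 else 0)"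
    using assms(2) unfolding lowering_def by blast
  have "x = x'" using top_at_unique x x' by blast
  then show ?thesis
    using assms x x' by (intro sig_conj_inject[of _ "length mu"]) (auto simp: lowering_def)
qed

lemma top_at_bits:
  assumes "kap \<preceq> mu" "mu \<preceq> nu" "top_at (height kap mu nu) x"
  shows "cj mu x = cj kap x + 1" "cj nu x = cj mu x"
    "\<not> (cj mu (x + 1) = cj kap (x + 1) + 1 \<and> cj nu (x + 1) = cj mu (x + 1))"
proof -
  let ?h = "height kap mu nu"
  have "?h (x - 1) < ?h x" "?h (x + 1) \<le> ?h x"
    using assms(3) by (auto simp: top_at_def)
  then show "cj mu x = cj kap x + 1" "cj nu x = cj mu x"
    "\<not> (cj mu (x + 1) = cj kap (x + 1) + 1 \<and> cj nu (x + 1) = cj mu (x + 1))"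
    using height_diff[of kap mu nu x] height_diff[of kap mu nu "x + 1"]
      interlaces_bits[OF assms(1), of x] interlaces_bits[OF assms(2), of x] by auto
qed

text \<open>If columns \<open>x\<close> and \<open>x + 1\<close> of \<open>mu\<close> had the same
  height, the bits found at \<open>x\<close> would repeat at \<open>x + 1\<close> and the height
  would rise beyond its maximum. Hence the lowered step function still decreases.\<close>

lemma lowering_exists:
  assumes i: "kap \<preceq> mu" "mu \<preceq> nu" and t: "top_at (height kap mu nu) x"
  obtains mu1 where "mu1 \<in> sig (length mu)" "\<And>y. cj mu1 y = cj mu y - (if y = x then 1 else 0)"
proof -
  define l where "l = length kap"
  have sg: "kap \<in> sig l" "mu \<in> sig l" "nu \<in> sig l" "length mu = l"
    using i by (auto simp: interlaces_def signatures_iff l_def)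
  note b = top_at_bits[OF i t]
  define f where "f y = cj mu y - (if y = x then 1 else 0)" for y
  have "f (y + 1) \<le> f y" for y
    using b interlaces_bits[OF i(1), of "x + 1"] interlaces_bits[OF i(2), of "x + 1"]
      sig_conj_antimono[of y "y + 1" mu] sig_conj_antimono[of x "x + 1" kap]
      sig_conj_antimono[of x "x + 1" nu]
    by (auto simp: f_def)
  moreover obtain N where "\<And>y. y \<le> N \<Longrightarrow> cj mu y = int l" using sig_conj_left sg by metis
  then have "f y = int l" if "y \<le> min N (x - 1)" for y using that by (simp add: f_def)
  moreover obtain M where "\<And>y. y \<ge> M \<Longrightarrow> cj mu y = 0" using sig_conj_right sg by metis
  then have "f y = 0" if "y \<ge> max M (x + 1)" for y using that by (simp add: f_def)
  ultimately obtain mu1 where "mu1 \<in> sig l" "\<And>y. cj mu1 y = f y"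
    using sig_conj_surj[of f] by metis
  then show ?thesis using that sg by (simp add: f_def)
qed

lemma lowering_exists_iff:
  assumes i: "kap \<preceq> mu" "mu \<preceq> nu"
  shows "(\<exists>mu1. lowering kap mu nu mu1) \<longleftrightarrow> (\<exists>x. top_at (height kap mu nu) x)"
  using lowering_exists[OF i] unfolding lowering_def by metis

lemma lowering_interlaces:
  assumes i: "kap \<preceq> mu" "mu \<preceq> nu" and l: "lowering kap mu nu mu1"
  shows "kap \<preceq> mu1" "mu1 \<preceq> nu"
proof -
  have sg: "kap \<in> sig (length mu)" "mu \<in> sig (length mu)" "nu \<in> sig (length mu)" "mu1 \<in> sig (length mu)"
    using i l by (auto simp: interlaces_def lowering_def signatures_iff)
  obtain x where x: "top_at (height kap mu nu) x" "\<And>y. cj mu1 y = cj mu y - (if y = x then 1 else 0)"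
    using l by (auto simp: lowering_def)
  note b = top_at_bits[OF i x(1)]
  have "cj mu1 y - cj kap y \<in> {0, 1}" "cj nu y - cj mu1 y \<in> {0, 1}" for y
    using interlaces_bits[OF i(1), of y] interlaces_bits[OF i(2), of y] b(1,2) x(2)[of y] by auto
  then show "kap \<preceq> mu1" "mu1 \<preceq> nu" using interlaces_iff sg by blast+
qed

lemma height_queue:
  assumes i: "kap \<preceq> mu" "mu \<preceq> nu"
  obtains p where "queue (\<lambda>x. height kap mu nu (x - 1) - height kap mu nu x) p"
    "queue (\<lambda>x. - ((cj mu x - cj kap x) - (cj nu x - cj mu x))) p"
proof -
  let ?h = "height kap mu nu"
  have eq: "(\<lambda>x. ?h (x - 1) - ?h x) = (\<lambda>x. - ((cj mu x - cj kap x) - (cj nu x - cj mu x)))"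
    using height_diff[of kap mu nu] by (intro ext) (smt (verit))
  obtain N where N: "\<And>x. x \<le> N \<Longrightarrow> ?h x = 0" using height_left[OF i] by blast
  then have "?h (x - 1) - ?h x \<le> 0" if "x \<le> N" for x using that by simp
  then obtain p where "queue (\<lambda>x. ?h (x - 1) - ?h x) p"
    using queue_exists[of N "\<lambda>x. ?h (x - 1) - ?h x"] by blast
  then show ?thesis using that eq by metis
qed

lemma top_at_height_iff:
  assumes i: "kap \<preceq> mu" "mu \<preceq> nu"
    and p: "queue (\<lambda>x. - ((cj mu x - cj kap x) - (cj nu x - cj mu x))) p"
  defines "u \<equiv> unmatched (\<lambda>x. (cj mu x - cj kap x) - (cj nu x - cj mu x)) p"
  shows "top_at (height kap mu nu) x \<longleftrightarrow> u x = 1 \<and> (\<forall>y>x. u y = 0)"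
    "(\<forall>x. u x = 0) \<longleftrightarrow> (\<forall>x. height kap mu nu x \<le> 0)"
proof -
  let ?h = "height kap mu nu"
  have eq: "(\<lambda>x. ?h x - ?h (x - 1)) = (\<lambda>x. (cj mu x - cj kap x) - (cj nu x - cj mu x))"
    using height_diff[of kap mu nu] by (intro ext)
  have q: "queue (\<lambda>x. ?h (x - 1) - ?h x) p"
    using p height_diff[of kap mu nu] by (metis (no_types, lifting) ext minus_diff_eq)
  obtain N where N: "\<And>x. x \<le> N \<Longrightarrow> ?h x = 0" using height_left[OF i] by blast
  show "top_at ?h x \<longleftrightarrow> u x = 1 \<and> (\<forall>y>x. u y = 0)"
    unfolding u_def eq[symmetric] using top_at_iff_unmatched[OF q, of N] N height_step[OF i] by blast
  show "(\<forall>x. u x = 0) \<longleftrightarrow> (\<forall>x. ?h x \<le> 0)"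
    unfolding u_def eq[symmetric] using unmatched_zero_height[OF q, of N] N by blast
qed

lemma fomin_square_right:
  assumes "fomin_square kap mu lam nu c"
  obtains K where "\<And>x. x \<ge> K \<Longrightarrow> c x = 0"
proof -
  obtain N where "\<And>x. x \<le> N \<Longrightarrow> c (- x) = 0" using queue_leftE[OF fomin_square_backward[OF assms]] by blast
  from this[of "- x" for x] show ?thesis using that[of "- N"] by simp
qed

section \<open>Lowering across two adjacent squares of the local rule\<close>

lemma fomin_squares_queues:
  assumes s1: "fomin_square kap mu kaph muh c" and s2: "fomin_square mu nu muh nuh e"
  defines "a \<equiv> \<lambda>x. cj mu x - cj kap x" and "d \<equiv> \<lambda>x. cj nu x - cj mu x" and "b \<equiv> \<lambda>x. cj kaph x - cj kap x"
  shows "a x \<in> {0, 1}" "d x \<in> {0, 1}" "b x \<in> {0, 1}"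
    "queue (\<lambda>x. a x + b x - 1) c" "queue (\<lambda>x. d x + pass b c x - 1) e"
    "cj muh x = cj kaph x + a x + c (x - 1) - c x" "cj muh x = cj mu x + b x + c (x - 1) - c x"
    "cj nuh x = cj muh x + d x + e (x - 1) - e x"
proof -
  have "kap \<preceq> mu" "mu \<preceq> nu" "kap \<preceq> kaph" using s1 s2 by (auto simp: fomin_square_def)
  then show "a x \<in> {0, 1}" "d x \<in> {0, 1}" "b x \<in> {0, 1}"
    unfolding a_def d_def b_def using interlaces_bits by blast+
  have muh: "cj muh x = cj kaph x + a x + c (x - 1) - c x" "cj muh x = cj mu x + b x + c (x - 1) - c x" for x
    using s1 by (auto simp: fomin_square_def a_def b_def)
  then show "cj muh x = cj kaph x + a x + c (x - 1) - c x" "cj muh x = cj mu x + b x + c (x - 1) - c x" .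
  show "cj nuh x = cj muh x + d x + e (x - 1) - e x" using s2 by (auto simp: fomin_square_def d_def)
  have "(\<lambda>x. cj mu x + cj kaph x - 2 * cj kap x - 1) = (\<lambda>x. a x + b x - 1)"
    by (simp add: a_def b_def algebra_simps)
  then show "queue (\<lambda>x. a x + b x - 1) c" using s1 by (simp add: fomin_square_def)
  have "(\<lambda>x. cj nu x + cj muh x - 2 * cj mu x - 1) = (\<lambda>x. d x + pass b c x - 1)"
    by (simp add: d_def muh(2) algebra_simps)
  then show "queue (\<lambda>x. d x + pass b c x - 1) e" using s2 by (simp add: fomin_square_def)
qed

text \<open>The new carries come from \<open>carrier_lowering\<close>. As \<open>kap\<close>,
  \<open>nu\<close>, \<open>kaph\<close> and \<open>nuh\<close> are all kept, changing one signature
  of a row changes one signature of the next row and nothing further along.\<close>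

lemma fomin_square_lowering:
  assumes s1: "fomin_square kap mu kaph muh c" and s2: "fomin_square mu nu muh nuh e"
    and l: "lowering kap mu nu mu1"
  obtains muh1 c1 e1 where "fomin_square kap mu1 kaph muh1 c1" "fomin_square mu1 nu muh1 nuh e1"
    "lowering kaph muh nuh muh1"
proof -
  have i: "kap \<preceq> mu" "mu \<preceq> nu" "kap \<preceq> kaph" "mu \<preceq> muh" using s1 s2 by (auto simp: fomin_square_def)
  have ih: "kaph \<preceq> muh" "muh \<preceq> nuh" using fomin_square_interlaces s1 s2 by blast+
  define a where "a x = cj mu x - cj kap x" for x
  define d where "d x = cj nu x - cj mu x" for x
  define b where "b x = cj kaph x - cj kap x" for x
  note sq = fomin_squares_queues[OF s1 s2, folded a_def b_def d_def]
  note bits = sq(1-3) and c = sq(4) and e = sq(5) and muh = sq(6,7) and nuh = sq(8)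
  obtain p where p: "queue (\<lambda>x. - ((cj mu x - cj kap x) - (cj nu x - cj mu x))) p"
    using height_queue[OF i(1,2)] by blast
  obtain ph where ph: "queue (\<lambda>x. - ((cj muh x - cj kaph x) - (cj nuh x - cj muh x))) ph"
    using height_queue[OF ih] by blast
  have hat: "(cj muh x - cj kaph x) - (cj nuh x - cj muh x) = pass a c x - pass d e x" for x
    using muh(1)[of x] nuh[of x] by simp
  have len: "length mu = length kap" "length muh = length kap" "length nuh = length kap"
    using i ih by (auto simp: interlaces_def)
  obtain x0 where x0: "top_at (height kap mu nu) x0" "\<And>y. cj mu1 y = cj mu y - (if y = x0 then 1 else 0)"
    using l by (auto simp: lowering_def)
  have un: "unmatched (\<lambda>x. a x - d x) p x0 = 1 \<and> (\<forall>y>x0. unmatched (\<lambda>x. a x - d x) p y = 0)"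
    using top_at_height_iff(1)[OF i(1,2) p] x0 unfolding a_def d_def by blast
  have K: "\<exists>K. \<forall>x\<ge>K. c x = 0" using fomin_square_right[OF s1] by metis
  define a1 where "a1 = (\<lambda>x. a x - (if x = x0 then 1 else 0))"
  define d1 where "d1 = (\<lambda>x. d x + (if x = x0 then 1 else 0))"
  obtain xh c1 e1 where xh: "unmatched (\<lambda>x. pass a c x - pass d e x) ph xh = 1 \<and>
      (\<forall>y>xh. unmatched (\<lambda>x. pass a c x - pass d e x) ph y = 0)"
    and o: "queue (\<lambda>x. a1 x + b x - 1) c1 \<and>
      queue (\<lambda>x. d1 x + pass b c1 x - 1) e1 \<and>
      (\<forall>x. pass a1 c1 x = pass a c x - (if x = xh then 1 else 0)) \<and>
      (\<forall>x. pass d1 e1 x = pass d e x + (if x = xh then 1 else 0)) \<and>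
      (\<forall>x. b x + c1 (x - 1) - c1 x + e1 (x - 1) - e1 x = b x + c (x - 1) - c x + e (x - 1) - e x)"
    unfolding a1_def d1_def
    by (rule carrier_lowering[OF bits c e p[folded a_def d_def] ph[unfolded hat] K un])
  have top: "top_at (height kaph muh nuh) xh"
    using top_at_height_iff(1)[OF ih ph] xh unfolding hat by blast
  obtain muh1 where m1: "muh1 \<in> sig (length muh)" "\<And>y. cj muh1 y = cj muh y - (if y = xh then 1 else 0)"
    using lowering_exists[OF ih top] by blast
  have low: "lowering kaph muh nuh muh1" using m1 top by (auto simp: lowering_def)
  have a1: "a1 x = cj mu1 x - cj kap x" for x using x0(2) by (simp add: a1_def a_def)
  have d1: "d1 x = cj nu x - cj mu1 x" for x using x0(2) by (simp add: d1_def d_def)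
  have m1c: "cj muh1 x = cj kaph x + a1 x + c1 (x - 1) - c1 x" for x
    using o m1(2)[of x] muh(1)[of x] by (smt (verit))
  then have m1d: "cj muh1 x = cj mu1 x + pass b c1 x" for x
    using a1[of x] by (simp add: b_def)
  have n1: "cj nuh x = cj muh1 x + d1 x + e1 (x - 1) - e1 x" for x
    using o m1(2)[of x] nuh[of x] by (smt (verit))
  note li = lowering_interlaces[OF i(1,2) l]
  have eq1: "(\<lambda>x. a1 x + b x - 1) = (\<lambda>x. cj mu1 x + cj kaph x - 2 * cj kap x - 1)"
    by (simp add: a1 b_def algebra_simps)
  have eq2: "(\<lambda>x. d1 x + pass b c1 x - 1) = (\<lambda>x. cj nu x + cj muh1 x - 2 * cj mu1 x - 1)"
    using d1 m1d by (intro ext) (smt (verit))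
  have sq1: "fomin_square kap mu1 kaph muh1 c1"
    unfolding fomin_square_def
  proof (intro conjI allI)
    show "queue (\<lambda>x. cj mu1 x + cj kaph x - 2 * cj kap x - 1) c1" using o unfolding eq1 by blast
    show "cj muh1 x = cj mu1 x + cj kaph x - cj kap x + c1 (x - 1) - c1 x" for x
      using m1c[of x] a1[of x] by simp
  qed (use li i m1 len in auto)
  have sq2: "fomin_square mu1 nu muh1 nuh e1"
    unfolding fomin_square_def
  proof (intro conjI allI)
    show "queue (\<lambda>x. cj nu x + cj muh1 x - 2 * cj mu1 x - 1) e1" using o unfolding eq2 by blast
    show "cj nuh x = cj nu x + cj muh1 x - cj mu1 x + e1 (x - 1) - e1 x" for x
      using n1[of x] d1[of x] by simp
    show "nuh \<in> sig (length mu1)"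
      using s2 li i by (auto simp: fomin_square_def interlaces_def)
  qed (use li fomin_square_interlaces(1)[OF sq1] in auto)
  show ?thesis using that[OF sq1 sq2 low] .
qed

lemma top_at_exists:
  fixes h :: "int \<Rightarrow> int"
  assumes fin: "finite (range h)" and N: "\<And>x. x \<le> N \<Longrightarrow> h x = s" and z: "h z > s"
  shows "\<exists>x. top_at h x \<and> h x = Max (range h)"
proof -
  define t where "t = Max (range h)"
  have le: "h x \<le> t" for x unfolding t_def using fin by simp
  have "t \<in> range h" unfolding t_def using fin by (intro Max_in) auto
  then obtain w where w: "h w = t" by blast
  have wN: "w > N" using z le[of z] w N[of w] by force
  have wr: "h (N + int (nat (w - N))) = t" using wN w by simp
  define k where "k = (LEAST k. h (N + int k) = t)"
  have hk: "h (N + int k) = t" unfolding k_def by (rule LeastI) (rule wr)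
  have "top_at h (N + int k)"
    unfolding top_at_def
  proof (intro conjI allI impI)
    fix y assume y: "y < N + int k"
    have "h y \<noteq> t"
    proof (cases "y \<le> N")
      case True then show ?thesis using N[of y] z le[of z] by simp
    next
      case False
      then have "nat (y - N) < k" using y by simp
      from not_less_Least[OF this[unfolded k_def]] show ?thesis using False by simp
    qed
    then show "h y < h (N + int k)" using le[of y] hk by simp
  qed (use hk le in simp)
  then show ?thesis using hk t_def by blast
qed

lemma height_finite:
  assumes i: "kap \<preceq> mu" "mu \<preceq> nu"
  shows "finite (range (height kap mu nu))"
proof -
  let ?h = "height kap mu nu"
  obtain N where N: "\<And>x. x \<le> N \<Longrightarrow> ?h x = 0" using height_left[OF i] by blast
  obtain M t where M: "\<And>x. x \<ge> M \<Longrightarrow> ?h x = t" using height_right by blast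
  have "range ?h \<subseteq> insert 0 (insert t (?h ` {N..M}))"
  proof (rule image_subsetI)
    fix x
    consider "x \<le> N" | "x \<ge> M" | "x \<in> {N..M}" by force
    then show "?h x \<in> insert 0 (insert t (?h ` {N..M}))" using N M by cases auto
  qed
  then show ?thesis by (rule finite_subset) simp
qed

lemma top_at_exists_iff:
  assumes i: "kap \<preceq> mu" "mu \<preceq> nu"
  shows "(\<exists>x. top_at (height kap mu nu) x) \<longleftrightarrow> \<not> (\<forall>x. height kap mu nu x \<le> 0)"
proof -
  let ?h = "height kap mu nu"
  obtain N where N: "\<And>x. x \<le> N \<Longrightarrow> ?h x = 0" using height_left[OF i] by blast
  show ?thesis
  proof
    assume "\<exists>x. top_at ?h x"
    then obtain x where "top_at ?h x" by blast
    then have "?h (min (x - 1) N) < ?h x" by (auto simp: top_at_def)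
    then show "\<not> (\<forall>x. ?h x \<le> 0)" using N[of "min (x - 1) N"] by (auto simp: not_le)
  next
    assume "\<not> (\<forall>x. ?h x \<le> 0)"
    then show "\<exists>x. top_at ?h x"
      using top_at_exists[OF height_finite[OF i], of N 0] N by (auto simp: not_le)
  qed
qed

text \<open>Needed where \<open>f\<close> is undefined on the lower row: without a top the height
  stays at most 0, so no unit is unmatched, and \<open>carrier_unmatched_zero\<close> passes this on
  to the upper row.\<close>

lemma fomin_square_lowering_reflect:
  assumes s1: "fomin_square kap mu kaph muh c" and s2: "fomin_square mu nu muh nuh e"
    and l: "lowering kaph muh nuh muh1"
  obtains mu1 where "lowering kap mu nu mu1"
proof (rule ccontr)
  assume "\<not> thesis"
  then have nl: "\<nexists>mu1. lowering kap mu nu mu1" using that by blast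
  have i: "kap \<preceq> mu" "mu \<preceq> nu" "kap \<preceq> kaph" "mu \<preceq> muh" using s1 s2 by (auto simp: fomin_square_def)
  have ih: "kaph \<preceq> muh" "muh \<preceq> nuh" using fomin_square_interlaces s1 s2 by blast+
  define a where "a x = cj mu x - cj kap x" for x
  define d where "d x = cj nu x - cj mu x" for x
  define b where "b x = cj kaph x - cj kap x" for x
  note sq = fomin_squares_queues[OF s1 s2, folded a_def b_def d_def]
  note bits = sq(1-3) and c = sq(4) and e = sq(5) and muh = sq(6,7) and nuh = sq(8)
  obtain p where p: "queue (\<lambda>x. - ((cj mu x - cj kap x) - (cj nu x - cj mu x))) p"
    using height_queue[OF i(1,2)] by blast
  obtain ph where ph: "queue (\<lambda>x. - ((cj muh x - cj kaph x) - (cj nuh x - cj muh x))) ph"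
    using height_queue[OF ih] by blast
  have hat: "(cj muh x - cj kaph x) - (cj nuh x - cj muh x) = pass a c x - pass d e x" for x
    using muh(1)[of x] nuh[of x] by simp
  have "\<forall>x. height kap mu nu x \<le> 0"
    using nl lowering_exists_iff[OF i(1,2)] top_at_exists_iff(1)[OF i(1,2)] by blast
  then have "unmatched (\<lambda>x. a x - d x) p x = 0" for x
    using top_at_height_iff(2)[OF i(1,2) p] unfolding a_def d_def by blast
  then have "unmatched (\<lambda>x. pass a c x - pass d e x) ph x = 0" for x
    using carrier_unmatched_zero[OF bits c e p[folded a_def d_def] ph[unfolded hat]] by blast
  then have "\<forall>x. height kaph muh nuh x \<le> 0"
    using top_at_height_iff(2)[OF ih ph] unfolding hat by blast
  then show False
    using l lowering_exists_iff[OF ih] top_at_exists_iff(1)[OF ih] by blast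
qed

section \<open>Transfer of a row across a column\<close>

definition chain :: "nat \<Rightarrow> int list list \<Rightarrow> bool" where
  "chain n P \<longleftrightarrow> length P = Suc n \<and> (\<forall>i<n. P ! i \<preceq> P ! Suc i)"

lemma chain_interlaces: "chain n P \<Longrightarrow> i < n \<Longrightarrow> P ! i \<preceq> P ! Suc i"
  by (simp add: chain_def)

lemma chain_signature:
  assumes "chain n P" "n \<ge> 1" "i \<le> n"
  shows "P ! i \<in> signatures"
proof (cases "i < n")
  case True
  then show ?thesis using chain_interlaces[OF assms(1)] by (simp add: interlaces_def)
next
  case False
  then have "i = Suc (n - 1)" "n - 1 < n" using assms by auto
  then show ?thesis using chain_interlaces[OF assms(1), of "n - 1"] by (simp add: interlaces_def)
qed

lemma chain_length:
  assumes "chain n P" "i \<le> n"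
  shows "length (P ! i) = length (P ! 0)"
  using assms(2)
proof (induction i)
  case (Suc i)
  then show ?case using chain_interlaces[OF assms(1), of i] by (simp add: interlaces_def)
qed simp

lemma tableau_pairs_iff:
  assumes "n \<ge> 1"
  shows "b \<in> tableau_pairs n \<longleftrightarrow> chain n (fst b) \<and> chain n (snd b) \<and>
    fst b ! 0 = snd b ! 0 \<and> fst b ! n = snd b ! n"
proof
  assume "b \<in> tableau_pairs n"
  then show "chain n (fst b) \<and> chain n (snd b) \<and> fst b ! 0 = snd b ! 0 \<and> fst b ! n = snd b ! n"
    by (auto simp: tableau_pairs_def SST_def chain_def)
next
  assume "chain n (fst b) \<and> chain n (snd b) \<and> fst b ! 0 = snd b ! 0 \<and> fst b ! n = snd b ! n"
  moreover from this have "fst b ! n \<in> signatures" "fst b ! 0 \<in> signatures"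
    using chain_signature[of n "fst b"] assms by blast+
  moreover from calculation have "b \<in> SST (fst b ! n) (fst b ! 0) n \<times> SST (fst b ! n) (fst b ! 0) n"
    unfolding SST_def chain_def by (auto simp: mem_Times_iff)
  ultimately show "b \<in> tableau_pairs n"
    unfolding tableau_pairs_def by blast
qed

section \<open>Transfer of a row and the shift of a pair of tableaux\<close>

primrec transfer :: "int list list \<Rightarrow> int list \<Rightarrow> nat \<Rightarrow> int list" where
  "transfer P s 0 = s"
| "transfer P s (Suc i) = fomin_rule (P ! i) (P ! Suc i) (transfer P s i)"

lemma transfer_interlaces:
  assumes "chain n P" "P ! 0 \<preceq> s" "i \<le> n"
  shows "P ! i \<preceq> transfer P s i"
  using assms(3)
proof (induction i)
  case (Suc i)
  then have "P ! i \<preceq> transfer P s i" "P ! i \<preceq> P ! Suc i" using chain_interlaces[OF assms(1)] by auto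
  then obtain c where "fomin_square (P ! i) (P ! Suc i) (transfer P s i) (fomin_rule (P ! i) (P ! Suc i) (transfer P s i)) c"
    using fomin_rule_square by blast
  then show ?case using fomin_square_interlaces(1) by simp
qed (use assms in simp)

lemma transfer_square:
  assumes "chain n P" "P ! 0 \<preceq> s" "i < n"
  obtains c where "fomin_square (P ! i) (P ! Suc i) (transfer P s i) (transfer P s (Suc i)) c"
  using fomin_rule_square[OF chain_interlaces[OF assms(1,3)] transfer_interlaces[OF assms(1,2), of i]] assms(3)
  by (metis less_imp_le transfer.simps(2))

text \<open>Recursive form of \<open>iota2\<close> (see \<open>iota2_up\<close>), available before
  any field is known to exist. The last entry of the second component reflects the identification of
  \<open>(n, 1)\<close> with \<open>(0, n + 1)\<close> on the cylinder.\<close>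

definition up :: "nat \<Rightarrow> int list list \<times> int list list \<Rightarrow> int list list \<times> int list list" where
  "up n b = (map (transfer (fst b) (snd b ! 1)) [0..<Suc n],
     map (\<lambda>i. if i < n then snd b ! Suc i else transfer (fst b) (snd b ! 1) n) [0..<Suc n])"

lemma up_fst: "i \<le> n \<Longrightarrow> fst (up n b) ! i = transfer (fst b) (snd b ! 1) i"
  by (simp add: up_def del: upt_Suc)

lemma up_snd: "i < n \<Longrightarrow> snd (up n b) ! i = snd b ! Suc i"
  "snd (up n b) ! n = transfer (fst b) (snd b ! 1) n"
  by (simp_all add: up_def del: upt_Suc)

lemma up_length: "length (fst (up n b)) = Suc n" "length (snd (up n b)) = Suc n"
  by (simp_all add: up_def)

context
  fixes n :: nat
  assumes n: "n \<ge> 1"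
begin

lemma pair_start:
  assumes "b \<in> tableau_pairs n"
  shows "fst b ! 0 \<preceq> snd b ! 1"
  using assms n chain_interlaces[of n "snd b" 0] by (simp add: tableau_pairs_iff)

lemma up_square:
  assumes "b \<in> tableau_pairs n" "i < n"
  obtains c where "fomin_square (fst b ! i) (fst b ! Suc i) (fst (up n b) ! i) (fst (up n b) ! Suc i) c"
proof -
  have "chain n (fst b)" using assms n by (simp add: tableau_pairs_iff)
  then obtain c where "fomin_square (fst b ! i) (fst b ! Suc i) (transfer (fst b) (snd b ! 1) i)
      (transfer (fst b) (snd b ! 1) (Suc i)) c"
    using transfer_square pair_start[OF assms(1)] assms(2) by blast
  then show ?thesis using that assms(2) up_fst[of i n b] up_fst[of "Suc i" n b] by simp
qed

lemma up_in:
  assumes "b \<in> tableau_pairs n"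
  shows "up n b \<in> tableau_pairs n"
proof -
  have b: "chain n (fst b)" "chain n (snd b)" "fst b ! 0 = snd b ! 0" "fst b ! n = snd b ! n"
    using assms n by (auto simp: tableau_pairs_iff)
  have "fst (up n b) ! i \<preceq> fst (up n b) ! Suc i" if "i < n" for i
    using up_square[OF assms that] fomin_square_interlaces by metis
  moreover have "snd (up n b) ! i \<preceq> snd (up n b) ! Suc i" if "i < n" for i
  proof (cases "Suc i < n")
    case True
    then show ?thesis using chain_interlaces[OF b(2), of "Suc i"] that by (simp add: up_snd)
  next
    case False
    then have "Suc i = n" using that by simp
    then show ?thesis
      using transfer_interlaces[OF b(1) pair_start[OF assms], of n] that b(4) by (auto simp: up_snd)
  qed
  ultimately show ?thesis
    using n by (auto simp: tableau_pairs_iff chain_def up_length up_fst up_snd)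
qed

text \<open>The shifted pair retains the second tableau except for its start, hence also the right
  end of the first tableau; from there the local rule is undone from right to left.\<close>

lemma up_inj: "inj_on (up n) (tableau_pairs n)"
proof (rule inj_onI)
  fix b b' assume b: "b \<in> tableau_pairs n" and b': "b' \<in> tableau_pairs n" and eq: "up n b = up n b'"
  have snd_eq: "snd b ! Suc i = snd b' ! Suc i" if "i < n" for i
    using that eq up_snd(1) by metis
  have "fst b ! i = fst b' ! i" if "i \<le> n" for i
    using that
  proof (induction rule: inc_induct)
    case base
    then show ?case using snd_eq[of "n - 1"] n b b' by (simp add: tableau_pairs_iff)
  next
    case (step i)
    then show ?case
      using up_square[OF b, of i] up_square[OF b', of i] eq fomin_square_cancel by metis
  qed
  then have "fst b = fst b'" using b b' n by (intro nth_equalityI) (auto simp: tableau_pairs_iff chain_def)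
  moreover have "snd b ! i = snd b' ! i" if "i \<le> n" for i
    using that snd_eq[of "i - 1"] b b' n \<open>fst b = fst b'\<close> by (cases i) (auto simp: tableau_pairs_iff)
  then have "snd b = snd b'" using b b' n by (intro nth_equalityI) (auto simp: tableau_pairs_iff chain_def)
  ultimately show "b = b'" by (simp add: prod_eq_iff)
qed

lemma up_surj:
  assumes b1: "b1 \<in> tableau_pairs n"
  obtains b where "b \<in> tableau_pairs n" "up n b = b1"
proof -
  define P1 where "P1 = fst b1"
  define Q1 where "Q1 = snd b1"
  have c1: "chain n P1" "chain n Q1" "P1 ! 0 = Q1 ! 0" "P1 ! n = Q1 ! n"
    using b1 n by (auto simp: tableau_pairs_iff P1_def Q1_def)
  define inv_rule where "inv_rule mu lam nu = (SOME kap. \<exists>c. fomin_square kap mu lam nu c)" for mu lam nu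
  have inv_rule: "\<exists>c. fomin_square (inv_rule mu lam nu) mu lam nu c" if "mu \<preceq> nu" "lam \<preceq> nu" for mu lam nu
    unfolding inv_rule_def by (rule someI_ex) (use fomin_square_exists_backward[OF that] in metis)
  \<comment> \<open>\<open>B k\<close> is the signature \<open>k\<close> places from the right end
    of the row sought. The start is \<open>Q1 ! (n - 1)\<close>, since the second component of a
    shifted pair holds the old common end at position \<open>n - 1\<close>.\<close>
  define B where "B = rec_nat (Q1 ! (n - 1)) (\<lambda>k v. inv_rule v (P1 ! (n - Suc k)) (P1 ! (n - k)))"
  have B0: "B 0 = Q1 ! (n - 1)" and BS: "B (Suc k) = inv_rule (B k) (P1 ! (n - Suc k)) (P1 ! (n - k))" for k
    by (simp_all add: B_def)
  have Bi: "B k \<preceq> P1 ! (n - k) \<and>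
      (\<forall>j<k. \<exists>c. fomin_square (B (Suc j)) (B j) (P1 ! (n - Suc j)) (P1 ! (n - j)) c)" if "k \<le> n" for k
    using that
  proof (induction k)
    case 0
    then show ?case using chain_interlaces[OF c1(2), of "n - 1"] n c1(4) by (simp add: B0)
  next
    case (Suc k)
    have "P1 ! (n - Suc k) \<preceq> P1 ! (n - k)"
      using chain_interlaces[OF c1(1), of "n - Suc k"] Suc.prems by (simp add: Suc_diff_Suc)
    then obtain c where "fomin_square (B (Suc k)) (B k) (P1 ! (n - Suc k)) (P1 ! (n - k)) c"
      using inv_rule Suc unfolding BS by (meson Suc_leD)
    then show ?case using Suc by (auto simp: fomin_square_def less_Suc_eq)
  qed
  define P where "P = map (\<lambda>i. B (n - i)) [0..<Suc n]"
  define Q where "Q = map (\<lambda>i. if i = 0 then P ! 0 else Q1 ! (i - 1)) [0..<Suc n]"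
  have P_nth: "P ! i = B (n - i)" if "i \<le> n" for i using that by (simp add: P_def del: upt_Suc)
  have Q_nth: "Q ! 0 = P ! 0" "i < n \<Longrightarrow> Q ! Suc i = Q1 ! i" for i by (simp_all add: Q_def del: upt_Suc)
  have sq: "\<exists>c. fomin_square (P ! i) (P ! Suc i) (P1 ! i) (P1 ! Suc i) c" if "i < n" for i
    using Bi[of n] that by (auto simp: P_nth Suc_diff_Suc dest!: spec[of _ "n - Suc i"])
  have P_last: "P ! n = Q ! n" using Q_nth(2)[of "n - 1"] n by (simp add: P_nth B0)
  have "P ! i \<preceq> P ! Suc i" if "i < n" for i using sq[OF that] by (auto simp: fomin_square_def)
  then have chP: "chain n P" by (simp add: chain_def P_def)
  have "Q ! i \<preceq> Q ! Suc i" if "i < n" for i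
  proof (cases i)
    case 0
    then show ?thesis using Q_nth n sq[of 0] c1(3) by (auto simp: fomin_square_def)
  next
    case (Suc j)
    then show ?thesis using Q_nth(2) that chain_interlaces[OF c1(2), of j] by simp
  qed
  then have chQ: "chain n Q" by (simp add: chain_def Q_def)
  have mem: "(P, Q) \<in> tableau_pairs n"
    using n chP chQ P_last Q_nth by (simp add: tableau_pairs_iff)
  have tr: "transfer P (Q ! 1) i = P1 ! i" if "i \<le> n" for i
    using that
  proof (induction i)
    case 0
    then show ?case using Q_nth(2)[of 0] n c1(3) by simp
  next
    case (Suc i)
    then show ?case using sq[of i] fomin_rule_eq by auto
  qed
  have "fst (up n (P, Q)) = P1"
    using c1(1) tr by (intro nth_equalityI) (simp_all add: up_length up_fst chain_def)
  moreover have "snd (up n (P, Q)) ! i = Q1 ! i" if "i \<le> n" for i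
    using that tr[of n] c1(4) by (cases "i < n") (auto simp: up_snd Q_nth)
  then have "snd (up n (P, Q)) = Q1"
    using c1(2) by (intro nth_equalityI) (auto simp: up_length chain_def)
  ultimately have "up n (P, Q) = b1" by (simp add: prod_eq_iff P1_def Q1_def)
  with mem show ?thesis using that by blast
qed

section \<open>Fomin fields\<close>

definition pair_at :: "(int \<times> int \<Rightarrow> int list) \<Rightarrow> int \<Rightarrow> int \<Rightarrow> int list list \<times> int list list" where
  "pair_at L x y = (map (\<lambda>i. L (x + int i, y)) [0..<Suc n], map (\<lambda>i. L (x, y + int i)) [0..<Suc n])"

lemma pair_at_nth:
  assumes "i \<le> n"
  shows "fst (pair_at L x y) ! i = L (x + int i, y)" "snd (pair_at L x y) ! i = L (x, y + int i)"
  using assms by (simp_all add: pair_at_def del: upt_Suc)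

lemma pair_at_eq_iff:
  assumes "b \<in> tableau_pairs n"
  shows "pair_at L x y = b \<longleftrightarrow> (\<forall>i\<le>n. L (x + int i, y) = fst b ! i \<and> L (x, y + int i) = snd b ! i)"
    (is "?l \<longleftrightarrow> ?r")
proof
  assume ?l then show ?r using pair_at_nth by metis
next
  assume r: ?r
  have "length (fst b) = Suc n" "length (snd b) = Suc n"
    using assms n by (auto simp: tableau_pairs_iff chain_def)
  then have "fst (pair_at L x y) = fst b" "snd (pair_at L x y) = snd b"
    using r by (auto intro!: nth_equalityI simp: pair_at_def simp del: upt_Suc)
  then show ?l by (simp add: prod_eq_iff)
qed

lemma field_periodic:
  assumes "fomin_field n L"
  shows "L (x + k * int n, y) = L (x, y + k * int n)"
proof -
  have "((x, y + k * int n), (x + k * int n, y)) \<in> cylinder_rel n"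
    by (auto simp: cylinder_rel_def)
  then show ?thesis using assms unfolding fomin_field_def congruent_def by fastforce
qed

lemma fieldD:
  assumes "fomin_field n L"
  shows "L (x, y) \<preceq> L (x + 1, y)" "L (x, y) \<preceq> L (x, y + 1)"
    "L (x + 1, y + 1) = fomin_rule (L (x, y)) (L (x + 1, y)) (L (x, y + 1))"
  using assms unfolding fomin_field_def by blast+

lemma pair_at_in:
  assumes "fomin_field n L"
  shows "pair_at L x y \<in> tableau_pairs n"
proof -
  have "L (x + int n, y) = L (x, y + int n)" using field_periodic[OF assms, of x 1] by simp
  moreover have "L (x + int i, y) \<preceq> L (x + (1 + int i), y)" "L (x, y + int i) \<preceq> L (x, y + (1 + int i))" for i
    using fieldD(1)[OF assms, of "x + int i" y] fieldD(2)[OF assms, of x "y + int i"] by (simp_all add: algebra_simps)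
  ultimately show ?thesis
    using n by (auto simp: tableau_pairs_iff chain_def pair_at_nth) (simp_all add: pair_at_def)
qed

lemma pair_at_up:
  assumes "fomin_field n L"
  shows "pair_at L x (y + 1) = up n (pair_at L x y)"
proof -
  have tr: "transfer (fst (pair_at L x y)) (L (x, y + 1)) i = L (x + int i, y + 1)" if "i \<le> n" for i
    using that
  proof (induction i)
    case (Suc i)
    then show ?case using fieldD(3)[OF assms, of "x + int i" y]
      by (simp add: pair_at_nth algebra_simps)
  qed simp
  have s1: "snd (pair_at L x y) ! 1 = L (x, y + 1)" using pair_at_nth(2)[of 1] n by simp
  have en: "snd (up n (pair_at L x y)) ! n = L (x, y + 1 + int n)"
    using tr[of n] field_periodic[OF assms, of x 1 "y + 1"] unfolding up_snd s1 by simp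
  have "fst (up n (pair_at L x y)) ! i = L (x + int i, y + 1)" if "i \<le> n" for i
    using that by (simp add: up_fst s1[simplified] tr)
  moreover have "snd (up n (pair_at L x y)) ! i = L (x, y + 1 + int i)" if "i \<le> n" for i
    using that en by (cases "i < n") (auto simp: up_snd pair_at_nth algebra_simps)
  ultimately show ?thesis
    using pair_at_in[OF assms, of x y] by (subst pair_at_eq_iff) (auto intro: up_in)
qed

text \<open>The pairs along \<open>x = 0\<close> are determined upwards by \<open>up\<close> and
  downwards by its injectivity, and every point of the cylinder has a representative with
  \<open>x\<close> between 0 and \<open>n - 1\<close>.\<close>

lemma field_unique:
  assumes "fomin_field n L" "fomin_field n L'" "pair_at L 0 0 = pair_at L' 0 0"
  shows "L = L'"
proof -
  have eq: "pair_at L 0 y = pair_at L' 0 y" for y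
  proof (induction y rule: int_induct[of _ 0])
    case base show ?case by (rule assms)
  next
    case (step1 i)
    then show ?case using pair_at_up assms by simp
  next
    case (step2 i)
    then have "up n (pair_at L 0 (i - 1)) = up n (pair_at L' 0 (i - 1))"
      using pair_at_up[OF assms(1), of 0 "i - 1"] pair_at_up[OF assms(2), of 0 "i - 1"] by simp
    then show ?case using up_inj pair_at_in assms by (meson inj_onD)
  qed
  show ?thesis
  proof
    fix p :: "int \<times> int"
    obtain x y where p: "p = (x, y)" by fastforce
    define k where "k = x div int n"
    define r where "r = nat (x mod int n)"
    have r: "x = int r + k * int n" "r \<le> n" using n by (auto simp: k_def r_def nat_le_iff less_imp_le)
    have "M (x, y) = fst (pair_at M 0 (y + k * int n)) ! r" if "fomin_field n M" for M
      using field_periodic[OF that, of "int r" k y] r by (simp add: pair_at_nth)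
    then have "L (x, y) = fst (pair_at L 0 (y + k * int n)) ! r" "L' (x, y) = fst (pair_at L' 0 (y + k * int n)) ! r"
      using assms by blast+
    then show "L p = L' p" using eq p by metis
  qed
qed

lemma field_exists:
  assumes b: "b \<in> tableau_pairs n"
  obtains L where "fomin_field n L" "pair_at L 0 0 = b"
proof -
  let ?X = "tableau_pairs n"
  define d where "d = inv_into ?X (up n)"
  have d: "d c \<in> ?X" "up n (d c) = c" if "c \<in> ?X" for c
  proof -
    have "c \<in> up n ` ?X" using up_surj[OF that] by blast
    then show "d c \<in> ?X" "up n (d c) = c" unfolding d_def by (auto intro: inv_into_into f_inv_into_f)
  qed
  \<comment> \<open>The orbit of \<open>b\<close> under \<open>up\<close>, continued to negative
    indices by the inverse \<open>d\<close>; \<open>g k\<close> is to become the pair of the field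
    at \<open>(0, k)\<close>.\<close>
  define g where "g k = (if k \<ge> 0 then (up n ^^ nat k) b else (d ^^ nat (- k)) b)" for k :: int
  have dn: "(d ^^ k) b \<in> ?X" for k by (induction k) (use b d in auto)
  have un: "(up n ^^ k) b \<in> ?X" for k by (induction k) (use b up_in in auto)
  have gX: "g k \<in> ?X" for k using dn un by (simp add: g_def)
  have gS: "g (k + 1) = up n (g k)" for k
  proof (cases "k \<ge> 0")
    case True
    then show ?thesis by (simp add: g_def nat_add_distrib)
  next
    case False
    then have "nat (- k) = Suc (nat (- (k + 1)))" by simp
    then have "g k = d (g (k + 1))" using False by (auto simp: g_def)
    then show ?thesis using d gX by metis
  qed
  define P where "P k = fst (g k)" for k
  define Q where "Q k = snd (g k)" for k
  have ch: "chain n (P k)" "P k ! 0 = Q k ! 0" "P k ! n = Q k ! n" for k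
    using gX[of k] n by (auto simp: tableau_pairs_iff P_def Q_def)
  have sq: "\<exists>c. fomin_square (P k ! i) (P k ! Suc i) (P (k + 1) ! i) (P (k + 1) ! Suc i) c" if "i < n" for k i
    using up_square[OF gX[of k] that] by (metis P_def gS)
  have Qs: "Q (k + 1) ! i = Q k ! Suc i" if "i < n" for k i
    using that by (simp add: Q_def gS up_snd)
  have "Q (k + int i) ! j = Q k ! (j + i)" if "j + i \<le> n" for k i j
    using that
  proof (induction i arbitrary: k j)
    case (Suc i)
    then show ?case using Suc.IH[of j "k + 1"] Qs[of "j + i" k] by (simp add: algebra_simps)
  qed simp
  then have wrap: "P k ! n = P (k + int n) ! 0" for k using ch[of k] ch[of "k + int n"] by simp
  \<comment> \<open>Each point is moved along the cylinder relation to the representative with first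
    coordinate between 0 and \<open>n - 1\<close> and read off there.\<close>
  define L where "L p = P (snd p + int n * (fst p div int n)) ! nat (fst p mod int n)" for p
  \<comment> \<open>The case \<open>r = n\<close> is included because a square starting at
    \<open>r = n - 1\<close> straddles the cut of the cylinder; it rests on
    \<open>wrap\<close>.\<close>
  have L: "L (int r + q * int n, y) = P (y + int n * q) ! r" if "r \<le> n" for r q y
  proof (cases "r = n")
    case True
    have "int r + q * int n = 0 + (q + 1) * int n" using True by (simp add: algebra_simps)
    then have "L (int r + q * int n, y) = P (y + int n * (q + 1)) ! 0" using n by (simp add: L_def)
    also have "\<dots> = P (y + int n * q) ! n" using wrap[of "y + int n * q"] by (simp add: algebra_simps)
    finally show ?thesis using True by simp
  next
    case False
    then have "int r < int n" using that by simp
    then show ?thesis by (simp add: L_def div_add1_eq)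
  qed
  have coord: "\<exists>r q. x = int r + q * int n \<and> r < n" for x :: int
    using n by (intro exI[of _ "nat (x mod int n)"] exI[of _ "x div int n"]) (auto simp: nat_less_iff)
  have len0: "length (P k ! 0) = length (P 0 ! 0)" for k
  proof (induction k rule: int_induct[of _ 0])
    case (step1 i)
    then show ?case using sq[of 0 i] n by (auto simp: fomin_square_def interlaces_def)
  next
    case (step2 i)
    then show ?case using sq[of 0 "i - 1"] n by (auto simp: fomin_square_def interlaces_def)
  qed simp
  have field: "fomin_field n L"
    unfolding fomin_field_def
  proof (intro conjI allI exI)
    show "L respects cylinder_rel n"
    proof (rule congruentI)
      fix p p' assume "(p, p') \<in> cylinder_rel n"
      then obtain x y k where p: "p = (x, y)" "p' = (x + k * int n, y - k * int n)"
        by (cases p; cases p') (auto simp: cylinder_rel_def)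
      obtain r q where r: "x = int r + q * int n" "r < n" using coord by blast
      have "x + k * int n = int r + (q + k) * int n" using r by (simp add: algebra_simps)
      then have "L p' = P (y - k * int n + int n * (q + k)) ! r"
        using L[of r "q + k" "y - k * int n"] r(2) unfolding p by simp
      also have "\<dots> = P (y + int n * q) ! r" by (simp add: algebra_simps)
      finally show "L p = L p'" using p r L by simp
    qed
  next
    fix p :: "int \<times> int"
    obtain x y where p: "p = (x, y)" by fastforce
    obtain r q where r: "x = int r + q * int n" "r < n" using coord by blast
    show "L p \<in> sig (length (P 0 ! 0))"
      using chain_signature[OF ch(1) n, of r] chain_length[OF ch(1), of r] r L[of r q y] len0[of "y + int n * q"]
      unfolding p by (metis less_imp_le signatures_iff)
  next
    fix x y :: int
    obtain r q where r: "x = int r + q * int n" "r < n" using coord by blast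
    have r1: "x + 1 = int (Suc r) + q * int n" "Suc r \<le> n" using r by auto
    have L4: "L (x, y) = P (y + int n * q) ! r" "L (x + 1, y) = P (y + int n * q) ! Suc r"
      "L (x, y + 1) = P (y + int n * q + 1) ! r" "L (x + 1, y + 1) = P (y + int n * q + 1) ! Suc r"
      using L[of r q y] L[of "Suc r" q y] L[of r q "y + 1"] L[of "Suc r" q "y + 1"] r r1
      by (simp_all add: algebra_simps)
    obtain c where c: "fomin_square (L (x, y)) (L (x + 1, y)) (L (x, y + 1)) (L (x + 1, y + 1)) c"
      using sq[OF r(2), of "y + int n * q"] unfolding L4 by blast
    then show "L (x, y) \<preceq> L (x + 1, y)" "L (x, y) \<preceq> L (x, y + 1)" by (simp_all add: fomin_square_def)
    show "L (x + 1, y + 1) = fomin_rule (L (x, y)) (L (x + 1, y)) (L (x, y + 1))"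
      using fomin_rule_eq[OF c] by simp
  qed
  have "L (int i, 0) = fst b ! i" if "i \<le> n" for i
    using L[OF that, of 0 0] by (simp add: P_def g_def)
  moreover have "L (0, int i) = snd b ! i" if "i \<le> n" for i
    using L[of 0 0 "int i"] \<open>\<And>k i j. j + i \<le> n \<Longrightarrow> Q (k + int i) ! j = Q k ! (j + i)\<close>[of 0 i 0] that ch(2)[of "int i"]
    by (simp add: Q_def g_def)
  ultimately have "pair_at L 0 0 = b" using b by (simp add: pair_at_eq_iff)
  with field show ?thesis using that by blast
qed

section \<open>The shifts as translations of the field\<close>

lemma field_of_pair_eq:
  assumes "fomin_field n L"
  shows "field_of_pair n (pair_at L 0 0) = L"
proof -
  note b = pair_at_in[OF assms, of 0 0]
  have "(\<forall>i\<le>n. M (int i, 0) = fst (pair_at L 0 0) ! i \<and> M (0, int i) = snd (pair_at L 0 0) ! i) \<longleftrightarrow>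
      pair_at M 0 0 = pair_at L 0 0" for M
    using pair_at_eq_iff[OF b, of M 0 0] by simp
  then show ?thesis
    unfolding field_of_pair_def using assms field_unique by (auto intro!: the_equality)
qed

text \<open>A translated field is again a field, and by uniqueness it is the field of the translated
  pair. Closure, commutation and transposition of the shifts all follow from this.\<close>

lemma iota_pair_at:
  assumes "fomin_field n L"
  shows "iota1 n (pair_at L x y) = pair_at L (x + 1) y" "iota2 n (pair_at L x y) = pair_at L x (y + 1)"
proof -
  define M where "M p = L (x + fst p, y + snd p)" for p
  have "fomin_field n M"
    unfolding fomin_field_def
  proof (intro conjI allI)
    show "M respects cylinder_rel n"
    proof (rule congruentI)
      fix p q assume "(p, q) \<in> cylinder_rel n"
      then obtain u v k where pq: "p = (u, v)" "q = (u + k * int n, v - k * int n)"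
        by (cases p; cases q) (auto simp: cylinder_rel_def)
      show "M p = M q" using field_periodic[OF assms, of "x + u" k "y + v - k * int n"] pq
        by (simp add: M_def algebra_simps)
    qed
    obtain l where "\<And>p. L p \<in> sig l" using assms unfolding fomin_field_def by blast
    then show "\<exists>l. \<forall>p. M p \<in> sig l" unfolding M_def by blast
    fix u v
    show "M (u, v) \<preceq> M (u + 1, v)" "M (u, v) \<preceq> M (u, v + 1)"
      "M (u + 1, v + 1) = fomin_rule (M (u, v)) (M (u + 1, v)) (M (u, v + 1))"
      using fieldD[OF assms, of "x + u" "y + v"] by (simp_all add: M_def add.assoc)
  qed
  from field_of_pair_eq[OF this] have "field_of_pair n (pair_at M 0 0) = M" .
  moreover have "pair_at M 0 0 = pair_at L x y" by (simp add: pair_at_def M_def)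
  ultimately show "iota1 n (pair_at L x y) = pair_at L (x + 1) y" "iota2 n (pair_at L x y) = pair_at L x (y + 1)"
    by (simp_all add: iota1_def iota2_def pair_at_def M_def add.assoc del: upt_Suc)
qed

lemma iota2_up:
  assumes "b \<in> tableau_pairs n" shows "iota2 n b = up n b"
  using field_exists[OF assms] iota_pair_at(2) pair_at_up by (metis add_0)

lemma iota_in:
  assumes "b \<in> tableau_pairs n"
  shows "iota1 n b \<in> tableau_pairs n" "iota2 n b \<in> tableau_pairs n"
  using field_exists[OF assms] iota_pair_at pair_at_in by metis+

lemma iota_commute:
  assumes "b \<in> tableau_pairs n"
  shows "iota1 n (iota2 n b) = iota2 n (iota1 n b)"
  using field_exists[OF assms] iota_pair_at by metis

lemma iota2_bij: "bij_betw (iota2 n) (tableau_pairs n) (tableau_pairs n)"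
proof -
  have "bij_betw (up n) (tableau_pairs n) (tableau_pairs n)"
    unfolding bij_betw_def using up_inj up_in up_surj by (metis image_subsetI imageI subsetI subset_antisym)
  then show ?thesis using bij_betw_cong[of "tableau_pairs n" "iota2 n" "up n"] iota2_up by blast
qed

text \<open>The cylinder relation and the local rule are symmetric in the two coordinates.\<close>

lemma field_transpose:
  assumes "fomin_field n L"
  shows "fomin_field n (\<lambda>p. L (snd p, fst p))"
  unfolding fomin_field_def
proof (intro conjI allI)
  show "(\<lambda>p. L (snd p, fst p)) respects cylinder_rel n"
  proof (rule congruentI)
    fix p q assume "(p, q) \<in> cylinder_rel n"
    then obtain u v k where pq: "p = (u, v)" "q = (u + k * int n, v - k * int n)"
      by (cases p; cases q) (auto simp: cylinder_rel_def)
    show "L (snd p, fst p) = L (snd q, fst q)" using field_periodic[OF assms, of "v - k * int n" k "u"] pq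
      by simp
  qed
  show "\<exists>l. \<forall>p. L (snd p, fst p) \<in> sig l" using assms unfolding fomin_field_def by blast
  fix u v
  show "L (snd (u, v), fst (u, v)) \<preceq> L (snd (u + 1, v), fst (u + 1, v))" 
    "L (snd (u, v), fst (u, v)) \<preceq> L (snd (u, v + 1), fst (u, v + 1))"
    "L (snd (u + 1, v + 1), fst (u + 1, v + 1)) = fomin_rule (L (snd (u, v), fst (u, v)))
       (L (snd (u + 1, v), fst (u + 1, v))) (L (snd (u, v + 1), fst (u, v + 1)))"
    using fieldD[OF assms, of v u] by (auto intro: fomin_rule_commute)
qed

lemma swap_in: "prod.swap b \<in> tableau_pairs n \<longleftrightarrow> b \<in> tableau_pairs n"
  unfolding tableau_pairs_iff[OF n] fst_swap snd_swap by auto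

lemma iota1_swap:
  assumes "b \<in> tableau_pairs n"
  shows "iota1 n b = prod.swap (iota2 n (prod.swap b))"
proof -
  obtain L where L: "fomin_field n L" "pair_at L 0 0 = b" using field_exists[OF assms] by blast
  define M where "M = (\<lambda>p. L (snd p, fst p))"
  have M: "fomin_field n M" unfolding M_def by (rule field_transpose[OF L(1)])
  have sw: "pair_at M x y = prod.swap (pair_at L y x)" for x y by (simp add: pair_at_def M_def)
  show ?thesis
    using iota_pair_at(1)[OF L(1), of 0 0] iota_pair_at(2)[OF M, of 0 0] L(2) by (simp add: sw)
qed

lemma iota1_bij: "bij_betw (iota1 n) (tableau_pairs n) (tableau_pairs n)"
proof -
  let ?X = "tableau_pairs n"
  have sw: "bij_betw prod.swap ?X ?X"
    by (rule bij_betw_byWitness[where f' = prod.swap]) (simp_all add: image_subset_iff swap_in)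
  have "bij_betw (prod.swap \<circ> (iota2 n \<circ> prod.swap)) ?X ?X"
    by (rule bij_betw_trans[OF bij_betw_trans[OF sw iota2_bij] sw])
  then show ?thesis
    using bij_betw_cong[of "?X" "iota1 n" "prod.swap \<circ> (iota2 n \<circ> prod.swap)"] iota1_swap by simp
qed

end

section \<open>Heights and strings\<close>

lemma psum_lower:
  assumes "\<And>y. cj mu1 y = cj mu y - (if y = x then 1 else 0)" "length mu1 = length mu"
  shows "psum mu1 y = psum mu y - (if y \<ge> x then 1 else 0)"
proof -
  obtain N1 N2 where N: "\<And>y. y \<le> N1 \<Longrightarrow> psum mu1 y = int (length mu1) * y"
    "\<And>y. y \<le> N2 \<Longrightarrow> psum mu y = int (length mu) * y"
    using psum_left by metis
  show ?thesis
  proof (rule left_induct[of "min (min N1 N2) (x - 1)" "\<lambda>y. psum mu1 y = psum mu y - (if y \<ge> x then 1 else 0)"])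
    show "psum mu1 y = psum mu y - (if y \<ge> x then 1 else 0)" if "y \<le> min (min N1 N2) (x - 1)" for y
      using that N assms(2) by simp
    show "psum mu1 y = psum mu y - (if y \<ge> x then 1 else 0)"
      if "psum mu1 (y - 1) = psum mu (y - 1) - (if y - 1 \<ge> x then 1 else 0)" for y
      using that psum_diff[of mu1 y] psum_diff[of mu y] assms(1)[of y] by (auto split: if_splits)
  qed
qed

lemma lowering_height:
  assumes "lowering kap mu nu mu1"
  obtains x where "top_at (height kap mu nu) x"
    "\<And>y. height kap mu1 nu y = height kap mu nu y - (if y \<ge> x then 2 else 0)"
    "sum_list mu1 = sum_list mu - 1"
proof -
  obtain x where x: "top_at (height kap mu nu) x" "\<And>y. cj mu1 y = cj mu y - (if y = x then 1 else 0)"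
    using assms unfolding lowering_def by blast
  have "length mu1 = length mu" using assms by (simp add: lowering_def sig_iff)
  note ps = psum_lower[OF x(2) this]
  obtain M1 M2 where M: "\<And>y. y \<ge> M1 \<Longrightarrow> psum mu1 y = sum_list mu1"
    "\<And>y. y \<ge> M2 \<Longrightarrow> psum mu y = sum_list mu"
    using psum_right by metis
  have "sum_list mu1 = sum_list mu - 1"
    using ps[of "max (max M1 M2) x"] M(1)[of "max (max M1 M2) x"] M(2)[of "max (max M1 M2) x"] by simp
  moreover have "height kap mu1 nu y = height kap mu nu y - (if y \<ge> x then 2 else 0)" for y
    using ps[of y] by (simp add: height_def)
  ultimately show ?thesis using that x(1) by blast
qed

text \<open>The value of the height far to the right, by \<open>height_right\<close>. For
  consecutive signatures of a chain it is the number of labels \<open>i\<close> minus the number of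
  labels \<open>i + 1\<close>.\<close>

definition excess :: "int list \<Rightarrow> int list \<Rightarrow> int list \<Rightarrow> int" where
  "excess kap mu nu = 2 * sum_list mu - sum_list kap - sum_list nu"

text \<open>This turns out to be the largest exponent of \<open>f\<close>, and
  \<open>string_phi - excess\<close> that of \<open>e\<close>.\<close>

definition string_phi :: "int list \<Rightarrow> int list \<Rightarrow> int list \<Rightarrow> int" where
  "string_phi kap mu nu = Max (range (height kap mu nu))"

lemma string_phi_bounds:
  assumes i: "kap \<preceq> mu" "mu \<preceq> nu"
  shows "0 \<le> string_phi kap mu nu" "excess kap mu nu \<le> string_phi kap mu nu"
    "height kap mu nu x \<le> string_phi kap mu nu"
proof -
  show le: "height kap mu nu x \<le> string_phi kap mu nu" for x
    unfolding string_phi_def using height_finite[OF i] by simp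
  show "0 \<le> string_phi kap mu nu" using height_left[OF i] le by (metis order_refl)
  show "excess kap mu nu \<le> string_phi kap mu nu"
    using height_right[of kap mu nu] le unfolding excess_def by (metis order_refl)
qed

lemma top_at_value:
  assumes "kap \<preceq> mu" "mu \<preceq> nu" "top_at (height kap mu nu) x"
  shows "height kap mu nu x = string_phi kap mu nu"
proof -
  have "height kap mu nu y \<le> height kap mu nu x" for y
    using assms(3) by (cases y x rule: linorder_cases) (auto simp: top_at_def)
  then show ?thesis
    unfolding string_phi_def by (intro Max_eqI[symmetric]) (use height_finite[OF assms(1,2)] in auto)
qed

text \<open>The height drops by 2 from its leftmost maximum \<open>x\<close> on, while
  \<open>x - 1\<close> keeps the value one below the maximum and now becomes maximal.\<close>

lemma lowering_string_phi:
  assumes i: "kap \<preceq> mu" "mu \<preceq> nu" and l: "lowering kap mu nu mu1"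
  shows "string_phi kap mu1 nu = string_phi kap mu nu - 1"
    "excess kap mu1 nu = excess kap mu nu - 2"
proof -
  obtain x where x: "top_at (height kap mu nu) x"
    "\<And>y. height kap mu1 nu y = height kap mu nu y - (if y \<ge> x then 2 else 0)"
    "sum_list mu1 = sum_list mu - 1"
    using lowering_height[OF l] by blast
  note v = top_at_value[OF i x(1)]
  have lx: "height kap mu nu (x - 1) = string_phi kap mu nu - 1"
    using top_at_bits(1,2)[OF i x(1)] height_diff[of kap mu nu x] v by simp
  have "height kap mu1 nu y \<le> string_phi kap mu nu - 1" for y
  proof (cases "y \<ge> x")
    case True
    then show ?thesis using x(2)[of y] string_phi_bounds(3)[OF i, of y] by simp
  next
    case False
    then show ?thesis using x(1,2) v by (auto simp: top_at_def)
  qed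
  then show "string_phi kap mu1 nu = string_phi kap mu nu - 1"
    using lx x(2)[of "x - 1"] unfolding string_phi_def[of kap mu1 nu]
    by (intro Max_eqI height_finite lowering_interlaces[OF i l]) (auto intro: range_eqI[of _ _ "x - 1"])
  show "excess kap mu1 nu = excess kap mu nu - 2" using x(3) by (simp add: excess_def)
qed

lemma lowering_iff_string_phi:
  assumes i: "kap \<preceq> mu" "mu \<preceq> nu"
  shows "(\<exists>mu1. lowering kap mu nu mu1) \<longleftrightarrow> string_phi kap mu nu > 0"
proof -
  have "string_phi kap mu nu \<in> range (height kap mu nu)"
    unfolding string_phi_def using height_finite[OF i] by (intro Max_in) auto
  then obtain x where x: "height kap mu nu x = string_phi kap mu nu" by force
  show ?thesis
    unfolding lowering_exists_iff[OF i] top_at_exists_iff[OF i]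
    using string_phi_bounds(3)[OF i] x by (metis not_le order_trans)
qed

text \<open>The position where a raising takes place is found by reading from right to left.\<close>

abbreviation last_top :: "(int \<Rightarrow> int) \<Rightarrow> int \<Rightarrow> bool" where
  "last_top h x \<equiv> top_at (\<lambda>y. h (- y)) (- x)"

lemma last_top_iff: "last_top h x \<longleftrightarrow> (\<forall>y<x. h y \<le> h x) \<and> (\<forall>y>x. h y < h x)"
proof -
  have "(\<forall>y. y < - x \<longrightarrow> h (- y) < h x) \<longleftrightarrow> (\<forall>y>x. h y < h x)"
    by (metis minus_less_iff minus_minus)
  moreover have "(\<forall>y. y > - x \<longrightarrow> h (- y) \<le> h x) \<longleftrightarrow> (\<forall>y<x. h y \<le> h x)"
    by (metis minus_less_iff minus_minus)
  ultimately show ?thesis unfolding top_at_def by auto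
qed

text \<open>Read from right to left the height starts at \<open>excess\<close>, which takes over the
  role that the initial value 0 has for lowerings.\<close>

lemma last_top_exists:
  assumes i: "kap \<preceq> mu" "mu \<preceq> nu" and "string_phi kap mu nu > excess kap mu nu"
  shows "\<exists>x. last_top (height kap mu nu) x"
proof -
  let ?h = "height kap mu nu"
  have "string_phi kap mu nu \<in> range ?h"
    unfolding string_phi_def using height_finite[OF i] by (intro Max_in) auto
  then obtain z where z: "?h (- z) > excess kap mu nu" using assms(3)
    by (metis (no_types, lifting) imageE minus_minus)
  obtain M where "\<And>x. x \<ge> M \<Longrightarrow> ?h x = excess kap mu nu" using height_right unfolding excess_def by blast
  then have "?h (- x) = excess kap mu nu" if "x \<le> - M" for x using that by simp
  moreover have "finite (range (\<lambda>y. ?h (- y)))"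
    by (rule finite_subset[OF _ height_finite[OF i]]) auto
  ultimately obtain x where "top_at (\<lambda>y. ?h (- y)) x"
    using top_at_exists[of "\<lambda>y. ?h (- y)" "- M" "excess kap mu nu" z] z by blast
  then show ?thesis by (intro exI[of _ "- x"]) simp
qed

lemma last_top_bits:
  assumes i: "kap \<preceq> mu" "mu \<preceq> nu" and "last_top (height kap mu nu) x"
  shows "cj mu (x + 1) = cj kap (x + 1)" "cj nu (x + 1) = cj mu (x + 1) + 1"
    "cj mu x > cj mu (x + 1)"
proof -
  let ?h = "height kap mu nu"
  have "?h (x - 1) \<le> ?h x" "?h (x + 1) < ?h x"
    using assms(3) unfolding last_top_iff by auto
  note h = this height_diff[of kap mu nu x] height_diff[of kap mu nu "x + 1"]
  show 1: "cj mu (x + 1) = cj kap (x + 1)" "cj nu (x + 1) = cj mu (x + 1) + 1"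
    using h interlaces_bits[OF i(1), of "x + 1"] interlaces_bits[OF i(2), of "x + 1"] by auto
  show "cj mu x > cj mu (x + 1)"
    using h 1 interlaces_bits[OF i(1), of x] interlaces_bits[OF i(2), of x]
     sig_conj_antimono[of x "x + 1" mu] sig_conj_antimono[of x "x + 1" nu] sig_conj_antimono[of x "x + 1" kap]
    by auto
qed

text \<open>The cell goes into column \<open>x + 1\<close>, just after the rightmost maximum. Adding
  2 to the height from there on lifts that column from one below to one above the old maximum, so it
  is the new leftmost maximum and lowering undoes the step.\<close>

lemma raising_exists:
  assumes i: "kap \<preceq> mu" "mu \<preceq> nu" and t: "last_top (height kap mu nu) x"
  obtains mu1 where "kap \<preceq> mu1" "mu1 \<preceq> nu" "lowering kap mu1 nu mu"
    "\<And>y. cj mu1 y = cj mu y + (if y = x + 1 then 1 else 0)"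
proof -
  let ?h = "height kap mu nu"
  define l where "l = length kap"
  have sg: "kap \<in> sig l" "mu \<in> sig l" "nu \<in> sig l" "length mu = l"
    using i by (auto simp: interlaces_def signatures_iff l_def)
  note b = last_top_bits[OF i t]
  define f where "f y = cj mu y + (if y = x + 1 then 1 else 0)" for y
  have "f (y + 1) \<le> f y" for y
    using b sig_conj_antimono[of y "y + 1" mu] by (auto simp: f_def)
  moreover obtain N where "\<And>y. y \<le> N \<Longrightarrow> cj mu y = int l" using sig_conj_left sg by metis
  then have "f y = int l" if "y \<le> min N x" for y using that by (simp add: f_def)
  moreover obtain M where "\<And>y. y \<ge> M \<Longrightarrow> cj mu y = 0" using sig_conj_right sg by metis
  then have "f y = 0" if "y \<ge> max M (x + 2)" for y using that by (simp add: f_def)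
  ultimately obtain mu1 where m: "mu1 \<in> sig l" "\<And>y. cj mu1 y = f y"
    using sig_conj_surj[of f] by metis
  have "cj mu1 y - cj kap y \<in> {0, 1}" "cj nu y - cj mu1 y \<in> {0, 1}" for y
    using interlaces_bits[OF i(1), of y] interlaces_bits[OF i(2), of y] b(1,2) m(2)[of y] by (auto simp: f_def)
  then have i1: "kap \<preceq> mu1" "mu1 \<preceq> nu" using interlaces_iff m(1) sg by blast+
  have low: "cj mu y = cj mu1 y - (if y = x + 1 then 1 else 0)" for y by (simp add: m(2) f_def)
  have ps: "psum mu y = psum mu1 y - (if y \<ge> x + 1 then 1 else 0)" for y
    by (rule psum_lower[OF low]) (use sg m in \<open>auto simp: sig_iff\<close>)
  then have h: "height kap mu1 nu y = ?h y + (if y \<ge> x + 1 then 2 else 0)" for y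
    by (simp add: height_def)
  have t': "\<forall>y<x. ?h y \<le> ?h x" "\<forall>y>x. ?h y < ?h x"
    using t unfolding last_top_iff by auto
  have hx: "?h (x + 1) = ?h x - 1"
    using height_diff[of kap mu nu "x + 1"] b(1,2) by simp
  have "top_at (height kap mu1 nu) (x + 1)"
    unfolding top_at_def
  proof (intro conjI allI impI)
    fix y assume "y < x + 1"
    then have "?h y \<le> ?h x" using t'(1) by (cases "y = x") auto
    then show "height kap mu1 nu y < height kap mu1 nu (x + 1)" using \<open>y < x + 1\<close> hx h by simp
  next
    fix y assume "x + 1 < y"
    then have "?h y \<le> ?h x - 1" using t'(2) by force
    then show "height kap mu1 nu y \<le> height kap mu1 nu (x + 1)" using \<open>x + 1 < y\<close> hx h by simp
  qed
  then have "lowering kap mu1 nu mu"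
    unfolding lowering_def using low sg m by (auto simp: sig_length)
  then show ?thesis using that[OF i1] m(2) by (simp add: f_def)
qed

text \<open>A lowering in some column leaves the column before it as the rightmost maximum, so the
  place of the lowering can be read off from the result alone.\<close>

lemma lowering_last_top:
  assumes i: "kap \<preceq> mu" "mu \<preceq> nu" and l: "lowering kap mu nu mu1"
  obtains x where "last_top (height kap mu1 nu) x" "\<And>y. cj mu y = cj mu1 y + (if y = x + 1 then 1 else 0)"
proof -
  let ?h1 = "height kap mu1 nu"
  let ?h = "height kap mu nu"
  obtain x where x: "top_at ?h x" "\<And>y. cj mu1 y = cj mu y - (if y = x then 1 else 0)"
    using l unfolding lowering_def by blast
  have "length mu1 = length mu" using l by (simp add: lowering_def sig_iff)
  note ps = psum_lower[OF x(2) this]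
  have h: "?h1 y = ?h y - (if y \<ge> x then 2 else 0)" for y
    using ps[of y] by (simp add: height_def)
  have hx: "?h (x - 1) = ?h x - 1"
    using top_at_bits[OF i x(1)] height_diff[of kap mu nu x] by simp
  have "last_top ?h1 (x - 1)"
    unfolding last_top_iff
  proof (intro conjI allI impI)
    fix y assume "y < x - 1"
    then have "?h y < ?h x" using x(1) by (auto simp: top_at_def)
    then show "?h1 y \<le> ?h1 (x - 1)" using \<open>y < x - 1\<close> h hx by simp
  next
    fix y assume "x - 1 < y"
    then have "?h y \<le> ?h x" using x(1) by (cases "y = x") (auto simp: top_at_def)
    then show "?h1 y < ?h1 (x - 1)" using \<open>x - 1 < y\<close> h hx by simp
  qed
  then show ?thesis using that[of "x - 1"] x(2) by simp
qed

lemma raising_unique: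
  assumes "kap \<preceq> mu" "mu \<preceq> nu" "kap \<preceq> mu'" "mu' \<preceq> nu" "lowering kap mu nu mu1" "lowering kap mu' nu mu1"
  shows "mu = mu'"
proof -
  obtain x where x: "last_top (height kap mu1 nu) x" "\<And>y. cj mu y = cj mu1 y + (if y = x + 1 then 1 else 0)"
    using lowering_last_top assms by blast
  obtain x' where x': "last_top (height kap mu1 nu) x'" "\<And>y. cj mu' y = cj mu1 y + (if y = x' + 1 then 1 else 0)"
    using lowering_last_top assms by blast
  have "x = x'" using top_at_unique x(1) x'(1) by fastforce
  moreover have "mu \<in> sig (length kap)" "mu' \<in> sig (length kap)" using assms interlaces_sig by auto
  ultimately show ?thesis using x x' by (intro sig_conj_inject) auto
qed

lemma raising_iff_string:
  assumes i: "kap \<preceq> mu" "mu \<preceq> nu"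
  shows "(\<exists>mu1. kap \<preceq> mu1 \<and> mu1 \<preceq> nu \<and> lowering kap mu1 nu mu) \<longleftrightarrow> string_phi kap mu nu > excess kap mu nu"
proof
  assume "\<exists>mu1. kap \<preceq> mu1 \<and> mu1 \<preceq> nu \<and> lowering kap mu1 nu mu"
  then obtain mu1 where m: "kap \<preceq> mu1" "mu1 \<preceq> nu" "lowering kap mu1 nu mu" by blast
  show "string_phi kap mu nu > excess kap mu nu"
    using lowering_string_phi[OF m] string_phi_bounds(2)[OF m(1,2)] by simp
next
  assume "string_phi kap mu nu > excess kap mu nu"
  then obtain x where "last_top (height kap mu nu) x" using last_top_exists[OF i] by blast
  then show "\<exists>mu1. kap \<preceq> mu1 \<and> mu1 \<preceq> nu \<and> lowering kap mu1 nu mu" using raising_exists[OF i] by metis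
qed

section \<open>From columns to rows\<close>

lemma top_at_row:
  assumes i: "kap \<preceq> mu" "mu \<preceq> nu" and t: "top_at (height kap mu nu) x"
  obtains j where "j < length mu" "cj mu x = int j + 1" "mu ! j = x"
proof -
  define l where "l = length mu"
  have sg: "kap \<in> sig l" "mu \<in> sig l" "nu \<in> sig l"
    using i by (auto simp: interlaces_def signatures_iff l_def)
  note b = top_at_bits[OF i t]
  define j where "j = nat (cj kap x)"
  have j: "int j = cj kap x" using sig_conj_nonneg[of kap x] by (simp add: j_def)
  have jl: "j < l" using j b(1) sig_conj_le[OF sg(2), of x] by simp
  have "x \<le> mu ! j" using sig_conj_gt_iff[OF sg(2) jl, of x] j b(1) by simp
  moreover have "\<not> x + 1 \<le> mu ! j"
  proof
    assume "x + 1 \<le> mu ! j"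
    then have "int j < cj mu (x + 1)" using sig_conj_gt_iff[OF sg(2) jl, of "x + 1"] by simp
    then show False
      using b j sig_conj_antimono[of x "x + 1" kap] sig_conj_antimono[of x "x + 1" nu] sig_conj_antimono[of x "x + 1" mu]
        interlaces_bits[OF i(1), of "x + 1"] interlaces_bits[OF i(2), of "x + 1"] by auto
  qed
  ultimately show ?thesis using that[of j] jl j b(1) by (simp add: l_def)
qed

lemma last_top_row:
  assumes i: "kap \<preceq> mu" "mu \<preceq> nu" and t: "last_top (height kap mu nu) x"
  obtains j where "j < length mu" "cj mu (x + 1) = int j" "mu ! j = x"
proof -
  define l where "l = length mu"
  have sg: "kap \<in> sig l" "mu \<in> sig l" "nu \<in> sig l"
    using i by (auto simp: interlaces_def signatures_iff l_def)
  note b = last_top_bits[OF i t]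
  define j where "j = nat (cj mu (x + 1))"
  have j: "int j = cj mu (x + 1)" using sig_conj_nonneg[of mu "x + 1"] by (simp add: j_def)
  have jl: "j < l" using j b(2) sig_conj_le[OF sg(3), of "x + 1"] by simp
  have "x \<le> mu ! j" "\<not> x + 1 \<le> mu ! j"
    using sig_conj_gt_iff[OF sg(2) jl] j b(3) by auto
  then show ?thesis using that[of j] jl j by (simp add: l_def)
qed

lemma lower_row:
  assumes m: "mu \<in> sig l" "mu1 \<in> sig l" and j: "j < l" "cj mu x = int j + 1" "mu ! j = x"
    and c: "\<And>y. cj mu1 y = cj mu y - (if y = x then 1 else 0)"
  shows "mu1 = mu[j := mu ! j - 1]"
proof (rule nth_equalityI)
  show "length mu1 = length (mu[j := mu ! j - 1])" using m by (simp add: sig_iff)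
  fix r assume "r < length mu1"
  then have r: "r < l" using m by (simp add: sig_iff)
  have "y \<le> mu1 ! r \<longleftrightarrow> y \<le> (mu[j := mu ! j - 1]) ! r" for y
    using sig_conj_gt_iff[OF m(2) r, of y] sig_conj_gt_iff[OF m(1) r, of y] c[of y] j m r
    by (cases "r = j"; cases "y = x") (auto simp: sig_length)
  then show "mu1 ! r = mu[j := mu ! j - 1] ! r" by (meson order_antisym order_refl)
qed

lemma raise_row:
  assumes m: "mu \<in> sig l" "mu1 \<in> sig l" and j: "j < l" "cj mu (x + 1) = int j" "mu ! j = x"
    and c: "\<And>y. cj mu1 y = cj mu y + (if y = x + 1 then 1 else 0)"
  shows "mu1 = mu[j := mu ! j + 1]"
proof (rule nth_equalityI)
  show "length mu1 = length (mu[j := mu ! j + 1])" using m by (simp add: sig_iff)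
  fix r assume "r < length mu1"
  then have r: "r < l" using m by (simp add: sig_iff)
  have "y \<le> mu1 ! r \<longleftrightarrow> y \<le> (mu[j := mu ! j + 1]) ! r" for y
    using sig_conj_gt_iff[OF m(2) r, of y] sig_conj_gt_iff[OF m(1) r, of y] c[of y] j m r
    by (cases "r = j"; cases "y = x + 1") (auto simp: sig_length)
  then show "mu1 ! r = mu[j := mu ! j + 1] ! r" by (meson order_antisym order_refl)
qed

text \<open>By \<open>top_at_row\<close> the leftmost maximum lies at the end of a row, so comparing
  heights at the parts of \<open>mu\<close> suffices. Rows with larger index end further left, hence
  the strict comparison with them.\<close>

lemma lowering_from_rows:
  assumes i: "kap \<preceq> mu" "mu \<preceq> nu" and j: "j < length mu"
    and pos: "height kap mu nu (mu ! j) > 0"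
    and below: "\<And>r. j < r \<Longrightarrow> r < length mu \<Longrightarrow> height kap mu nu (mu ! r) < height kap mu nu (mu ! j)"
    and above: "\<And>r. r < j \<Longrightarrow> height kap mu nu (mu ! r) \<le> height kap mu nu (mu ! j)"
  shows "lowering kap mu nu (mu[j := mu ! j - 1])"
proof -
  let ?h = "height kap mu nu"
  have sg: "mu \<in> sig (length mu)" using i(1) by (simp add: interlaces_def signatures_iff)
  have "\<not> (\<forall>x. ?h x \<le> 0)" using pos by (auto simp: not_le)
  then obtain x where x: "top_at ?h x" using top_at_exists_iff[OF i] by blast
  obtain j' where j': "j' < length mu" "cj mu x = int j' + 1" "mu ! j' = x" using top_at_row[OF i x] by blast
  have mx: "?h y \<le> ?h x" for y
    using x by (cases y x rule: linorder_cases) (auto simp: top_at_def)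
  have "j' \<le> j" using below[of j'] j' mx[of "mu ! j"] by (cases j j' rule: linorder_cases) auto
  moreover have "j \<le> j'"
  proof (rule ccontr)
    assume "\<not> j \<le> j'"
    then have "?h x \<le> ?h (mu ! j)" using above[of j'] j' by simp
    then have "mu ! j \<ge> x" using x unfolding top_at_def by (metis not_le)
    then show False using \<open>\<not> j \<le> j'\<close> j'(2) sig_conj_gt_iff[OF sg j, of x] by simp
  qed
  ultimately have "j = j'" by simp
  moreover obtain mu1 where m1: "mu1 \<in> sig (length mu)" "\<And>y. cj mu1 y = cj mu y - (if y = x then 1 else 0)"
    using lowering_exists[OF i x] by blast
  ultimately have "mu1 = mu[j := mu ! j - 1]"
    using lower_row[OF sg m1(1) j'] m1(2) by simp
  then show ?thesis using m1 x by (auto simp: lowering_def)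
qed

lemma no_lowering_from_rows:
  assumes i: "kap \<preceq> mu" "mu \<preceq> nu" and "\<And>j. j < length mu \<Longrightarrow> height kap mu nu (mu ! j) \<le> 0"
  shows "\<not> lowering kap mu nu mu1"
proof
  assume "lowering kap mu nu mu1"
  then obtain x where x: "top_at (height kap mu nu) x" unfolding lowering_def by blast
  obtain j where "j < length mu" "mu ! j = x" using top_at_row[OF i x] by blast
  then have "height kap mu nu x \<le> 0" using assms(3) by auto
  then show False
    using x lowering_iff_string_phi[OF i] \<open>lowering kap mu nu mu1\<close> top_at_value[OF i x] by auto
qed

lemma raising_from_rows:
  assumes i: "kap \<preceq> mu" "mu \<preceq> nu" and j: "j < length mu"
    and pos: "height kap mu nu (mu ! j) > excess kap mu nu"
    and above: "\<And>r. r < j \<Longrightarrow> height kap mu nu (mu ! r) < height kap mu nu (mu ! j)"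
    and below: "\<And>r. j < r \<Longrightarrow> r < length mu \<Longrightarrow> height kap mu nu (mu ! r) \<le> height kap mu nu (mu ! j)"
  shows "kap \<preceq> mu[j := mu ! j + 1] \<and> mu[j := mu ! j + 1] \<preceq> nu \<and> lowering kap (mu[j := mu ! j + 1]) nu mu"
proof -
  let ?h = "height kap mu nu"
  have sg: "mu \<in> sig (length mu)" using i(1) by (simp add: interlaces_def signatures_iff)
  have "string_phi kap mu nu > excess kap mu nu" using pos string_phi_bounds(3)[OF i, of "mu ! j"] by simp
  then obtain x where x: "last_top ?h x" using last_top_exists[OF i] by blast
  obtain j' where j': "j' < length mu" "cj mu (x + 1) = int j'" "mu ! j' = x" using last_top_row[OF i x] by blast
  have mx: "?h y \<le> ?h x" for y
    using x unfolding last_top_iff by (cases y x rule: linorder_cases) auto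
  have "j \<le> j'" using above[of j'] j' mx[of "mu ! j"] by (cases j j' rule: linorder_cases) auto
  moreover have "j' \<le> j"
  proof (rule ccontr)
    assume "\<not> j' \<le> j"
    then have "?h x \<le> ?h (mu ! j)" using below[of j'] j' by simp
    then have "mu ! j \<le> x" using x unfolding last_top_iff by (metis not_le)
    then show False using \<open>\<not> j' \<le> j\<close> j'(2) sig_conj_gt_iff[OF sg j, of "x + 1"] by simp
  qed
  ultimately have jj: "j = j'" by simp
  obtain mu1 where m1: "kap \<preceq> mu1" "mu1 \<preceq> nu" "lowering kap mu1 nu mu"
     "\<And>y. cj mu1 y = cj mu y + (if y = x + 1 then 1 else 0)"
    using raising_exists[OF i x] by blast
  have "mu1 \<in> sig (length mu)" using m1(1) i(1) by (simp add: interlaces_def signatures_iff)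
  then have "mu1 = mu[j := mu ! j + 1]"
    using raise_row[OF sg _ j' m1(4)] jj by simp
  then show ?thesis using m1 by auto
qed

lemma no_raising_from_rows:
  assumes i: "kap \<preceq> mu" "mu \<preceq> nu"
    and "\<And>j. j < length mu \<Longrightarrow> height kap mu nu (mu ! j) \<le> excess kap mu nu"
  shows "\<not> (kap \<preceq> mu1 \<and> mu1 \<preceq> nu \<and> lowering kap mu1 nu mu)"
proof
  assume m: "kap \<preceq> mu1 \<and> mu1 \<preceq> nu \<and> lowering kap mu1 nu mu"
  then have gt: "string_phi kap mu nu > excess kap mu nu" using raising_iff_string[OF i] by blast
  then obtain x where x: "last_top (height kap mu nu) x" using last_top_exists[OF i] by blast
  obtain j where "j < length mu" "mu ! j = x" using last_top_row[OF i x] by blast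
  then have le: "height kap mu nu x \<le> excess kap mu nu" using assms(3) by auto
  obtain M where "\<And>y. y \<ge> M \<Longrightarrow> height kap mu nu y = excess kap mu nu"
    using height_right unfolding excess_def by blast
  then have "height kap mu nu (max M (x + 1)) = excess kap mu nu" by simp
  then show False using x le unfolding last_top_iff by (metis less_max_iff_disj not_le zless_add1_eq)
qed

text \<open>By interlacing, the rows below \<open>j\<close> lie entirely within the columns up to
  \<open>mu ! j\<close>, and the three truncated parts of a row above cancel. What remains is the
  number of closing minus opening brackets in the reading word up to the closing brackets of row
  \<open>j\<close>.\<close>

lemma height_at_row:
  assumes i: "kap \<preceq> mu" "mu \<preceq> nu" and j: "j < length mu"
  shows "height kap mu nu (mu ! j) = mu ! j - kap ! j + (\<Sum>r\<in>{j<..<length mu}. 2 * mu ! r - kap ! r - nu ! r)"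
proof -
  define l where "l = length mu"
  have len: "length kap = l" "length nu = l" using i by (auto simp: interlaces_def l_def)
  have sg: "kap \<in> sig l" "mu \<in> sig l" "nu \<in> sig l"
    using i by (auto simp: interlaces_def signatures_iff l_def)
  have km: "kap ! r \<le> mu ! r" "mu ! r \<le> nu ! r" if "r < l" for r
    using that i by (auto simp: interlaces_def l_def)
  have mk: "mu ! r \<le> kap ! q" "nu ! r \<le> mu ! q" if "q < r" "r < l" for q r
  proof -
    have "kap ! (r - 1) \<le> kap ! q" "mu ! (r - 1) \<le> mu ! q" "mu ! r \<le> kap ! (r - 1)" "nu ! r \<le> mu ! (r - 1)"
      using that i sig_nth_antimono[OF sg(1), of q "r - 1"] sig_nth_antimono[OF sg(2), of q "r - 1"]
      by (auto simp: interlaces_def l_def dest!: spec[of _ "r - 1"])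
    then show "mu ! r \<le> kap ! q" "nu ! r \<le> mu ! q" by auto
  qed
  let ?g = "\<lambda>r. 2 * min (mu ! r) (mu ! j) - min (kap ! r) (mu ! j) - min (nu ! r) (mu ! j)"
  have "height kap mu nu (mu ! j) = (\<Sum>r<l. ?g r)"
    unfolding height_def psum_def len l_def[symmetric] by (simp add: sum_subtractf sum_distrib_left)
  also have "\<dots> = (\<Sum>r\<in>{..<l}. if r = j then mu ! j - kap ! j else if j < r then 2 * mu ! r - kap ! r - nu ! r else 0)"
  proof (rule sum.cong)
    fix r assume "r \<in> {..<l}"
    then have r: "r < l" by simp
    consider "r = j" | "j < r" | "r < j" by linarith
    then show "?g r = (if r = j then mu ! j - kap ! j else if j < r then 2 * mu ! r - kap ! r - nu ! r else 0)"
    proof cases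
      case 1 then show ?thesis using km[OF r] by simp
    next
      case 2
      then show ?thesis using mk[OF 2 r] km[OF r] by simp
    next
      case 3
      then show ?thesis using mk[OF 3] km[OF r] j by (simp add: l_def)
    qed
  qed simp
  also have "\<dots> = (mu ! j - kap ! j) + (\<Sum>r\<in>{..<l} - {j}. if j < r then 2 * mu ! r - kap ! r - nu ! r else 0)"
    using j by (subst sum.remove[of _ j]) (auto simp: l_def intro!: sum.cong)
  also have "(\<Sum>r\<in>{..<l} - {j}. if j < r then 2 * mu ! r - kap ! r - nu ! r else 0)
      = (\<Sum>r\<in>{j<..<l}. 2 * mu ! r - kap ! r - nu ! r)"
    by (rule sum.mono_neutral_cong_right) auto
  finally show ?thesis by (simp add: l_def)
qed

text \<open>The same value counted from the other end of the word, as \<open>kashiwara_e_iff\<close>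
  needs for reading backwards.\<close>

lemma height_at_row_excess:
  assumes i: "kap \<preceq> mu" "mu \<preceq> nu" and j: "j < length mu"
  shows "height kap mu nu (mu ! j) = excess kap mu nu + (nu ! j - mu ! j)
    + (\<Sum>r<j. kap ! r + nu ! r - 2 * mu ! r)"
proof -
  define l where "l = length mu"
  have len: "length kap = l" "length nu = l" using i by (auto simp: interlaces_def l_def)
  let ?d = "\<lambda>r. 2 * mu ! r - kap ! r - nu ! r"
  have "excess kap mu nu = (\<Sum>r<l. ?d r)"
    unfolding excess_def sum_list_sum_nth len l_def[symmetric] atLeast0LessThan
    by (simp add: sum_subtractf sum_distrib_left)
  also have "{..<l} = {..<j} \<union> ({j} \<union> {j<..<l})" using j by (auto simp: l_def)
  also have "sum ?d \<dots> = sum ?d {..<j} + (?d j + sum ?d {j<..<l})"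
    by (subst sum.union_disjoint) auto
  finally have "excess kap mu nu = sum ?d {..<j} + (?d j + sum ?d {j<..<l})" .
  moreover have "(\<Sum>r<j. kap ! r + nu ! r - 2 * mu ! r) = - sum ?d {..<j}"
    unfolding sum_negf[symmetric] by (intro sum.cong) auto
  ultimately show ?thesis using height_at_row[OF assms] by (simp add: l_def)
qed

section \<open>Bracketing\<close>

text \<open>One pass with a counter \<open>m\<close> of open brackets finds the closing brackets
  that survive all deletions. Applied to the reversed word with the roles exchanged, it finds the
  surviving opening brackets.\<close>

fun pending :: "('a \<Rightarrow> bool) \<Rightarrow> nat \<Rightarrow> 'a list \<Rightarrow> 'a list" where
  "pending cl m [] = []"
| "pending cl m (x # w) =
     (if cl x then (if m = 0 then x # pending cl 0 w else pending cl (m - 1) w) else pending cl (Suc m) w)"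

lemma pending_cancel:
  "\<not> cl c \<Longrightarrow> cl d \<Longrightarrow> pending cl m (u @ c # d # v) = pending cl m (u @ v)"
  by (induction u arbitrary: m) auto

lemma pending_closers:
  "\<forall>x\<in>set A. cl x \<Longrightarrow> pending cl m (A @ w) = drop m A @ pending cl (m - length A) w"
  by (induction A arbitrary: m) (auto simp: drop_Cons' gr0_conv_Suc)

lemma pending_openers:
  "\<forall>x\<in>set B. \<not> cl x \<Longrightarrow> pending cl m (B @ w) = pending cl (m + length B) w"
  by (induction B arbitrary: m) auto

lemma pending_split:
  assumes "\<forall>x\<in>set A. cl x" "\<forall>x\<in>set B. \<not> cl x"
  shows "pending cl 0 (A @ B) = A"
  using pending_closers[OF assms(1), of 0 B] pending_openers[OF assms(2), of 0 "[]"] by simp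

abbreviation (input) bracket_free :: "('a \<Rightarrow> nat) \<Rightarrow> nat \<Rightarrow> 'a list \<Rightarrow> bool" where
  "bracket_free T i \<equiv> successively (\<lambda>c d. \<not> (T c = Suc i \<and> T d = i))"

lemma delete_pair_cases:
  obtains (delete) u c d v where "w = u @ c # d # v" "T c = Suc i" "T d = i" "delete_pair T i w = u @ v"
  | (free) "delete_pair T i w = w" "bracket_free T i w"
proof -
  have "(\<exists>u c d v. w = u @ c # d # v \<and> T c = Suc i \<and> T d = i \<and> delete_pair T i w = u @ v) \<or>
    (delete_pair T i w = w \<and> bracket_free T i w)"
  proof (induction T i w rule: delete_pair.induct)
    case (1 T i c d w)
    show ?case
    proof (cases "T c = Suc i \<and> T d = i")
      case True
      then have "c # d # w = [] @ c # d # w \<and> T c = Suc i \<and> T d = i \<and> delete_pair T i (c # d # w) = [] @ w" by simp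
      then show ?thesis by blast
    next
      case False
      from 1[OF False] show ?thesis
      proof
        assume "\<exists>u c' d' v. d # w = u @ c' # d' # v \<and> T c' = Suc i \<and> T d' = i \<and> delete_pair T i (d # w) = u @ v"
        then obtain u c' d' v where "d # w = u @ c' # d' # v" "T c' = Suc i" "T d' = i" "delete_pair T i (d # w) = u @ v"
          by blast
        moreover have "delete_pair T i (c # d # w) = c # delete_pair T i (d # w)"
          using False by auto
        ultimately have "c # d # w = (c # u) @ c' # d' # v" "delete_pair T i (c # d # w) = (c # u) @ v"
          by (metis append_Cons)+
        then show ?thesis using \<open>T c' = Suc i\<close> \<open>T d' = i\<close> by blast
      next
        assume "delete_pair T i (d # w) = d # w \<and> bracket_free T i (d # w)"
        then show ?thesis using False by auto
      qed
    qed
  qed auto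
  then show ?thesis using that by blast
qed

text \<open>Deleting a matched pair changes neither one-pass result, and every step on a word that
  is not bracket-free shortens it. So as many steps as letters reach a bracket-free word.\<close>

lemma delete_pair_iterate:
  fixes w T i k
  defines "w' \<equiv> (delete_pair T i ^^ k) w"
  shows "pending (\<lambda>x. T x = i) 0 w' = pending (\<lambda>x. T x = i) 0 w \<and>
    pending (\<lambda>x. T x = Suc i) 0 (rev w') = pending (\<lambda>x. T x = Suc i) 0 (rev w) \<and>
    set w' \<subseteq> set w \<and> (bracket_free T i w' \<or> length w' + k \<le> length w)"
  unfolding w'_def
proof (induction k)
  case (Suc k)
  let ?w = "(delete_pair T i ^^ k) w"
  have eq: "(delete_pair T i ^^ Suc k) w = delete_pair T i ?w" by simp
  show ?case
  proof (cases rule: delete_pair_cases[of ?w T i])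
    case (delete u c d v)
    have p1: "pending (\<lambda>x. T x = i) 0 (u @ v) = pending (\<lambda>x. T x = i) 0 ?w"
      unfolding delete(1) using delete(2,3) by (subst pending_cancel) auto
    have "rev ?w = rev v @ d # c # rev u" unfolding delete(1) by simp
    then have p2: "pending (\<lambda>x. T x = Suc i) 0 (rev (u @ v)) = pending (\<lambda>x. T x = Suc i) 0 (rev ?w)"
      using delete(2,3) pending_cancel[of "\<lambda>x. T x = Suc i" d c 0 "rev v" "rev u"] by simp
    have nf: "\<not> bracket_free T i ?w"
      unfolding delete(1) using delete(2,3) by (simp add: successively_append_iff)
    have "set (u @ v) \<subseteq> set ?w" "length (u @ v) < length ?w" unfolding delete(1) by auto
    then show ?thesis using Suc nf p1 p2 unfolding eq delete(4) by auto
  next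
    case free
    then show ?thesis using Suc unfolding eq by auto
  qed
qed auto

lemma bracket_free_split:
  assumes "bracket_free T i w" "\<forall>x\<in>set w. T x \<in> {i, Suc i}"
  shows "\<exists>A B. w = A @ B \<and> (\<forall>x\<in>set A. T x = i) \<and> (\<forall>x\<in>set B. T x = Suc i)"
  using assms
proof (induction w)
  case (Cons c w)
  then have "bracket_free T i w" by (cases w) auto
  then obtain A B where AB: "w = A @ B" "\<forall>x\<in>set A. T x = i" "\<forall>x\<in>set B. T x = Suc i"
    using Cons by auto
  show ?case
  proof (cases "T c = i")
    case True
    then show ?thesis using AB by (intro exI[of _ "c # A"] exI[of _ B]) auto
  next
    case False
    then have "T c = Suc i" using Cons.prems by simp
    then have "A = []" using Cons.prems(1) AB(1,2) by (cases A) auto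
    then show ?thesis using AB \<open>T c = Suc i\<close> by (intro exI[of _ "[]"] exI[of _ "c # B"]) auto
  qed
qed simp

text \<open>The final word consists of closing brackets \<open>A\<close> followed by opening
  brackets \<open>B\<close>; on it the one-pass results are \<open>A\<close> and the reversal of
  \<open>B\<close>, and by invariance they agree with those of the original word.\<close>

lemma remaining_cells_filter:
  fixes i P
  defines "T \<equiv> cell_label P"
  defines "w \<equiv> filter (\<lambda>c. T c \<in> {i, Suc i}) (reading_cells P)"
  shows "filter (\<lambda>c. T c = i) (remaining_cells i P) = pending (\<lambda>c. T c = i) 0 w"
    "filter (\<lambda>c. T c = Suc i) (remaining_cells i P) = rev (pending (\<lambda>c. T c = Suc i) 0 (rev w))"
proof -
  let ?r = "remaining_cells i P"
  have r: "?r = (delete_pair T i ^^ length w) w" by (simp add: remaining_cells_def w_def T_def Let_def)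
  have it: "pending (\<lambda>x. T x = i) 0 ?r = pending (\<lambda>x. T x = i) 0 w"
    "pending (\<lambda>x. T x = Suc i) 0 (rev ?r) = pending (\<lambda>x. T x = Suc i) 0 (rev w)"
    "set ?r \<subseteq> set w" "bracket_free T i ?r \<or> length ?r + length w \<le> length w"
    unfolding r using delete_pair_iterate[of T i "length w" w] by blast+
  have "bracket_free T i ?r"
    using it(4)
  proof
    assume "length ?r + length w \<le> length w"
    then have "?r = []" by simp
    then show ?thesis by (simp only: successively.simps(1))
  qed
  moreover have "\<forall>x\<in>set ?r. T x \<in> {i, Suc i}"
  proof
    fix x assume "x \<in> set ?r"
    then have "x \<in> set w" using it(3) by blast
    then show "T x \<in> {i, Suc i}" unfolding w_def by simp
  qed
  ultimately obtain A B where AB: "?r = A @ B" "\<forall>x\<in>set A. T x = i" "\<forall>x\<in>set B. T x = Suc i"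
    using bracket_free_split[of T i ?r] by blast
  have "pending (\<lambda>c. T c = i) 0 (A @ B) = A" using AB(2,3) by (intro pending_split) auto
  moreover have "filter (\<lambda>c. T c = i) (A @ B) = A"
    using filter_True[of A "\<lambda>c. T c = i"] filter_False[of B "\<lambda>c. T c = i"] AB(2,3) by simp
  ultimately show "filter (\<lambda>c. T c = i) ?r = pending (\<lambda>c. T c = i) 0 w"
    unfolding AB(1)[symmetric] using it(1) by simp
  have "pending (\<lambda>c. T c = Suc i) 0 (rev B @ rev A) = rev B" using AB(2,3) by (intro pending_split) auto
  moreover have "filter (\<lambda>c. T c = Suc i) (A @ B) = B"
    using filter_True[of B "\<lambda>c. T c = Suc i"] filter_False[of A "\<lambda>c. T c = Suc i"] AB(2,3) by simp
  ultimately show "filter (\<lambda>c. T c = Suc i) ?r = rev (pending (\<lambda>c. T c = Suc i) 0 (rev w))"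
    unfolding AB(1)[symmetric] rev_append[symmetric] using it(2) by simp
qed

text \<open>The row containing the last pending letter, for rows \<open>j\<close> consisting of \<open>p j\<close> closing and then
  \<open>q j\<close> opening brackets.\<close>

fun last_row :: "('j \<Rightarrow> nat) \<Rightarrow> ('j \<Rightarrow> nat) \<Rightarrow> nat \<Rightarrow> 'j list \<Rightarrow> 'j option" where
  "last_row p q m [] = None"
| "last_row p q m (j # js) = (case last_row p q (m - p j + q j) js of
     Some r \<Rightarrow> Some r | None \<Rightarrow> if p j > m then Some j else None)"

lemma pending_rows:
  assumes "\<forall>j\<in>set js. (\<forall>x\<in>set (A j). cl x) \<and> (\<forall>x\<in>set (B j). \<not> cl x)"
  shows "(case last_row (\<lambda>j. length (A j)) (\<lambda>j. length (B j)) m js of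
      None \<Rightarrow> pending cl m (concat (map (\<lambda>j. A j @ B j) js)) = []
    | Some r \<Rightarrow> r \<in> set js \<and> A r \<noteq> [] \<and> pending cl m (concat (map (\<lambda>j. A j @ B j) js)) \<noteq> [] \<and>
        last (pending cl m (concat (map (\<lambda>j. A j @ B j) js))) = last (A r))"
  using assms
proof (induction js arbitrary: m)
  case (Cons j js)
  let ?m = "m - length (A j) + length (B j)"
  have eq: "pending cl m (concat (map (\<lambda>j. A j @ B j) (j # js))) =
      drop m (A j) @ pending cl ?m (concat (map (\<lambda>j. A j @ B j) js))"
    using Cons.prems by (simp add: pending_closers pending_openers)
  show ?case
    using Cons.IH[of ?m] Cons.prems unfolding eq by (fastforce split: option.splits simp: last_drop)
qed simp

text \<open>With \<open>t\<close> the height before the first row, \<open>t + int m\<close> is the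
  running maximum: a row leaves a pending bracket exactly when its height exceeds it. The last such
  row is therefore the first one of maximal height.\<close>

lemma last_row_heights:
  fixes H :: "'j \<Rightarrow> int"
  assumes "js \<noteq> [] \<Longrightarrow> H (js ! 0) = t + int (p (js ! 0))"
    and "\<And>k. Suc k < length js \<Longrightarrow> H (js ! Suc k) = H (js ! k) - int (q (js ! k)) + int (p (js ! Suc k))"
  shows "(case last_row p q m js of
      None \<Rightarrow> \<forall>k<length js. H (js ! k) \<le> t + int m
    | Some r \<Rightarrow> \<exists>k<length js. js ! k = r \<and> H r > t + int m \<and> (\<forall>k'<k. H (js ! k') < H r) \<and>
        (\<forall>k'. k < k' \<and> k' < length js \<longrightarrow> H (js ! k') \<le> H r))"
  using assms
proof (induction js arbitrary: m t)
  case (Cons j js)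
  let ?m = "m - p j + q j"
  let ?t = "t + int (p j) - int (q j)"
  have Hj: "H j = t + int (p j)" using Cons.prems(1) by simp
  have mx: "?t + int ?m = t + max (int m) (int (p j))" by auto
  have "H (js ! 0) = ?t + int (p (js ! 0))" if "js \<noteq> []"
    using Cons.prems(2)[of 0] that Hj by simp
  moreover have "H (js ! Suc k) = H (js ! k) - int (q (js ! k)) + int (p (js ! Suc k))" if "Suc k < length js" for k
    using Cons.prems(2)[of "Suc k"] that by simp
  ultimately have IH: "case last_row p q ?m js of
      None \<Rightarrow> \<forall>k<length js. H (js ! k) \<le> ?t + int ?m
    | Some r \<Rightarrow> \<exists>k<length js. js ! k = r \<and> H r > ?t + int ?m \<and> (\<forall>k'<k. H (js ! k') < H r) \<and>
        (\<forall>k'. k < k' \<and> k' < length js \<longrightarrow> H (js ! k') \<le> H r)"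
    by (rule Cons.IH)
  show ?case
  proof (cases "last_row p q ?m js")
    case None
    then have le: "\<forall>k<length js. H (js ! k) \<le> t + max (int m) (int (p j))" using IH mx by simp
    show ?thesis
    proof (cases "p j > m")
      case True
      have "\<forall>k'. 0 < k' \<and> k' < length (j # js) \<longrightarrow> H ((j # js) ! k') \<le> H j"
        using le True Hj by (auto simp: nth_Cons split: nat.splits)
      then show ?thesis using None True Hj by (auto intro!: exI[of _ 0])
    next
      case False
      then show ?thesis using None le Hj by (auto simp: nth_Cons split: nat.splits)
    qed
  next
    case (Some r)
    then obtain k where k: "k < length js" "js ! k = r" "H r > t + max (int m) (int (p j))"
      "\<forall>k'<k. H (js ! k') < H r" "\<forall>k'. k < k' \<and> k' < length js \<longrightarrow> H (js ! k') \<le> H r"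
      using IH mx by auto
    have "\<forall>k'<Suc k. H ((j # js) ! k') < H r" using k Hj by (auto simp: nth_Cons split: nat.splits)
    moreover have "\<forall>k'. Suc k < k' \<and> k' < length (j # js) \<longrightarrow> H ((j # js) ! k') \<le> H r"
      using k(5) by (auto simp: nth_Cons split: nat.splits)
    ultimately show ?thesis using Some k(1,2,3) by (auto intro!: exI[of _ "Suc k"])
  qed
qed simp

section \<open>Cells and labels\<close>

lemma chain_row_mono:
  assumes "chain n P" "j < length (P ! 0)" "a \<le> b" "b \<le> n"
  shows "P ! a ! j \<le> P ! b ! j"
  using assms(3,4)
proof (induction b rule: dec_induct)
  case (step b)
  have "P ! b ! j \<le> P ! Suc b ! j"
    using chain_interlaces[OF assms(1), of b] chain_length[OF assms(1), of b] assms(2) step by (simp add: interlaces_def)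
  then show ?case using step by simp
qed simp

lemma chain_hd_last: "chain n P \<Longrightarrow> hd P = P ! 0" "chain n P \<Longrightarrow> last P = P ! n"
  unfolding chain_def by (metis hd_conv_nth length_0_conv nat.distinct(1), metis diff_Suc_1 last_conv_nth length_0_conv nat.distinct(1))

text \<open>Rows of a chain increase, so the label is the least \<open>i\<close> with
  \<open>k \<le> P ! i ! j\<close>. The cells with label at most \<open>a\<close> thus recover the
  signature \<open>P ! a\<close>.\<close>

lemma cell_label_le_iff:
  assumes P: "chain n P" and j: "j < length (P ! 0)" and k: "P ! 0 ! j < k" "k \<le> P ! n ! j" and a: "a \<le> n"
  shows "cell_label P (j, k) \<le> a \<longleftrightarrow> k \<le> P ! a ! j"
proof -
  define i where "i = (LEAST i. k \<le> P ! i ! j)"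
  have ki: "k \<le> P ! i ! j" unfolding i_def by (rule LeastI) (rule k(2))
  have i_le: "i \<le> b" if "k \<le> P ! b ! j" for b unfolding i_def using that by (rule Least_le)
  have i0: "i \<noteq> 0" using ki k(1) by (cases i) auto
  have "\<not> k \<le> P ! (i - 1) ! j" using i_le[of "i - 1"] i0 by auto
  then have lab: "1 \<le> i \<and> i < length P \<and> P ! (i - 1) ! j < k \<and> k \<le> P ! i ! j"
    using i0 i_le[OF k(2)] ki P by (auto simp: chain_def)
  have "cell_label P (j, k) = i"
    unfolding cell_label_def fst_conv snd_conv
  proof (rule the_equality)
    fix i' assume i': "1 \<le> i' \<and> i' < length P \<and> P ! (i' - 1) ! j < k \<and> k \<le> P ! i' ! j"
    have "\<not> i \<le> i' - 1"
    proof
      assume "i \<le> i' - 1"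
      then have "P ! i ! j \<le> P ! (i' - 1) ! j"
        using chain_row_mono[OF P j, of i "i' - 1"] i' P by (auto simp: chain_def)
      then show False using i' ki by simp
    qed
    then show "i' = i" using i_le[of i'] i' by simp
  qed (rule lab)
  moreover have "i \<le> a \<longleftrightarrow> k \<le> P ! a ! j"
    using i_le[of a] chain_row_mono[OF P j, of i a] ki a by fastforce
  ultimately show ?thesis by simp
qed

lemma cell_label_eq_iff:
  assumes P: "chain n P" and j: "j < length (P ! 0)" and k: "P ! 0 ! j < k" "k \<le> P ! n ! j" and a: "1 \<le> a" "a \<le> n"
  shows "cell_label P (j, k) = a \<longleftrightarrow> P ! (a - 1) ! j < k \<and> k \<le> P ! a ! j"
proof -
  have "cell_label P (j, k) = a \<longleftrightarrow> cell_label P (j, k) \<le> a \<and> \<not> cell_label P (j, k) \<le> a - 1"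
    using a by auto
  then show ?thesis
    using cell_label_le_iff[OF P j k, of a] cell_label_le_iff[OF P j k, of "a - 1"] a by auto
qed

lemma filter_upto:
  assumes "r \<le> a" "b \<le> s"
  shows "filter (\<lambda>k. a < k \<and> k \<le> b) [r + 1..s] = [a + 1..b]"
proof (rule sorted_distinct_set_unique)
  show "sorted (filter (\<lambda>k. a < k \<and> k \<le> b) [r + 1..s])" by (rule sorted_filter[of "\<lambda>x. x", simplified]) simp
qed (use assms in auto)

lemma set_reading_cells:
  assumes "chain n P"
  shows "set (reading_cells P) = {(j, k). j < length (P ! 0) \<and> P ! 0 ! j < k \<and> k \<le> P ! n ! j}"
  unfolding reading_cells_def chain_hd_last[OF assms] by auto

lemma label_count_chain:
  assumes P: "chain n P" and a: "1 \<le> a" "a \<le> n"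
  shows "label_count P a = sum_list (P ! a) - sum_list (P ! (a - 1))"
proof -
  define l where "l = length (P ! 0)"
  have "{c \<in> set (reading_cells P). cell_label P c = a} = (SIGMA j:{..<l}. {P ! (a - 1) ! j<..P ! a ! j})"
  proof (intro equalityI subsetI)
    fix c assume c: "c \<in> {c \<in> set (reading_cells P). cell_label P c = a}"
    obtain j k where jk: "c = (j, k)" by fastforce
    with c have "j < l" "P ! 0 ! j < k" "k \<le> P ! n ! j" by (auto simp: set_reading_cells[OF P] l_def)
    then show "c \<in> (SIGMA j:{..<l}. {P ! (a - 1) ! j<..P ! a ! j})"
      using c jk cell_label_eq_iff[OF P _ _ _ a, of j k] by (auto simp: l_def)
  next
    fix c assume "c \<in> (SIGMA j:{..<l}. {P ! (a - 1) ! j<..P ! a ! j})"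
    then obtain j k where c: "c = (j, k)" "j < l" "P ! (a - 1) ! j < k" "k \<le> P ! a ! j" by auto
    then have "P ! 0 ! j < k" "k \<le> P ! n ! j"
      using chain_row_mono[OF P, of j 0 "a - 1"] chain_row_mono[OF P, of j a n] a
      by (auto simp: l_def le_diff_conv)
    then show "c \<in> {c \<in> set (reading_cells P). cell_label P c = a}"
      using c cell_label_eq_iff[OF P _ _ _ a, of j k] by (auto simp: set_reading_cells[OF P] l_def)
  qed
  then have "label_count P a = int (\<Sum>j<l. card {P ! (a - 1) ! j<..P ! a ! j})"
    by (simp add: label_count_def)
  also have "\<dots> = (\<Sum>j<l. P ! a ! j - P ! (a - 1) ! j)"
    using chain_row_mono[OF P, of _ "a - 1" a] a by (auto simp: l_def intro!: sum.cong)
  also have "\<dots> = sum_list (P ! a) - sum_list (P ! (a - 1))"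
    using chain_length[OF P, of a] chain_length[OF P, of "a - 1"] a
    by (simp add: sum_list_sum_nth sum_subtractf l_def atLeast0LessThan)
  finally show ?thesis .
qed

lemma refill_eq:
  assumes P: "chain n P"
    and P': "length P' = Suc n" "\<And>a. a \<le> n \<Longrightarrow> length (P' ! a) = length (P ! 0)"
    and T: "\<And>a j k. a \<le> n \<Longrightarrow> j < length (P ! 0) \<Longrightarrow> P ! 0 ! j < k \<Longrightarrow> k \<le> P ! n ! j \<Longrightarrow>
        T (j, k) \<le> a \<longleftrightarrow> k \<le> P' ! a ! j"
    and b: "\<And>a j. a \<le> n \<Longrightarrow> j < length (P ! 0) \<Longrightarrow> P ! 0 ! j \<le> P' ! a ! j \<and> P' ! a ! j \<le> P ! n ! j"
  shows "refill P T = P'"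
proof (rule nth_equalityI)
  have len: "length P = Suc n" using P by (simp add: chain_def)
  show "length (refill P T) = length P'" using len P' by (simp add: refill_def)
  fix a assume "a < length (refill P T)"
  then have a: "a \<le> n" using len by (simp add: refill_def)
  show "refill P T ! a = P' ! a"
  proof (rule nth_equalityI)
    show "length (refill P T ! a) = length (P' ! a)"
      using a len P'(2)[OF a] by (simp add: refill_def chain_hd_last[OF P] del: upt_Suc)
    fix j assume "j < length (refill P T ! a)"
    then have j: "j < length (P ! 0)" using a len by (simp add: refill_def chain_hd_last[OF P] del: upt_Suc)
    have "{k. P ! 0 ! j < k \<and> k \<le> P ! n ! j \<and> T (j, k) \<le> a} = {P ! 0 ! j<..P' ! a ! j}"
      using T[OF a j] b[OF a j] by auto
    then show "refill P T ! a ! j = P' ! a ! j"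
      using a j len b[OF a j] by (simp add: refill_def chain_hd_last[OF P] del: upt_Suc)
  qed
qed

text \<open>Exchanging the labels \<open>i\<close> and \<open>i + 1\<close> in a cell affects, among
  the sets of cells with label at most \<open>a\<close>, only the one with
  \<open>a = i\<close>.\<close>

lemma refill_update:
  assumes P: "chain n P" and i: "i < n" and j0: "j0 < length (P ! 0)"
    and k0: "P ! 0 ! j0 < k0" "k0 \<le> P ! n ! j0" and lab: "cell_label P (j0, k0) \<in> {i, Suc i}" "v \<in> {i, Suc i}"
    and m: "P ! 0 ! j0 \<le> m" "m \<le> P ! n ! j0" "\<And>k. k \<le> m \<longleftrightarrow> (if k = k0 then v = i else k \<le> P ! i ! j0)"
  shows "refill P ((cell_label P)((j0, k0) := v)) = P[i := (P ! i)[j0 := m]]"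
proof (rule refill_eq[OF P])
  have len: "length P = Suc n" using P by (simp add: chain_def)
  note cl = chain_length[OF P]
  show "length (P[i := (P ! i)[j0 := m]]) = Suc n" using len by simp
  show "length (P[i := (P ! i)[j0 := m]] ! a) = length (P ! 0)" if "a \<le> n" for a
    using cl[OF that] that len by (cases "a = i") auto
  fix a j
  assume a: "a \<le> n" and j: "j < length (P ! 0)"
  show "P ! 0 ! j \<le> P[i := (P ! i)[j0 := m]] ! a ! j \<and> P[i := (P ! i)[j0 := m]] ! a ! j \<le> P ! n ! j"
    using chain_row_mono[OF P j le0 a] chain_row_mono[OF P j a] m(1,2) a j len cl[OF a]
    by (cases "a = i"; cases "j = j0") auto
  fix k assume k: "P ! 0 ! j < k" "k \<le> P ! n ! j"
  note le = cell_label_le_iff[OF P j k a]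
  show "((cell_label P)((j0, k0) := v)) (j, k) \<le> a \<longleftrightarrow> k \<le> P[i := (P ! i)[j0 := m]] ! a ! j"
  proof (cases "a = i \<and> j = j0")
    case True
    then show ?thesis using le lab(2) m(3)[of k] a len cl[OF a] j by auto
  next
    case False
    then have "P[i := (P ! i)[j0 := m]] ! a ! j = P ! a ! j"
      using a len cl[OF a] j by (cases "a = i") auto
    then show ?thesis using le lab False by (cases "(j, k) = (j0, k0)") auto
  qed
qed

lemma refill_lower:
  assumes P: "chain n P" and i: "1 \<le> i" "i < n" and j0: "j0 < length (P ! 0)" and lt: "P ! (i - 1) ! j0 < P ! i ! j0"
  shows "refill P ((cell_label P)((j0, P ! i ! j0) := Suc i)) = P[i := (P ! i)[j0 := P ! i ! j0 - 1]]"
proof -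
  have c: "P ! 0 ! j0 < P ! i ! j0" "P ! i ! j0 \<le> P ! n ! j0"
    using chain_row_mono[OF P j0 le0, of "i - 1"] chain_row_mono[OF P j0, of i n] lt i by (auto simp: le_diff_conv)
  have "cell_label P (j0, P ! i ! j0) = i" using cell_label_eq_iff[OF P j0 c] lt i by auto
  then show ?thesis using c by (intro refill_update[OF P i(2) j0 c]) auto
qed

lemma refill_raise:
  assumes P: "chain n P" and i: "1 \<le> i" "i < n" and j0: "j0 < length (P ! 0)" and lt: "P ! i ! j0 < P ! Suc i ! j0"
  shows "refill P ((cell_label P)((j0, P ! i ! j0 + 1) := i)) = P[i := (P ! i)[j0 := P ! i ! j0 + 1]]"
proof -
  have c: "P ! 0 ! j0 < P ! i ! j0 + 1" "P ! i ! j0 + 1 \<le> P ! n ! j0"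
    using chain_row_mono[OF P j0, of 0 i] chain_row_mono[OF P j0, of "Suc i" n] lt i by auto
  have "cell_label P (j0, P ! i ! j0 + 1) = Suc i" using cell_label_eq_iff[OF P j0 c, of "Suc i"] lt i by auto
  then show ?thesis using c by (intro refill_update[OF P i(2) j0 c]) auto
qed

section \<open>The bracket word of a chain and the Kashiwara operators in column form\<close>

lemma bracket_word:
  assumes P: "chain n P" and i: "1 \<le> i" "i < n"
  shows "filter (\<lambda>c. cell_label P c \<in> {i, Suc i}) (reading_cells P) =
    concat (map (\<lambda>j. map (Pair j) [P ! (i - 1) ! j + 1..P ! i ! j] @ map (Pair j) [P ! i ! j + 1..P ! Suc i ! j])
      (rev [0..<length (P ! 0)]))"
proof -
  have row: "filter (\<lambda>c. cell_label P c \<in> {i, Suc i}) (map (Pair j) [P ! 0 ! j + 1..P ! n ! j]) =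
      map (Pair j) [P ! (i - 1) ! j + 1..P ! i ! j] @ map (Pair j) [P ! i ! j + 1..P ! Suc i ! j]"
    if j: "j < length (P ! 0)" for j
  proof -
    have m: "P ! 0 ! j \<le> P ! (i - 1) ! j" "P ! (i - 1) ! j \<le> P ! i ! j" "P ! i ! j \<le> P ! Suc i ! j"
        "P ! Suc i ! j \<le> P ! n ! j"
      using chain_row_mono[OF P j] i by auto
    have "filter (\<lambda>k. cell_label P (j, k) \<in> {i, Suc i}) [P ! 0 ! j + 1..P ! n ! j] =
        filter (\<lambda>k. P ! (i - 1) ! j < k \<and> k \<le> P ! Suc i ! j) [P ! 0 ! j + 1..P ! n ! j]"
    proof (rule filter_cong)
      fix k assume "k \<in> set [P ! 0 ! j + 1..P ! n ! j]"
      then have k: "P ! 0 ! j < k" "k \<le> P ! n ! j" by auto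
      show "cell_label P (j, k) \<in> {i, Suc i} \<longleftrightarrow> P ! (i - 1) ! j < k \<and> k \<le> P ! Suc i ! j"
        using cell_label_eq_iff[OF P j k, of i] cell_label_eq_iff[OF P j k, of "Suc i"] i m by auto
    qed simp
    also have "\<dots> = [P ! (i - 1) ! j + 1..P ! Suc i ! j]" by (rule filter_upto) (use m in auto)
    also have "\<dots> = [P ! (i - 1) ! j + 1..P ! i ! j] @ [P ! i ! j + 1..P ! Suc i ! j]"
      using upto_split1[of "P ! (i - 1) ! j + 1" "P ! i ! j + 1" "P ! Suc i ! j"] m
      by (cases "P ! i ! j = P ! Suc i ! j") auto
    finally show ?thesis by (simp add: filter_map comp_def)
  qed
  then show ?thesis
    unfolding reading_cells_def chain_hd_last[OF P] filter_concat map_map comp_def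
    by (intro arg_cong[of _ _ concat] map_cong) auto
qed

context
  fixes n i P kap mu nu
  assumes P: "chain n P" and i: "1 \<le> i" "i < n"
  defines "kap \<equiv> P ! (i - 1)" and "mu \<equiv> P ! i" and "nu \<equiv> P ! Suc i"
begin

lemma local_interlaces: "kap \<preceq> mu" "mu \<preceq> nu" "length mu = length (P ! 0)"
  using chain_interlaces[OF P, of "i - 1"] chain_interlaces[OF P, of i] chain_length[OF P, of i] i
  by (auto simp: kap_def mu_def nu_def)

lemma label_blocks:
  assumes "j < length mu"
  shows "\<forall>x\<in>set (map (Pair j) [kap ! j + 1..mu ! j]). cell_label P x = i"
    "\<forall>x\<in>set (map (Pair j) [mu ! j + 1..nu ! j]). cell_label P x = Suc i"
proof -
  have j: "j < length (P ! 0)" using assms local_interlaces(3) by simp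
  have m: "P ! 0 ! j \<le> kap ! j" "kap ! j \<le> mu ! j" "mu ! j \<le> nu ! j" "nu ! j \<le> P ! n ! j"
    using chain_row_mono[OF P j] i by (auto simp: kap_def mu_def nu_def)
  have "cell_label P (j, k) = i" if "kap ! j < k" "k \<le> mu ! j" for k
    using cell_label_eq_iff[OF P j, of k i] i m that by (simp add: kap_def mu_def)
  then show "\<forall>x\<in>set (map (Pair j) [kap ! j + 1..mu ! j]). cell_label P x = i" by auto
  have "cell_label P (j, k) = Suc i" if "mu ! j < k" "k \<le> nu ! j" for k
    using cell_label_eq_iff[OF P j, of k "Suc i"] i m that by (simp add: nu_def mu_def)
  then show "\<forall>x\<in>set (map (Pair j) [mu ! j + 1..nu ! j]). cell_label P x = Suc i" by auto
qed

lemma row_le: "j < length mu \<Longrightarrow> kap ! j \<le> mu ! j" "j < length mu \<Longrightarrow> mu ! j \<le> nu ! j"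
  using local_interlaces by (auto simp: interlaces_def)

text \<open>Each row contributes its labels \<open>i\<close> followed by its labels
  \<open>i + 1\<close>, so the rightmost surviving closing bracket is the last \<open>i\<close> of
  the row chosen by \<open>last_row\<close>. The heights at the row ends identify that row as the
  one containing the leftmost maximum.\<close>

lemma kashiwara_f_iff:
  "kashiwara_f i P = Some P' \<longleftrightarrow> (\<exists>mu1. lowering kap mu nu mu1 \<and> P' = P[i := mu1])"
proof -
  let ?h = "height kap mu nu"
  define l where "l = length mu"
  define A where "A j = map (Pair j) [kap ! j + 1..mu ! j]" for j
  define B where "B j = map (Pair j) [mu ! j + 1..nu ! j]" for j
  define js where "js = rev [0..<l]"
  define w where "w = filter (\<lambda>c. cell_label P c = i) (remaining_cells i P)"
  have w: "w = pending (\<lambda>c. cell_label P c = i) 0 (concat (map (\<lambda>j. A j @ B j) js))"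
    unfolding w_def remaining_cells_filter(1) bracket_word[OF P i]
    by (simp add: A_def B_def js_def l_def local_interlaces(3)[unfolded mu_def] kap_def mu_def nu_def)
  have blocks: "\<forall>j\<in>set js. (\<forall>x\<in>set (A j). cell_label P x = i) \<and> (\<forall>x\<in>set (B j). \<not> cell_label P x = i)"
  proof
    fix j assume "j \<in> set js"
    then have "j < length mu" by (simp add: js_def l_def)
    from label_blocks[OF this] show "(\<forall>x\<in>set (A j). cell_label P x = i) \<and> (\<forall>x\<in>set (B j). \<not> cell_label P x = i)"
      by (auto simp: A_def B_def)
  qed
  define H where "H j = ?h (mu ! j)" for j
  have js_nth: "js ! k = l - 1 - k" if "k < l" for k using that by (simp add: js_def rev_nth)
  have lA: "int (length (A j)) = mu ! j - kap ! j" "int (length (B j)) = nu ! j - mu ! j" if "j < l" for j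
    using row_le that by (auto simp: A_def B_def l_def)
  have H: "H j = mu ! j - kap ! j + (\<Sum>r\<in>{j<..<l}. 2 * mu ! r - kap ! r - nu ! r)" if "j < l" for j
    unfolding H_def using height_at_row[OF local_interlaces(1,2)] that by (simp add: l_def)
  have hts: "(case last_row (\<lambda>j. length (A j)) (\<lambda>j. length (B j)) 0 js of
      None \<Rightarrow> \<forall>k<length js. H (js ! k) \<le> 0 + int 0
    | Some r \<Rightarrow> \<exists>k<length js. js ! k = r \<and> H r > 0 + int 0 \<and> (\<forall>k'<k. H (js ! k') < H r) \<and>
        (\<forall>k'. k < k' \<and> k' < length js \<longrightarrow> H (js ! k') \<le> H r))"
  proof (rule last_row_heights)
    show "H (js ! 0) = 0 + int (length (A (js ! 0)))" if "js \<noteq> []"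
    proof -
      have "0 < l" using that by (simp add: js_def)
      then have "{l - 1<..<l} = {}" by auto
      then show ?thesis using H[of "l - 1"] lA[of "l - 1"] js_nth[of 0] \<open>0 < l\<close> by simp
    qed
    show "H (js ! Suc k) = H (js ! k) - int (length (B (js ! k))) + int (length (A (js ! Suc k)))"
      if "Suc k < length js" for k
    proof -
      define j where "j = js ! Suc k"
      have kl: "Suc k < l" using that by (simp add: js_def)
      then have j: "js ! k = Suc j" "Suc j < l" using js_nth[of k] js_nth[of "Suc k"] by (auto simp: j_def)
      have "{j<..<l} = insert (Suc j) {Suc j<..<l}" using j(2) by auto
      then show ?thesis
        using H[of j] H[of "Suc j"] lA[of j] lA[of "Suc j"] j unfolding j_def[symmetric] by simp
    qed
  qed
  note pr = pending_rows[OF blocks, of 0, folded w]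
  have kf: "kashiwara_f i P = (if w = [] then None else Some (refill P ((cell_label P)(last w := Suc i))))"
    by (simp add: kashiwara_f_def w_def Let_def)
  show ?thesis
  proof (cases "last_row (\<lambda>j. length (A j)) (\<lambda>j. length (B j)) 0 js")
    case None
    have "H j \<le> 0" if "j < l" for j
    proof -
      have "\<forall>k<length js. H (js ! k) \<le> 0" using hts None by simp
      moreover have "l - 1 - j < length js" "js ! (l - 1 - j) = j"
        using js_nth[of "l - 1 - j"] that by (simp_all add: js_def)
      ultimately show ?thesis by metis
    qed
    then have "\<not> lowering kap mu nu mu1" for mu1
      using no_lowering_from_rows[OF local_interlaces(1,2)] by (simp add: H_def l_def)
    moreover have "w = []" using pr None by simp
    ultimately show ?thesis using kf by simp
  next
    case (Some r)
    then have r: "r \<in> set js" "A r \<noteq> []" "w \<noteq> []" "last w = last (A r)" using pr by auto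
    obtain k where k: "k < length js" "js ! k = r" "H r > 0" "\<forall>k'<k. H (js ! k') < H r"
      "\<forall>k'. k < k' \<and> k' < length js \<longrightarrow> H (js ! k') \<le> H r"
      using hts Some by auto
    have rl: "r < l" and kr: "r = l - 1 - k" "k < l" using r(1) k(1,2) js_nth[of k] by (auto simp: js_def)
    have low: "lowering kap mu nu (mu[r := mu ! r - 1])"
    proof (rule lowering_from_rows[OF local_interlaces(1,2)])
      show "?h (mu ! s) < ?h (mu ! r)" if "r < s" "s < length mu" for s
      proof -
        have "l - 1 - s < l" "l - 1 - (l - 1 - s) = s" and s: "l - 1 - s < k"
          using that kr unfolding l_def[symmetric] by arith+
        then have "js ! (l - 1 - s) = s" using js_nth[of "l - 1 - s"] by simp
        with s show ?thesis using k(4)[rule_format, of "l - 1 - s"] by (simp add: H_def)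
      qed
      show "?h (mu ! s) \<le> ?h (mu ! r)" if "s < r" for s
      proof -
        have "l - 1 - s < l" "l - 1 - (l - 1 - s) = s" "k < l - 1 - s" using that kr by arith+
        then have s: "k < l - 1 - s" "l - 1 - s < length js" "js ! (l - 1 - s) = s"
          using js_nth[of "l - 1 - s"] by (simp_all add: js_def)
        then show ?thesis using k(5)[rule_format, of "l - 1 - s"] by (simp add: H_def)
      qed
    qed (use rl k(3) in \<open>auto simp: l_def H_def\<close>)
    have lt: "kap ! r < mu ! r" using r(2) by (simp add: A_def)
    then have "last (A r) = (r, mu ! r)" by (simp add: A_def last_map upto_rec2)
    then have "kashiwara_f i P = Some (P[i := mu[r := mu ! r - 1]])"
      using kf r refill_lower[OF P i, of r] lt rl local_interlaces(3)[unfolded mu_def] by (simp add: l_def kap_def mu_def)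
    moreover have "lowering kap mu nu m \<longleftrightarrow> m = mu[r := mu ! r - 1]" for m
      using low lowering_unique[OF low, of m] by blast
    ultimately show ?thesis by (simp only: option.inject) blast
  qed
qed

text \<open>The argument for \<open>f\<close> applied to the reversed word: rows run from top to
  bottom, the labels \<open>i + 1\<close> play the closing brackets, and heights are measured from
  \<open>excess\<close>.\<close>

lemma kashiwara_e_iff:
  "kashiwara_e i P = Some P' \<longleftrightarrow>
    (\<exists>mu1. kap \<preceq> mu1 \<and> mu1 \<preceq> nu \<and> lowering kap mu1 nu mu \<and> P' = P[i := mu1])"
proof -
  define l where "l = length mu"
  define A where "A j = rev (map (Pair j) [mu ! j + 1..nu ! j])" for j
  define B where "B j = rev (map (Pair j) [kap ! j + 1..mu ! j])" for j
  define js where "js = [0..<l]"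
  define w where "w = pending (\<lambda>c. cell_label P c = Suc i) 0 (concat (map (\<lambda>j. A j @ B j) js))"
  have "rev (concat (map (\<lambda>j. map (Pair j) [kap ! j + 1..mu ! j] @ map (Pair j) [mu ! j + 1..nu ! j]) (rev [0..<l])))
      = concat (map (\<lambda>j. A j @ B j) js)"
    by (simp add: A_def B_def js_def rev_concat rev_map[symmetric] comp_def)
  then have w: "filter (\<lambda>c. cell_label P c = Suc i) (remaining_cells i P) = rev w"
    unfolding w_def remaining_cells_filter(2) bracket_word[OF P i]
    by (simp add: l_def local_interlaces(3)[unfolded mu_def] kap_def mu_def nu_def)
  have blocks: "\<forall>j\<in>set js. (\<forall>x\<in>set (A j). cell_label P x = Suc i) \<and> (\<forall>x\<in>set (B j). \<not> cell_label P x = Suc i)"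
  proof
    fix j assume "j \<in> set js"
    then have "j < length mu" by (simp add: js_def l_def)
    from label_blocks[OF this] show "(\<forall>x\<in>set (A j). cell_label P x = Suc i) \<and> (\<forall>x\<in>set (B j). \<not> cell_label P x = Suc i)"
      by (auto simp: A_def B_def)
  qed
  define H where "H j = height kap mu nu (mu ! j)" for j
  have js_nth: "js ! k = k" if "k < l" for k using that by (simp add: js_def)
  have lA: "int (length (B j)) = mu ! j - kap ! j" "int (length (A j)) = nu ! j - mu ! j" if "j < l" for j
    using row_le that by (auto simp: A_def B_def l_def)
  let ?x = "excess kap mu nu"
  have H: "H j = ?x + (nu ! j - mu ! j) + (\<Sum>r<j. kap ! r + nu ! r - 2 * mu ! r)" if "j < l" for j
    unfolding H_def using height_at_row_excess[OF local_interlaces(1,2)] that by (simp add: l_def)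
  have hts: "(case last_row (\<lambda>j. length (A j)) (\<lambda>j. length (B j)) 0 js of
      None \<Rightarrow> \<forall>k<length js. H (js ! k) \<le> ?x + int 0
    | Some r \<Rightarrow> \<exists>k<length js. js ! k = r \<and> H r > ?x + int 0 \<and> (\<forall>k'<k. H (js ! k') < H r) \<and>
        (\<forall>k'. k < k' \<and> k' < length js \<longrightarrow> H (js ! k') \<le> H r))"
  proof (rule last_row_heights)
    show "H (js ! 0) = ?x + int (length (A (js ! 0)))" if "js \<noteq> []"
      using that H[of 0] lA[of 0] by (simp add: js_def)
    show "H (js ! Suc k) = H (js ! k) - int (length (B (js ! k))) + int (length (A (js ! Suc k)))"
      if "Suc k < length js" for k
      using that H[of k] H[of "Suc k"] lA[of k] lA[of "Suc k"] by (simp add: js_def)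
  qed
  note pr = pending_rows[OF blocks, of 0, folded w_def]
  have ke: "kashiwara_e i P = (if w = [] then None else Some (refill P ((cell_label P)(last w := i))))"
    unfolding kashiwara_e_def w by (simp add: hd_rev)
  show ?thesis
  proof (cases "last_row (\<lambda>j. length (A j)) (\<lambda>j. length (B j)) 0 js")
    case None
    have "H j \<le> ?x" if "j < l" for j
      using hts None that by (simp add: js_def)
    then have "\<not> (kap \<preceq> mu1 \<and> mu1 \<preceq> nu \<and> lowering kap mu1 nu mu)" for mu1
      using no_raising_from_rows[OF local_interlaces(1,2)] by (simp add: H_def l_def)
    moreover have "w = []" using pr None by simp
    ultimately show ?thesis using ke by auto
  next
    case (Some r)
    then have r: "r \<in> set js" "A r \<noteq> []" "w \<noteq> []" "last w = last (A r)" using pr by auto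
    have rl: "r < l" using r(1) by (simp add: js_def)
    have k: "H r > ?x" "\<forall>k'<r. H k' < H r" "\<forall>k'. r < k' \<and> k' < l \<longrightarrow> H k' \<le> H r"
      using hts Some by (auto simp: js_def)
    have raise: "kap \<preceq> mu[r := mu ! r + 1] \<and> mu[r := mu ! r + 1] \<preceq> nu \<and> lowering kap (mu[r := mu ! r + 1]) nu mu"
      by (rule raising_from_rows[OF local_interlaces(1,2)]) (use rl k in \<open>auto simp: l_def H_def\<close>)
    have lt: "mu ! r < nu ! r" using r(2) by (simp add: A_def)
    then have "last (A r) = (r, mu ! r + 1)" by (simp add: A_def last_rev upto_rec1)
    then have "kashiwara_e i P = Some (P[i := mu[r := mu ! r + 1]])"
      using ke r refill_raise[OF P i, of r] lt rl local_interlaces(3)[unfolded mu_def] by (simp add: l_def nu_def mu_def)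
    then show ?thesis
      using raise raising_unique[of kap "mu[r := mu ! r + 1]" nu _ mu] by auto
  qed
qed

end

section \<open>Partial operators\<close>

definition closed_under :: "'b set \<Rightarrow> ('b \<Rightarrow> 'b option) \<Rightarrow> bool" where
  "closed_under X G \<longleftrightarrow> (\<forall>b\<in>X. \<forall>b'. G b = Some b' \<longrightarrow> b' \<in> X)"

definition intertwines :: "'b set \<Rightarrow> ('b \<Rightarrow> 'b) \<Rightarrow> ('b \<Rightarrow> 'b option) \<Rightarrow> ('b \<Rightarrow> 'b option) \<Rightarrow> bool" where
  "intertwines X h G G' \<longleftrightarrow> (\<forall>b\<in>X. G' (h b) = map_option h (G b))"

lemma closed_underD: "closed_under X G \<Longrightarrow> b \<in> X \<Longrightarrow> G b = Some b' \<Longrightarrow> b' \<in> X"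
  by (auto simp: closed_under_def)

lemma intertwines_conjugate:
  assumes "bij_betw h X X"
  shows "intertwines X h G (conjugate_by X h G)"
  using assms by (auto simp: intertwines_def conjugate_by_def bij_betw_def)

lemma intertwines_closed:
  assumes h: "bij_betw h X X" and t: "intertwines X h G G'" and c: "closed_under X G"
  shows "closed_under X G'"
  unfolding closed_under_def
proof (intro ballI allI impI)
  fix b b' assume b: "b \<in> X" "G' b = Some b'"
  obtain a where a: "a \<in> X" "b = h a" using h b(1) by (auto simp: bij_betw_def)
  then obtain a' where "G a = Some a'" "b' = h a'" using b t by (auto simp: intertwines_def)
  then show "b' \<in> X" using closed_underD[OF c a(1)] h by (auto simp: bij_betw_def)
qed

text \<open>Applied with one operator that commutes with \<open>h\<close> and is therefore carried
  to itself, while the other one is conjugated.\<close>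

lemma commute_on_transport:
  assumes h: "bij_betw h X X" and G: "intertwines X h G G'" "closed_under X G"
    and H: "intertwines X h H H'" "closed_under X H" and c: "commute_on X G H"
  shows "commute_on X G' H'"
  unfolding commute_on_def
proof
  fix b assume "b \<in> X"
  then obtain a where a: "a \<in> X" "b = h a" using h by (auto simp: bij_betw_def)
  have "Option.bind (H' b) G' = map_option h (Option.bind (H a) G)"
    using a G(1) H closed_underD[OF H(2) a(1)] by (cases "H a") (auto simp: intertwines_def)
  moreover have "Option.bind (G' b) H' = map_option h (Option.bind (G a) H)"
    using a H(1) G closed_underD[OF G(2) a(1)] by (cases "G a") (auto simp: intertwines_def)
  ultimately show "Option.bind (H' b) G' = Option.bind (G' b) H'"
    using c a(1) by (simp add: commute_on_def)
qed

lemma string_exponents_transport: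
  assumes t: "intertwines X h G G'" and c: "closed_under X G" and b: "b \<in> X"
  shows "string_exponents G' (h b) = string_exponents G b"
proof -
  have "((\<lambda>x. Option.bind x G') ^^ m) (Some (h b)) = map_option h (((\<lambda>x. Option.bind x G) ^^ m) (Some b)) \<and>
      (\<forall>b'. ((\<lambda>x. Option.bind x G) ^^ m) (Some b) = Some b' \<longrightarrow> b' \<in> X)" for m
  proof (induction m)
    case (Suc m)
    then show ?case
      using t closed_underD[OF c] by (cases "((\<lambda>x. Option.bind x G) ^^ m) (Some b)") (auto simp: intertwines_def)
  qed (use b in simp)
  then show ?thesis by (simp add: string_exponents_def)
qed

lemma string_exponents_eq:
  assumes c: "closed_under X G" and def: "\<And>b. b \<in> X \<Longrightarrow> G b \<noteq> None \<longleftrightarrow> m b > 0"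
    and step: "\<And>b b'. b \<in> X \<Longrightarrow> G b = Some b' \<Longrightarrow> m b = Suc (m b')"
    and b: "b \<in> X"
  shows "string_exponents G b = {..m b}"
proof -
  have none: "((\<lambda>x. Option.bind x G) ^^ k) None = None" for k by (induction k) auto
  have "((\<lambda>x. Option.bind x G) ^^ k) (Some b) \<noteq> None \<longleftrightarrow> k \<le> m b" if "b \<in> X" for k b
    using that
  proof (induction k arbitrary: b)
    case (Suc k)
    show ?case
    proof (cases "G b")
      case None
      then show ?thesis using def[OF Suc.prems] none by (simp add: funpow_Suc_right del: funpow.simps)
    next
      case (Some b')
      then show ?thesis
        using Suc.IH[of b'] closed_underD[OF c Suc.prems Some] step[OF Suc.prems Some]
        by (simp add: funpow_Suc_right del: funpow.simps)
    qed
  qed simp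
  then show ?thesis using b by (auto simp: string_exponents_def)
qed

text \<open>Since \<open>E\<close> is the partial inverse of \<open>F\<close>, it suffices to follow
  \<open>F\<close> along \<open>h\<close>. If \<open>E\<close> is defined at \<open>h b\<close>,
  surjectivity of \<open>h\<close> pulls its value back to a preimage of \<open>b\<close> under
  \<open>F\<close>.\<close>

lemma intertwines_inverse:
  assumes h: "bij_betw h X X" and c: "closed_under X E" "closed_under X F"
    and inv: "\<forall>b\<in>X. \<forall>b'\<in>X. F b = Some b' \<longleftrightarrow> E b' = Some b"
    and t: "intertwines X h F F"
  shows "intertwines X h E E"
  unfolding intertwines_def
proof
  fix b assume b: "b \<in> X"
  have hX: "h a \<in> X" if "a \<in> X" for a using h that by (auto simp: bij_betw_def)
  have inj: "h a = h a' \<Longrightarrow> a = a'" if "a \<in> X" "a' \<in> X" for a a'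
    using h that by (auto simp: bij_betw_def inj_on_def)
  show "E (h b) = map_option h (E b)"
  proof (cases "E b")
    case (Some a)
    then have a: "a \<in> X" using closed_underD c(1) b by metis
    then have "F a = Some b" using inv b Some by blast
    then have "F (h a) = Some (h b)" using t a by (simp add: intertwines_def)
    then show ?thesis using inv hX a b Some by simp
  next
    case None
    have "E (h b) \<noteq> Some a'" for a'
    proof
      assume E: "E (h b) = Some a'"
      then have "a' \<in> X" using closed_underD c(1) hX b by metis
      then obtain a where a: "a \<in> X" "a' = h a" using h by (auto simp: bij_betw_def)
      have "F (h a) = Some (h b)" using inv E a hX b by blast
      then obtain b' where b': "F a = Some b'" "h b' = h b" using t a by (auto simp: intertwines_def)
      then have "b' = b" using inj closed_underD[OF c(2) a(1)] b by blast
      then show False using inv a b b' None by force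
    qed
    then show ?thesis using None by auto
  qed
qed

section \<open>Crystal axioms at a single index and their transport\<close>

definition crystal_at ::
    "nat \<Rightarrow> 'b set \<Rightarrow> ('b \<Rightarrow> 'b option) \<Rightarrow> ('b \<Rightarrow> 'b option) \<Rightarrow> ('b \<Rightarrow> nat \<Rightarrow> int) \<Rightarrow> nat \<Rightarrow> bool" where
  "crystal_at n X E F wt i \<longleftrightarrow>
     closed_under X E \<and> closed_under X F \<and>
     (\<forall>b\<in>X. \<forall>b'\<in>X. F b = Some b' \<longleftrightarrow> E b' = Some b) \<and>
     (\<forall>b\<in>X. \<forall>b'\<in>X. F b = Some b' \<longrightarrow>
        (\<forall>j\<in>{1..n}. wt b' j = wt b j - eps n i j + eps n (Suc i) j)) \<and>
     (\<forall>b\<in>X. finite (string_exponents E b) \<and> finite (string_exponents F b) \<and>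
        int (Max (string_exponents F b)) - int (Max (string_exponents E b))
          = (\<Sum>j=1..n. (eps n i j - eps n (Suc i) j) * wt b j))"

lemma affine_crystal_iff: "affine_crystal n X E F wt \<longleftrightarrow> (\<forall>i<n. crystal_at n X (E i) (F i) wt i)"
proof -
  have "(\<forall>b\<in>X. \<forall>b'. A b = Some b' \<or> B b = Some b' \<longrightarrow> b' \<in> X) \<longleftrightarrow> closed_under X A \<and> closed_under X B" for A B
    by (auto simp: closed_under_def)
  then show ?thesis unfolding affine_crystal_def crystal_at_def by simp
qed

text \<open>Serves two purposes: with \<open>h\<close> the swap of the two tableaux and
  \<open>s\<close> the identity, and with \<open>h\<close> a shift and
  \<open>s = next_label n\<close>, which turns index 1 into index 0.\<close>

lemma crystal_at_transport:
  assumes h: "bij_betw h X X" and E: "intertwines X h E E'" and F: "intertwines X h F F'"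
    and c: "crystal_at n X E F wt i" and s: "bij_betw s {1..n} {1..n}"
    and wt: "\<And>b j. b \<in> X \<Longrightarrow> j \<in> {1..n} \<Longrightarrow> wt' (h b) j = wt b (s j)"
    and eps: "\<And>j. j \<in> {1..n} \<Longrightarrow> eps n i (s j) = eps n i' j \<and> eps n (Suc i) (s j) = eps n (Suc i') j"
  shows "crystal_at n X E' F' wt' i'"
proof -
  have cE: "closed_under X E" and cF: "closed_under X F"
    and inv: "\<And>b b'. b \<in> X \<Longrightarrow> b' \<in> X \<Longrightarrow> F b = Some b' \<longleftrightarrow> E b' = Some b"
    and w: "\<And>b b' j. b \<in> X \<Longrightarrow> b' \<in> X \<Longrightarrow> F b = Some b' \<Longrightarrow> j \<in> {1..n} \<Longrightarrow>
        wt b' j = wt b j - eps n i j + eps n (Suc i) j"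
    and st: "\<And>b. b \<in> X \<Longrightarrow> finite (string_exponents E b) \<and> finite (string_exponents F b) \<and>
        int (Max (string_exponents F b)) - int (Max (string_exponents E b))
          = (\<Sum>j=1..n. (eps n i j - eps n (Suc i) j) * wt b j)"
    using c unfolding crystal_at_def by blast+
  have im: "\<exists>a\<in>X. b = h a" if "b \<in> X" for b using h that by (auto simp: bij_betw_def)
  have sX: "s j \<in> {1..n}" if "j \<in> {1..n}" for j using s that by (auto simp: bij_betw_def)
  have mapF: "F' (h a) = Some (h a') \<longleftrightarrow> F a = Some a'" if "a \<in> X" "a' \<in> X" for a a'
    using F h that closed_underD[OF cF that(1)] by (auto simp: intertwines_def bij_betw_def inj_on_def)
  have mapE: "E' (h a) = Some (h a') \<longleftrightarrow> E a = Some a'" if "a \<in> X" "a' \<in> X" for a a'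
    using E h that closed_underD[OF cE that(1)] by (auto simp: intertwines_def bij_betw_def inj_on_def)
  show ?thesis
    unfolding crystal_at_def
  proof (intro conjI ballI impI)
    show "closed_under X E'" "closed_under X F'" using intertwines_closed h E F cE cF by blast+
  next
    fix b b' assume b: "b \<in> X" "b' \<in> X"
    then obtain a a' where a: "a \<in> X" "b = h a" "a' \<in> X" "b' = h a'" using im by metis
    then show "F' b = Some b' \<longleftrightarrow> E' b' = Some b" using mapE mapF inv by simp
    fix j assume F': "F' b = Some b'" and j: "j \<in> {1..n}"
    then show "wt' b' j = wt' b j - eps n i' j + eps n (Suc i') j"
      using w[OF a(1,3) _ sX[OF j]] wt a eps[OF j] mapF by simp
  next
    fix b assume b: "b \<in> X"
    then obtain a where a: "a \<in> X" "b = h a" using im by metis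
    have se: "string_exponents E' b = string_exponents E a" "string_exponents F' b = string_exponents F a"
      using string_exponents_transport E F cE cF a by metis+
    then show "finite (string_exponents E' b)" "finite (string_exponents F' b)" using st[OF a(1)] by auto
    have "(\<Sum>j=1..n. (eps n i' j - eps n (Suc i') j) * wt' b j) =
        (\<Sum>j=1..n. (eps n i (s j) - eps n (Suc i) (s j)) * wt a (s j))"
      using eps wt a by (intro sum.cong) auto
    also have "\<dots> = (\<Sum>j=1..n. (eps n i j - eps n (Suc i) j) * wt a j)"
      by (rule sum.reindex_bij_betw[OF s])
    finally show "int (Max (string_exponents F' b)) - int (Max (string_exponents E' b))
          = (\<Sum>j=1..n. (eps n i' j - eps n (Suc i') j) * wt' b j)"
      using st[OF a(1)] se by simp
  qed
qed

section \<open>The finite crystal operators\<close>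

lemma chain_update:
  assumes P: "chain n P" and i: "1 \<le> i" "i < n" and m: "P ! (i - 1) \<preceq> m" "m \<preceq> P ! Suc i"
  shows "chain n (P[i := m])"
proof -
  have "P[i := m] ! a \<preceq> P[i := m] ! Suc a" if "a < n" for a
    using chain_interlaces[OF P that] m i that P
    by (cases "a = i"; cases "Suc a = i") (auto simp: chain_def)
  then show ?thesis using P by (simp add: chain_def)
qed

lemma kashiwara_f_chain:
  assumes P: "chain n P" and i: "1 \<le> i" "i < n" and f: "kashiwara_f i P = Some P'"
  obtains mu1 where "P' = P[i := mu1]" "lowering (P ! (i - 1)) (P ! i) (P ! Suc i) mu1" "chain n P'"
    "P' ! i = mu1" "\<And>a. a \<noteq> i \<Longrightarrow> P' ! a = P ! a" "P = P'[i := P ! i]"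
proof -
  obtain mu1 where m: "P' = P[i := mu1]" "lowering (P ! (i - 1)) (P ! i) (P ! Suc i) mu1"
    using f kashiwara_f_iff[OF P i] by blast
  have "chain n P'"
    using chain_update[OF P i] lowering_interlaces[OF local_interlaces(1,2)[OF P i] m(2)] m(1) by simp
  then show ?thesis using that[OF m] m(1) P i by (simp add: chain_def)
qed

lemma kashiwara_e_chain:
  assumes P: "chain n P" and i: "1 \<le> i" "i < n" and e: "kashiwara_e i P = Some P'"
  obtains mu1 where "P' = P[i := mu1]" "lowering (P ! (i - 1)) mu1 (P ! Suc i) (P ! i)" "chain n P'"
    "P' ! i = mu1" "\<And>a. a \<noteq> i \<Longrightarrow> P' ! a = P ! a" "P = P'[i := P ! i]"
proof -
  obtain mu1 where m: "P ! (i - 1) \<preceq> mu1" "mu1 \<preceq> P ! Suc i" "P' = P[i := mu1]"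
      "lowering (P ! (i - 1)) mu1 (P ! Suc i) (P ! i)"
    using e kashiwara_e_iff[OF P i] by blast
  have "chain n P'" using chain_update[OF P i m(1,2)] m(3) by simp
  then show ?thesis using that[OF m(3,4)] m(3) P i by (simp add: chain_def)
qed

lemma kashiwara_inverse:
  assumes P: "chain n P" and P': "chain n P'" and i: "1 \<le> i" "i < n"
  shows "kashiwara_f i P = Some P' \<longleftrightarrow> kashiwara_e i P' = Some P"
proof
  assume "kashiwara_f i P = Some P'"
  then obtain mu1 where m: "lowering (P ! (i - 1)) (P ! i) (P ! Suc i) mu1"
    "P' ! i = mu1" "\<And>a. a \<noteq> i \<Longrightarrow> P' ! a = P ! a" "P = P'[i := P ! i]"
    using kashiwara_f_chain[OF P i] by metis
  then show "kashiwara_e i P' = Some P"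
    unfolding kashiwara_e_iff[OF P' i] using local_interlaces(1,2)[OF P i] i
    by (intro exI[of _ "P ! i"]) auto
next
  assume "kashiwara_e i P' = Some P"
  then obtain mu1 where m: "lowering (P' ! (i - 1)) mu1 (P' ! Suc i) (P' ! i)"
    "P ! i = mu1" "\<And>a. a \<noteq> i \<Longrightarrow> P ! a = P' ! a" "P' = P[i := P' ! i]"
    using kashiwara_e_chain[OF P' i] by metis
  then show "kashiwara_f i P = Some P'"
    unfolding kashiwara_f_iff[OF P i] using i by (intro exI[of _ "P' ! i"]) auto
qed

lemma on_first_Some: "on_first g b = Some b' \<longleftrightarrow> (\<exists>P. g (fst b) = Some P \<and> b' = (P, snd b))"
  by (auto simp: on_first_def)

lemma eps_weight_sum:
  assumes "1 \<le> i" "i < n"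
  shows "(\<Sum>j=1..n. (eps n i j - eps n (Suc i) j) * w j) = w i - w (Suc i)"
proof -
  have "(\<Sum>j=1..n. (eps n i j - eps n (Suc i) j) * w j) =
      (\<Sum>j=1..n. (if j = i then w j else 0) - (if j = Suc i then w j else 0))"
    using assms by (intro sum.cong) (auto simp: eps_def)
  then show ?thesis using assms by (simp add: sum_subtractf)
qed

lemma crystal_at_first:
  assumes i: "1 \<le> i" "i < n"
  shows "crystal_at n (tableau_pairs n) (on_first (kashiwara_e i)) (on_first (kashiwara_f i)) wt1 i"
proof -
  have n: "n \<ge> 1" using i by simp
  let ?X = "tableau_pairs n"
  let ?E = "on_first (kashiwara_e i) :: int list list \<times> int list list \<Rightarrow> _"
  let ?F = "on_first (kashiwara_f i) :: int list list \<times> int list list \<Rightarrow> _"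
  have chX: "chain n (fst b)" if "b \<in> ?X" for b using that by (simp add: tableau_pairs_iff[OF n])
  have cF: "closed_under ?X ?F"
    unfolding closed_under_def
  proof (intro ballI allI impI)
    fix b b' assume b: "b \<in> ?X" and "?F b = Some b'"
    then obtain P' where P': "kashiwara_f i (fst b) = Some P'" "b' = (P', snd b)" by (auto simp: on_first_Some)
    obtain mu1 where "chain n P'" "\<And>a. a \<noteq> i \<Longrightarrow> P' ! a = fst b ! a"
      using kashiwara_f_chain[OF chX[OF b] i P'(1)] by metis
    then show "b' \<in> ?X" using b P'(2) i by (simp add: tableau_pairs_iff[OF n])
  qed
  have cE: "closed_under ?X ?E"
    unfolding closed_under_def
  proof (intro ballI allI impI)
    fix b b' assume b: "b \<in> ?X" and "?E b = Some b'"
    then obtain P' where P': "kashiwara_e i (fst b) = Some P'" "b' = (P', snd b)" by (auto simp: on_first_Some)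
    obtain mu1 where "chain n P'" "\<And>a. a \<noteq> i \<Longrightarrow> P' ! a = fst b ! a"
      using kashiwara_e_chain[OF chX[OF b] i P'(1)] by metis
    then show "b' \<in> ?X" using b P'(2) i by (simp add: tableau_pairs_iff[OF n])
  qed
  have inv: "?F b = Some b' \<longleftrightarrow> ?E b' = Some b" if "b \<in> ?X" "b' \<in> ?X" for b b'
    using kashiwara_inverse[OF chX[OF that(1)] chX[OF that(2)] i]
    by (cases b; cases b') (auto simp: on_first_Some)
  have wt: "wt1 b' j = wt1 b j - eps n i j + eps n (Suc i) j"
    if b: "b \<in> ?X" "?F b = Some b'" "j \<in> {1..n}" for b b' j
  proof -
    obtain P' where P': "kashiwara_f i (fst b) = Some P'" "b' = (P', snd b)" using b by (auto simp: on_first_Some)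
    obtain mu1 where m: "chain n P'" "\<And>a. a \<noteq> i \<Longrightarrow> P' ! a = fst b ! a" "P' ! i = mu1"
        "lowering (fst b ! (i - 1)) (fst b ! i) (fst b ! Suc i) mu1"
      using kashiwara_f_chain[OF chX[OF b(1)] i P'(1)] by metis
    have "sum_list mu1 = sum_list (fst b ! i) - 1" using lowering_height[OF m(4)] by blast
    then have s: "sum_list (P' ! a) = sum_list (fst b ! a) - (if a = i then 1 else 0)" for a
      using m(2)[of a] m(3) by auto
    have "wt1 b' j = sum_list (P' ! j) - sum_list (P' ! (j - 1))"
      "wt1 b j = sum_list (fst b ! j) - sum_list (fst b ! (j - 1))"
      using label_count_chain[OF m(1), of j] label_count_chain[OF chX[OF b(1)], of j] b(3) P'(2)
      by (auto simp: wt1_def)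
    then show ?thesis using s[of j] s[of "j - 1"] b(3) i by (auto simp: eps_def)
  qed
  \<comment> \<open>\<open>ph\<close> and \<open>ph - ex\<close> are the lengths of the strings of
    \<open>f\<close> and \<open>e\<close>: a step of \<open>f\<close> decreases \<open>ph\<close> by
    1 and \<open>ex\<close> by 2, hence increases the second length by 1.\<close>
  define ph where "ph b = string_phi (fst b ! (i - 1)) (fst b ! i) (fst b ! Suc i)" for b :: "int list list \<times> int list list"
  define ex where "ex b = excess (fst b ! (i - 1)) (fst b ! i) (fst b ! Suc i)" for b :: "int list list \<times> int list list"
  have bounds: "0 \<le> ph b" "ex b \<le> ph b" if "b \<in> ?X" for b
    using string_phi_bounds(1,2)[OF local_interlaces(1,2)[OF chX[OF that] i]] by (auto simp: ph_def ex_def)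
  have stepF: "ph b' = ph b - 1 \<and> ex b' = ex b - 2" if b: "b \<in> ?X" "?F b = Some b'" for b b'
  proof -
    obtain P' where P': "kashiwara_f i (fst b) = Some P'" "b' = (P', snd b)" using b by (auto simp: on_first_Some)
    obtain mu1 where m: "\<And>a. a \<noteq> i \<Longrightarrow> P' ! a = fst b ! a" "P' ! i = mu1"
        "lowering (fst b ! (i - 1)) (fst b ! i) (fst b ! Suc i) mu1"
      using kashiwara_f_chain[OF chX[OF b(1)] i P'(1)] by metis
    then show ?thesis
      using lowering_string_phi[OF local_interlaces(1,2)[OF chX[OF b(1)] i] m(3)] P'(2) i
      by (simp add: ph_def ex_def)
  qed
  have seF: "string_exponents ?F b = {..nat (ph b)}" if "b \<in> ?X" for b
  proof (rule string_exponents_eq[OF cF _ _ that])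
    fix b assume b: "b \<in> ?X"
    have "?F b \<noteq> None \<longleftrightarrow> (\<exists>P'. kashiwara_f i (fst b) = Some P')" by (auto simp: on_first_def)
    also have "\<dots> \<longleftrightarrow> ph b > 0"
      unfolding kashiwara_f_iff[OF chX[OF b] i] ph_def
      using lowering_iff_string_phi[OF local_interlaces(1,2)[OF chX[OF b] i]] by blast
    finally show "?F b \<noteq> None \<longleftrightarrow> 0 < nat (ph b)" by simp
    fix b' assume F: "?F b = Some b'"
    show "nat (ph b) = Suc (nat (ph b'))" using stepF[OF b F] bounds(1)[OF closed_underD[OF cF b F]] by simp
  qed
  have seE: "string_exponents ?E b = {..nat (ph b - ex b)}" if "b \<in> ?X" for b
  proof (rule string_exponents_eq[OF cE _ _ that])
    fix b assume b: "b \<in> ?X"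
    have "?E b \<noteq> None \<longleftrightarrow> (\<exists>P'. kashiwara_e i (fst b) = Some P')" by (auto simp: on_first_def)
    also have "\<dots> \<longleftrightarrow> ph b > ex b"
      unfolding kashiwara_e_iff[OF chX[OF b] i] ph_def ex_def
      using raising_iff_string[OF local_interlaces(1,2)[OF chX[OF b] i]] by blast
    finally show "?E b \<noteq> None \<longleftrightarrow> 0 < nat (ph b - ex b)" by simp
    fix b' assume E: "?E b = Some b'"
    note b' = closed_underD[OF cE b E]
    have "?F b' = Some b" using inv[OF b' b] E by blast
    then show "nat (ph b - ex b) = Suc (nat (ph b' - ex b'))" using stepF[OF b'] bounds(2)[OF b'] by simp
  qed
  \<comment> \<open>The two string lengths differ by \<open>ex\<close>, and label counts are
    differences of the sizes of consecutive signatures.\<close>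
  have sum: "ex b = wt1 b i - wt1 b (Suc i)" if "b \<in> ?X" for b
    using label_count_chain[OF chX[OF that], of i] label_count_chain[OF chX[OF that], of "Suc i"] i
    by (simp add: wt1_def ex_def excess_def)
  have Mx: "Max {..k} = k" for k :: nat by (intro Max_eqI) auto
  show ?thesis
    unfolding crystal_at_def eps_weight_sum[OF i]
    using cE cF inv wt seE seF sum bounds Mx by auto
qed

section \<open>Commutation with the shifts\<close>

text \<open>Only the squares on both sides of \<open>P ! i\<close> see the change. The right one
  returns to the old signature at \<open>Suc i\<close>, so the recursion continues as
  before.\<close>

lemma transfer_lowering:
  assumes P: "chain n P" and i: "1 \<le> i" "i < n" and s: "P ! 0 \<preceq> s"
    and l: "lowering (P ! (i - 1)) (P ! i) (P ! Suc i) mu1"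
  obtains muh1 where "lowering (transfer P s (i - 1)) (transfer P s i) (transfer P s (Suc i)) muh1"
    "\<And>a. a \<le> n \<Longrightarrow> transfer (P[i := mu1]) s a = (if a = i then muh1 else transfer P s a)"
proof -
  obtain k where k: "i = Suc k" using i(1) by (cases i) auto
  obtain c where c: "fomin_square (P ! k) (P ! i) (transfer P s k) (transfer P s i) c"
    using transfer_square[OF P s, of k] i k by auto
  obtain e where e: "fomin_square (P ! i) (P ! Suc i) (transfer P s i) (transfer P s (Suc i)) e"
    using transfer_square[OF P s, of i] i by auto
  obtain muh1 c1 e1 where m: "fomin_square (P ! k) mu1 (transfer P s k) muh1 c1"
      "fomin_square mu1 (P ! Suc i) muh1 (transfer P s (Suc i)) e1"
      "lowering (transfer P s k) (transfer P s i) (transfer P s (Suc i)) muh1"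
    using fomin_square_lowering[OF c e, of mu1] l k by auto
  have len: "i < length P" using P i by (simp add: chain_def)
  have "a \<le> n \<longrightarrow> transfer (P[i := mu1]) s a = (if a = i then muh1 else transfer P s a)" for a
  proof (induction a)
    case (Suc a)
    consider "Suc a = i" | "a = i" | "a \<noteq> i" "Suc a \<noteq> i" by blast
    then show ?case
    proof cases
      case 1
      then show ?thesis using Suc fomin_rule_eq[OF m(1)] k len by auto
    next
      case 2
      then show ?thesis using Suc fomin_rule_eq[OF m(2)] len by auto
    next
      case 3
      then show ?thesis using Suc by auto
    qed
  qed (use i in simp)
  then show ?thesis using that[of muh1] m(3) k by auto
qed

lemma first_f_iota2:
  assumes i: "1 \<le> i" "i < n"
  shows "intertwines (tableau_pairs n) (iota2 n) (on_first (kashiwara_f i)) (on_first (kashiwara_f i))"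
  unfolding intertwines_def
proof
  have n: "n \<ge> 1" using i by simp
  fix b assume b: "b \<in> tableau_pairs n"
  define P where "P = fst b"
  define s where "s = snd b ! 1"
  have P: "chain n P" using b by (simp add: tableau_pairs_iff[OF n] P_def)
  have s: "P ! 0 \<preceq> s" using pair_start[OF n b] by (simp add: P_def s_def)
  have up: "iota2 n b = up n b" by (rule iota2_up[OF n b])
  have ub: "up n b \<in> tableau_pairs n" by (rule up_in[OF n b])
  have R: "chain n (fst (up n b))" using ub by (simp add: tableau_pairs_iff[OF n])
  have nth: "fst (up n b) ! (i - 1) = transfer P s (i - 1)" "fst (up n b) ! i = transfer P s i"
    "fst (up n b) ! Suc i = transfer P s (Suc i)"
    using i by (auto simp: up_fst P_def s_def simp del: transfer.simps)
  show "on_first (kashiwara_f i) (iota2 n b) = map_option (iota2 n) (on_first (kashiwara_f i) b)"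
  proof (cases "kashiwara_f i P")
    case None
    \<comment> \<open>Undefinedness has to agree as well: a lowering of the upper row is reflected
      to the lower row.\<close>
    have "kashiwara_f i (fst (up n b)) = None"
    proof (rule ccontr)
      assume "kashiwara_f i (fst (up n b)) \<noteq> None"
      then obtain muh1 where l: "lowering (transfer P s (i - 1)) (transfer P s i) (transfer P s (Suc i)) muh1"
        using kashiwara_f_iff[OF R i] unfolding nth by blast
      obtain c where c: "fomin_square (P ! (i - 1)) (P ! i) (transfer P s (i - 1)) (transfer P s i) c"
      proof -
        have "i - 1 < n" "Suc (i - 1) = i" using i by auto
        then show ?thesis using transfer_square[OF P s, of "i - 1"] that by metis
      qed
      obtain e where e: "fomin_square (P ! i) (P ! Suc i) (transfer P s i) (transfer P s (Suc i)) e"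
        using transfer_square[OF P s, of i] i by auto
      obtain mu1 where "lowering (P ! (i - 1)) (P ! i) (P ! Suc i) mu1"
        using fomin_square_lowering_reflect[OF c e l] by blast
      then have "kashiwara_f i P = Some (P[i := mu1])" unfolding kashiwara_f_iff[OF P i] by (intro exI[of _ mu1] conjI) simp_all
      then show False using None by simp
    qed
    then show ?thesis using None by (simp add: up on_first_def P_def)
  next
    case (Some P')
    then obtain mu1 where m: "lowering (P ! (i - 1)) (P ! i) (P ! Suc i) mu1" "P' = P[i := mu1]"
      using kashiwara_f_iff[OF P i] by blast
    obtain muh1 where h: "lowering (transfer P s (i - 1)) (transfer P s i) (transfer P s (Suc i)) muh1"
        "\<And>a. a \<le> n \<Longrightarrow> transfer (P[i := mu1]) s a = (if a = i then muh1 else transfer P s a)"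
      using transfer_lowering[OF P i s m(1)] by blast
    have cl: "closed_under (tableau_pairs n) (on_first (kashiwara_f i))"
      using crystal_at_first[OF i] unfolding crystal_at_def by (elim conjE)
    have "on_first (kashiwara_f i) b = Some (P', snd b)" using Some by (simp add: on_first_def P_def)
    moreover from this have "(P', snd b) \<in> tableau_pairs n"
      by (rule closed_underD[OF cl b])
    then have "iota2 n (P', snd b) = up n (P', snd b)" by (rule iota2_up[OF n])
    moreover have "up n (P', snd b) = ((fst (up n b))[i := muh1], snd (up n b))"
    proof -
      have "fst (up n (P', snd b)) = (fst (up n b))[i := muh1]"
        using h(2) m(2) by (intro nth_equalityI) (auto simp: up_length up_fst nth_list_update P_def s_def)
      \<comment> \<open>As \<open>i < n\<close>, the end of the transferred row is unchanged, and it
        is the only entry of the second component that depends on the first tableau.\<close>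
      moreover have "snd (up n (P', snd b)) = snd (up n b)"
        using h(2)[of n] m(2) i by (simp add: up_def P_def s_def)
      ultimately show ?thesis by (simp add: prod_eq_iff)
    qed
    moreover have "kashiwara_f i (fst (up n b)) = Some ((fst (up n b))[i := muh1])"
      unfolding kashiwara_f_iff[OF R i] nth using h(1) by (intro exI[of _ muh1] conjI) simp_all
    ultimately show ?thesis by (simp add: up on_first_def)
  qed
qed

lemma first_e_iota2:
  assumes i: "1 \<le> i" "i < n"
  shows "intertwines (tableau_pairs n) (iota2 n) (on_first (kashiwara_e i)) (on_first (kashiwara_e i))"
proof (rule intertwines_inverse[where F = "on_first (kashiwara_f i)"])
  show "bij_betw (iota2 n) (tableau_pairs n) (tableau_pairs n)" using i by (intro iota2_bij) simp
  note c = crystal_at_first[OF i, unfolded crystal_at_def]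
  show "closed_under (tableau_pairs n) (on_first (kashiwara_e i))" using c by (rule conjunct1)
  show "closed_under (tableau_pairs n) (on_first (kashiwara_f i))" using c by blast
  show "\<forall>b\<in>tableau_pairs n. \<forall>b'\<in>tableau_pairs n.
      on_first (kashiwara_f i) b = Some b' \<longleftrightarrow> on_first (kashiwara_e i) b' = Some b"
    using c by blast
qed (rule first_f_iota2[OF i])

lemma swap_bij: "n \<ge> 1 \<Longrightarrow> bij_betw prod.swap (tableau_pairs n) (tableau_pairs n)"
  by (rule bij_betw_byWitness[where f' = prod.swap]) (simp_all add: image_subset_iff swap_in)

lemma second_first: "on_second g b = map_option prod.swap (on_first g (prod.swap b))"
  by (simp add: on_second_def on_first_def option.map_comp comp_def)

lemma second_swap: "intertwines X prod.swap (on_first g) (on_second g)"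
  by (simp add: intertwines_def second_first)

text \<open>Swapping the tableaux exchanges \<open>iota1\<close> with \<open>iota2\<close> and the
  first factor with the second.\<close>

lemma second_iota1:
  assumes n: "n \<ge> 1" and c: "closed_under (tableau_pairs n) (on_first g)"
    and t: "intertwines (tableau_pairs n) (iota2 n) (on_first g) (on_first g)"
  shows "intertwines (tableau_pairs n) (iota1 n) (on_second g) (on_second g)"
  unfolding intertwines_def
proof
  fix b assume b: "b \<in> tableau_pairs n"
  then have sb: "prod.swap b \<in> tableau_pairs n" by (simp only: swap_in[OF n])
  have "on_second g (iota1 n b) = map_option (prod.swap \<circ> iota2 n) (on_first g (prod.swap b))"
    using t sb by (simp add: iota1_swap[OF n b] second_first intertwines_def option.map_comp)
  also have "\<dots> = map_option (iota1 n \<circ> prod.swap) (on_first g (prod.swap b))"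
  proof (rule option.map_cong[OF refl])
    fix z assume "z \<in> set_option (on_first g (prod.swap b))"
    then have "z \<in> tableau_pairs n" using closed_underD[OF c sb] by simp
    then have "prod.swap z \<in> tableau_pairs n" by (simp only: swap_in[OF n])
    then show "(prod.swap \<circ> iota2 n) z = (iota1 n \<circ> prod.swap) z"
      using iota1_swap[OF n, of "prod.swap z"] by simp
  qed
  also have "\<dots> = map_option (iota1 n) (on_second g b)"
    by (simp add: second_first option.map_comp)
  finally show "on_second g (iota1 n b) = map_option (iota1 n) (on_second g b)" .
qed

section \<open>Weights under the shifts\<close>

lemma fomin_square_sum_list:
  assumes s: "fomin_square kap mu lam nu c"
  shows "sum_list nu + sum_list kap = sum_list mu + sum_list lam"
proof -
  have len: "length mu = length kap" "length lam = length kap" "length nu = length kap"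
    using s by (auto simp: fomin_square_def interlaces_def sig_iff)
  have q: "queue (\<lambda>x. cj mu x + cj lam x - 2 * cj kap x - 1) c" using s by (simp add: fomin_square_def)
  obtain N1 N2 N3 N4 where N: "\<And>x. x \<le> N1 \<Longrightarrow> psum kap x = int (length kap) * x"
    "\<And>x. x \<le> N2 \<Longrightarrow> psum mu x = int (length mu) * x" "\<And>x. x \<le> N3 \<Longrightarrow> psum lam x = int (length lam) * x"
    "\<And>x. x \<le> N4 \<Longrightarrow> psum nu x = int (length nu) * x"
    using psum_left by metis
  obtain N5 where N5: "\<And>x. x \<le> N5 \<Longrightarrow> c x = 0" using queue_leftE[OF q] by blast
  \<comment> \<open>Up to column \<open>x\<close> the balance is off by exactly the carry, which
    vanishes far to the right.\<close>
  have eq: "psum nu x + psum kap x = psum mu x + psum lam x - c x" for x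
  proof (rule left_induct[of "min (min N1 N2) (min N3 (min N4 N5))" "\<lambda>x. psum nu x + psum kap x = psum mu x + psum lam x - c x"])
    show "psum nu x + psum kap x = psum mu x + psum lam x - c x" if "x \<le> min (min N1 N2) (min N3 (min N4 N5))" for x
      using that N N5 len by simp
    show "psum nu x + psum kap x = psum mu x + psum lam x - c x"
      if "psum nu (x - 1) + psum kap (x - 1) = psum mu (x - 1) + psum lam (x - 1) - c (x - 1)" for x
      using that psum_diff[of nu x] psum_diff[of kap x] psum_diff[of mu x] psum_diff[of lam x] s
      by (simp add: fomin_square_def)
  qed
  obtain M1 M2 M3 M4 where M: "\<And>x. x \<ge> M1 \<Longrightarrow> psum kap x = sum_list kap"
    "\<And>x. x \<ge> M2 \<Longrightarrow> psum mu x = sum_list mu" "\<And>x. x \<ge> M3 \<Longrightarrow> psum lam x = sum_list lam"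
    "\<And>x. x \<ge> M4 \<Longrightarrow> psum nu x = sum_list nu"
    using psum_right by metis
  obtain M5 where M5: "\<And>x. x \<ge> M5 \<Longrightarrow> c x = 0" using fomin_square_right[OF s] by blast
  define x where "x = max (max M1 M2) (max M3 (max M4 M5))"
  show ?thesis using eq[of x] M(1)[of x] M(2)[of x] M(3)[of x] M(4)[of x] M5[of x] by (simp add: x_def)
qed

lemma field_sum_list:
  assumes "fomin_field n L"
  shows "sum_list (L (x + 1, int k)) - sum_list (L (x, int k)) = sum_list (L (x + 1, 0)) - sum_list (L (x, 0))"
proof (induction k)
  case (Suc k)
  obtain c where "fomin_square (L (x, int k)) (L (x + 1, int k)) (L (x, int k + 1)) (L (x + 1, int k + 1)) c"
    using fomin_rule_square fomin_field_def assms by metis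
  from fomin_square_sum_list[OF this] show ?case using Suc by (simp add: add.commute)
qed simp

definition next_label :: "nat \<Rightarrow> nat \<Rightarrow> nat" where
  "next_label n j = (if j = n then 1 else Suc j)"

lemma next_label_bij:
  assumes "n \<ge> 1" shows "bij_betw (next_label n) {1..n} {1..n}"
  by (rule bij_betw_byWitness[where f' = "\<lambda>j. if j = 1 then n else j - 1"])
    (use assms in \<open>auto simp: next_label_def\<close>)

text \<open>A label count is a difference of sizes at neighbouring points. For the last label, the
  cylinder moves the step from \<open>(n, 0)\<close> to \<open>(n + 1, 0)\<close> to the step from
  \<open>(0, n)\<close> to \<open>(1, n)\<close>, and conservation of size in each square identifies
  its count with that of the step from \<open>(0, 0)\<close> to \<open>(1, 0)\<close>.\<close>

lemma wt1_iota1: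
  assumes n: "n \<ge> 1" and b: "b \<in> tableau_pairs n" and j: "j \<in> {1..n}"
  shows "wt1 (iota1 n b) j = wt1 b (next_label n j)"
proof -
  obtain L where L: "fomin_field n L" "pair_at n L 0 0 = b" using field_exists[OF n b] by blast
  have io: "iota1 n b = pair_at n L 1 0" using iota_pair_at(1)[OF n L(1), of 0 0] L(2) by simp
  have chain: "chain n (fst (pair_at n L x 0))" for x
    using pair_at_in[OF n L(1), of x 0] by (simp add: tableau_pairs_iff[OF n])
  have wt: "wt1 (pair_at n L x 0) a = sum_list (L (x + int a, 0)) - sum_list (L (x + int a - 1, 0))"
    if "a \<in> {1..n}" for a x
    using label_count_chain[OF chain, of a x] that by (simp add: wt1_def pair_at_nth[OF n] of_nat_diff algebra_simps)
  show ?thesis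
  proof (cases "j = n")
    case True
    have p: "L (x + int n, 0) = L (x, int n)" for x using field_periodic[OF n L(1), of x 1 0] by simp
    have "wt1 (iota1 n b) j = sum_list (L (1, int n)) - sum_list (L (0, int n))"
      using wt[of j 1] j True p[of 1] p[of 0] by (simp add: io)
    also have "\<dots> = wt1 b 1"
      using field_sum_list[OF L(1), of 0 n] wt[of 1 0] n L(2) by simp
    finally show ?thesis using True by (simp add: next_label_def)
  next
    case False
    then show ?thesis using wt[of j 1] wt[of "Suc j" 0] j L(2) by (simp add: io next_label_def)
  qed
qed

lemma wt2_iota2:
  assumes n: "n \<ge> 1" and b: "b \<in> tableau_pairs n" and j: "j \<in> {1..n}"
  shows "wt2 (iota2 n b) j = wt2 b (next_label n j)"
proof -
  have "prod.swap b \<in> tableau_pairs n" using b by (simp only: swap_in[OF n])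
  from wt1_iota1[OF n this j] iota1_swap[OF n this] show ?thesis by (simp add: wt1_def wt2_def)
qed

lemma crystal_at_second:
  assumes i: "1 \<le> i" "i < n"
  shows "crystal_at n (tableau_pairs n) (on_second (kashiwara_e i)) (on_second (kashiwara_f i)) wt2 i"
proof (rule crystal_at_transport[where h = prod.swap and s = "\<lambda>j. j"])
  show "bij_betw prod.swap (tableau_pairs n) (tableau_pairs n)" using i by (intro swap_bij) simp
  show "crystal_at n (tableau_pairs n) (on_first (kashiwara_e i)) (on_first (kashiwara_f i)) wt1 i"
    by (rule crystal_at_first[OF i])
  show "bij_betw (\<lambda>j. j) {1..n} {1..n}" by (simp add: bij_betw_def)
qed (simp_all add: second_swap wt1_def wt2_def)

lemma crystal_at_shift:
  assumes n: "n \<ge> 2" and h: "bij_betw h X X" and c: "crystal_at n X E F wt 1"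
    and wt: "\<And>b j. b \<in> X \<Longrightarrow> j \<in> {1..n} \<Longrightarrow> wt (h b) j = wt b (next_label n j)"
  shows "crystal_at n X (conjugate_by X h E) (conjugate_by X h F) wt 0"
proof (rule crystal_at_transport[OF h intertwines_conjugate[OF h] intertwines_conjugate[OF h] c])
  show "bij_betw (next_label n) {1..n} {1..n}" using n by (intro next_label_bij) simp
  \<comment> \<open>The wrap-around of \<open>next_label\<close> at \<open>n\<close> matches the
    convention that \<open>eps n 0\<close> is the basis vector at \<open>n\<close>; by
    \<open>n \<ge> 2\<close>, label 2 follows label 1.\<close>
  show "eps n 1 (next_label n j) = eps n 0 j \<and> eps n (Suc 1) (next_label n j) = eps n (Suc 0) j"
    if "j \<in> {1..n}" for j
    using that n by (auto simp: eps_def next_label_def)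
qed (rule wt)

section \<open>The two affine crystals and their commutation\<close>

lemma affine_crystals:
  assumes n: "n \<ge> 2"
  shows "affine_crystal n (tableau_pairs n) (E1 n) (F1 n) wt1"
    "affine_crystal n (tableau_pairs n) (E2 n) (F2 n) wt2"
proof -
  let ?X = "tableau_pairs n"
  have n1: "n \<ge> 1" using n by simp
  show "affine_crystal n ?X (E1 n) (F1 n) wt1"
    unfolding affine_crystal_iff
  proof (intro allI impI)
    fix i assume "i < n"
    then show "crystal_at n ?X (E1 n i) (F1 n i) wt1 i"
      using crystal_at_shift[OF n iota1_bij[OF n1] crystal_at_first wt1_iota1[OF n1]] crystal_at_first[of i n] n
      by (cases "i = 0") (auto simp: E1_def F1_def)
  qed
  show "affine_crystal n ?X (E2 n) (F2 n) wt2"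
    unfolding affine_crystal_iff
  proof (intro allI impI)
    fix i assume "i < n"
    then show "crystal_at n ?X (E2 n i) (F2 n i) wt2 i"
      using crystal_at_shift[OF n iota2_bij[OF n1] crystal_at_second wt2_iota2[OF n1]] crystal_at_second[of i n] n
      by (cases "i = 0") (auto simp: E2_def F2_def)
  qed
qed

lemma families_commute:
  assumes n: "n \<ge> 2" and G: "G \<in> operator_family n (E1 n) (F1 n)" and H: "H \<in> operator_family n (E2 n) (F2 n)"
  shows "commute_on (tableau_pairs n) G H"
proof -
  let ?X = "tableau_pairs n"
  have n1: "n \<ge> 1" using n by simp
  \<comment> \<open>This property is all that is required of \<open>e\<close> and \<open>f\<close>,
    so that every member of a family has the form \<open>on_first g\<close> or its conjugate, and
    correspondingly for the second factor.\<close>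
  define first where "first g \<longleftrightarrow> closed_under ?X (on_first g) \<and> intertwines ?X (iota2 n) (on_first g) (on_first g)"
    for g :: "int list list \<Rightarrow> int list list option"
  have first: "first (kashiwara_e i)" "first (kashiwara_f i)" if "1 \<le> i" "i < n" for i
    using crystal_at_first[OF that] first_e_iota2[OF that] first_f_iota2[OF that]
    by (auto simp: first_def crystal_at_def)
  have second: "closed_under ?X (on_second g) \<and> intertwines ?X (iota1 n) (on_second g) (on_second g)" if "first g" for g
    using that intertwines_closed[OF swap_bij[OF n1] second_swap] second_iota1[OF n1] by (auto simp: first_def)
  have G': "\<exists>g. first g \<and> (G = on_first g \<or> G = conjugate_by ?X (iota1 n) (on_first g))"
  proof -
    obtain i where i: "i < n" "G = E1 n i \<or> G = F1 n i" using G by (auto simp: operator_family_def)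
    then show ?thesis using first[of i] first[of 1] n by (cases "i = 0") (auto simp: E1_def F1_def)
  qed
  have H': "\<exists>g. first g \<and> (H = on_second g \<or> H = conjugate_by ?X (iota2 n) (on_second g))"
  proof -
    obtain i where i: "i < n" "H = E2 n i \<or> H = F2 n i" using H by (auto simp: operator_family_def)
    then show ?thesis using first[of i] first[of 1] n by (cases "i = 0") (auto simp: E2_def F2_def)
  qed
  obtain g where g: "first g" "G = on_first g \<or> G = conjugate_by ?X (iota1 n) (on_first g)" using G' by blast
  obtain k where k: "first k" "H = on_second k \<or> H = conjugate_by ?X (iota2 n) (on_second k)" using H' by blast
  have gk: "commute_on ?X (on_first g) (on_second k)"
    unfolding commute_on_def
  proof
    fix b assume "b \<in> ?X"
    show "Option.bind (on_second k b) (on_first g) = Option.bind (on_first g b) (on_second k)"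
      by (cases "g (fst b)"; cases "k (snd b)") (simp_all add: on_first_def on_second_def)
  qed
  note h1 = iota1_bij[OF n1] and h2 = iota2_bij[OF n1]
  \<comment> \<open>Conjugation by \<open>iota1\<close> carries \<open>on_second k\<close> to
    itself, and it preserves commutation with \<open>iota2\<close> because the two shifts commute.
    This leaves \<open>G\<close> ready for the conjugation of the second factor by
    \<open>iota2\<close>.\<close>
  have G2: "closed_under ?X G \<and> intertwines ?X (iota2 n) G G \<and> commute_on ?X G (on_second k)"
    using g(2)
  proof
    assume "G = on_first g"
    then show ?thesis using g gk by (simp add: first_def)
  next
    assume G0: "G = conjugate_by ?X (iota1 n) (on_first g)"
    have c: "closed_under ?X (on_first g)" and t: "intertwines ?X (iota2 n) (on_first g) (on_first g)"
      using g(1) by (simp_all add: first_def)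
    have t1: "intertwines ?X (iota1 n) (on_first g) G" unfolding G0 by (rule intertwines_conjugate[OF h1])
    have "intertwines ?X (iota2 n) G G"
      unfolding intertwines_def
    proof
      fix b assume "b \<in> ?X"
      then obtain a where a: "a \<in> ?X" "b = iota1 n a" using h1 unfolding bij_betw_def by (metis imageE)
      have "G (iota2 n b) = map_option (iota1 n \<circ> iota2 n) (on_first g a)"
        using a t1 t iota_in(2)[OF n1 a(1)] iota_commute[OF n1 a(1)]
        by (simp add: intertwines_def option.map_comp flip: iota_commute[OF n1 a(1)])
      also have "\<dots> = map_option (iota2 n \<circ> iota1 n) (on_first g a)"
      proof (rule option.map_cong[OF refl])
        fix z assume "z \<in> set_option (on_first g a)"
        then have "z \<in> ?X" using closed_underD[OF c a(1)] by simp
        then show "(iota1 n \<circ> iota2 n) z = (iota2 n \<circ> iota1 n) z" using iota_commute[OF n1] by simp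
      qed
      also have "\<dots> = map_option (iota2 n) (G b)"
        using a t1 by (simp add: intertwines_def option.map_comp)
      finally show "G (iota2 n b) = map_option (iota2 n) (G b)" .
    qed
    moreover have "commute_on ?X G (on_second k)"
      using commute_on_transport[OF h1 t1 c _ _ gk] second[OF k(1)] by blast
    ultimately show ?thesis using intertwines_closed[OF h1 t1 c] by blast
  qed
  show ?thesis
    using k(2)
  proof
    assume "H = on_second k"
    then show ?thesis using G2 by simp
  next
    assume H0: "H = conjugate_by ?X (iota2 n) (on_second k)"
    show ?thesis
      unfolding H0 using commute_on_transport[OF h2 _ _ intertwines_conjugate[OF h2]] G2 second[OF k(1)] by blast
  qed
qed

theorem theorem6p8:
  fixes n :: nat
  assumes "n \<ge> 2"
  shows "(\<forall>G\<in>operator_family n (E1 n) (F1 n). \<forall>H\<in>operator_family n (E2 n) (F2 n).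
            commute_on (tableau_pairs n) G H) \<and>
         affine_crystal n (tableau_pairs n) (E1 n) (F1 n) wt1 \<and>
         affine_crystal n (tableau_pairs n) (E2 n) (F2 n) wt2"
  using families_commute[OF assms] affine_crystals[OF assms] by blast

end
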